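(* Set $a_1=a_2=0$. Let $\mathcal R_f(t),\mathcal F_{0,f}(t)$ be obtained from $\mathcal R,\mathcal F_0\in\mathbb Q[[a_1,a_2,\dots]]$ by putting $a_1=a_2=0$ and substituting $a_nt^{n/2-1}$ for $a_n$, for all $n\ge3$. Then, as formal power series, $$\mathcal F_{0,f}(t)=\frac1{t^2}\int_0^t(t-s)\log\mathcal R_f(s)\,ds.$$ In particular $(t^2\mathcal F_{0,f})''=\log\mathcal R_f(t)$, where $'$ denotes the derivative with respect to $t$.
   Context: $\mathcal A=\mathbb Q[[a_1,a_2,\dots]]$ is the ring of formal power series in infinitely many variables, $\mathcal A^+$ the series with zero constant term. $(\mathcal R,\mathcal S)$ is the unique pair with $\mathcal R\in1+\mathcal A^+$, $\mathcal S\in\mathcal A^+$ satisfying $$\mathcal R=1+\sum_{n\ge1}a_n\sum_{j\ge1}\binom{n-1}{j-1}\binom{n-j}{j}\mathcal R^j\mathcal S^{n-2j},\qquad \mathcal S=\sum_{n\ge1}a_n\sum_{j\ge0}\binom{n-1}{2j}\binom{2j}{j}\mathcal R^j\mathcal S^{n-2j-1}.$$ Let $\mathcal H_N$ be the space of $N\times N$ Hermitian matrices and $$\mathcal Z=\frac{\int_{\mathcal H_N}\exp\!\big(-N\,\mathrm{Tr}\,(M^2/2)+N\sum_{n\ge1}\frac{a_n}{n}\mathrm{Tr}(M^n)\big)dM}{\int_{\mathcal H_N}\exp(-N\,\mathrm{Tr}(M^2/2))dM},$$ where the factor $\exp(N\sum_n\frac{a_n}{n}\mathrm{Tr}(M^n))$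 is expanded as a power series in the $a_n$ and integrated coefficient by coefficient against the normalized Gaussian. Then $\mathcal F=\log\mathcal Z\in N^2\mathcal A[[1/N^2]]$, written $\mathcal F=\sum_{g\ge0}N^{2-2g}\mathcal F_g$ with $\mathcal F_g\in\mathcal A$; $\mathcal F_0$ is the formal planar limit. Integrals, derivatives and logarithms of formal power series in $t$ (with constant term $1$ for the logarithm) are taken formally. *)

theory Defs
  imports
    "HOL-Probability.Probability"
    "HOL-Computational_Algebra.Computational_Algebra"
    "HOL-Library.Multiset"
    "Jordan_Normal_Form.Matrix"
begin

section \<open>Formal power series in the variables a_1, a_2, ...\<close>

text \<open>
  A monomial is a multiset of natural numbers, in which the number i stands for the variable
  a_{i+1}; so the variables are exactly a_1, a_2, ... . A series is an arbitrary family of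
  coefficients.
\<close>

typedef 'a mpser = "UNIV :: (nat multiset \<Rightarrow> 'a) set"
  morphisms mcoeff Abs_mpser ..

setup_lifting type_definition_mpser

lemma mpser_eqI: "(\<And>m. mcoeff f m = mcoeff g m) \<Longrightarrow> f = g"
  by (simp add: mcoeff_inject[symmetric] fun_eq_iff)

lemma mcoeff_Abs [simp]: "mcoeff (Abs_mpser c) m = c m"
  by (simp add: Abs_mpser_inverse)

lemma finite_submultisets: "finite {u. u \<subseteq># (m :: 'b multiset)}"
proof (induction m)
  case empty
  then show ?case by simp
next
  case (add x m)
  have "{u. u \<subseteq># add_mset x m} \<subseteq> {u. u \<subseteq># m} \<union> add_mset x ` {u. u \<subseteq># m}"
  proof
    fix u assume u: "u \<in> {u. u \<subseteq># add_mset x m}"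
    show "u \<in> {u. u \<subseteq># m} \<union> add_mset x ` {u. u \<subseteq># m}"
    proof (cases "x \<in># u")
      case True
      then obtain v where "u = add_mset x v" by (blast dest: multi_member_split)
      with u show ?thesis by simp
    next
      case False
      with u have "u \<subseteq># m"
        by (intro mset_subset_eqI)
          (metis count_add_mset count_eq_zero_iff le0 mem_Collect_eq mset_subset_eq_count)
      then show ?thesis by simp
    qed
  qed
  with add show ?case by (meson finite_UnI finite_imageI finite_subset)
qed

instantiation mpser :: (comm_ring_1) comm_ring_1
begin

lift_definition zero_mpser :: "'a mpser" is "\<lambda>_. 0" .
lift_definition one_mpser :: "'a mpser" is "\<lambda>m. if m = {#} then 1 else 0" .
lift_definition plus_mpser :: "'a mpser \<Rightarrow> 'a mpser \<Rightarrow> 'a mpser" is "\<lambda>f g m. f m + g m" .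
lift_definition minus_mpser :: "'a mpser \<Rightarrow> 'a mpser \<Rightarrow> 'a mpser" is "\<lambda>f g m. f m - g m" .
lift_definition uminus_mpser :: "'a mpser \<Rightarrow> 'a mpser" is "\<lambda>f m. - f m" .
lift_definition times_mpser :: "'a mpser \<Rightarrow> 'a mpser \<Rightarrow> 'a mpser"
  is "\<lambda>f g m. \<Sum>u | u \<subseteq># m. f u * g (m - u)" .

instance
proof
  fix f g h :: "'a mpser"
  show "f * g * h = f * (g * h)"
  proof (rule mpser_eqI)
    fix m
    let ?F = "mcoeff f" and ?G = "mcoeff g" and ?H = "mcoeff h"
    have "mcoeff (f * g * h) m =
        (\<Sum>w | w \<subseteq># m. \<Sum>u | u \<subseteq># w. ?F u * ?G (w - u) * ?H (m - w))"
      by (simp add: times_mpser.rep_eq sum_distrib_right)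
    also have "\<dots> = (\<Sum>(w, u) \<in> (SIGMA w:{w. w \<subseteq># m}. {u. u \<subseteq># w}).
        ?F u * ?G (w - u) * ?H (m - w))"
      by (simp add: sum.Sigma finite_submultisets)
    also have "\<dots> = (\<Sum>(u, v) \<in> (SIGMA u:{u. u \<subseteq># m}. {v. v \<subseteq># m - u}).
        ?F u * ?G v * ?H (m - u - v))"
    proof (rule sum.reindex_bij_witness[where
            i = "\<lambda>(u, v). (u + v, u)" and j = "\<lambda>(w, u). (u, w - u)"], goal_cases)
      case (2 p)
      obtain w u where p: "p = (w, u)" by fastforce
      with 2 have w: "w \<subseteq># m" and u: "u \<subseteq># w" by auto
      have "w - u \<subseteq># m - u"
        using w by (auto simp: subseteq_mset_def diff_le_mono)
      with p w u show ?case by (auto intro: subset_mset.order_trans)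
    next
      case (4 p)
      obtain u v where p: "p = (u, v)" by fastforce
      with 4 have u: "u \<subseteq># m" and v: "v \<subseteq># m - u" by auto
      have "u + v \<subseteq># u + (m - u)"
        using v by simp
      with u have "u + v \<subseteq># m" by simp
      with p show ?case by simp
    qed auto
    also have "\<dots> = (\<Sum>u | u \<subseteq># m. \<Sum>v | v \<subseteq># m - u. ?F u * ?G v * ?H (m - u - v))"
      by (simp add: sum.Sigma finite_submultisets)
    also have "\<dots> = mcoeff (f * (g * h)) m"
      by (simp add: times_mpser.rep_eq sum_distrib_left mult.assoc)
    finally show "mcoeff (f * g * h) m = mcoeff (f * (g * h)) m" .
  qed
  show "f * g = g * f"
  proof (rule mpser_eqI)
    fix m :: "nat multiset"
    have inv: "m - (m - u) = u" if "u \<subseteq># m" for u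
      using that by (auto simp: multiset_eq_iff subseteq_mset_def)
    show "mcoeff (f * g) m = mcoeff (g * f) m"
      unfolding times_mpser.rep_eq
      by (rule sum.reindex_bij_witness[where i = "\<lambda>u. m - u" and j = "\<lambda>u. m - u"])
        (auto simp: mult.commute inv)
  qed
  show "1 * f = f"
  proof (rule mpser_eqI)
    fix m
    have "mcoeff (1 * f) m = (\<Sum>u | u \<subseteq># m. if u = {#} then mcoeff f m else 0)"
      unfolding times_mpser.rep_eq one_mpser.rep_eq by (rule sum.cong) auto
    then show "mcoeff (1 * f) m = mcoeff f m"
      by (simp add: finite_submultisets)
  qed
  show "(f + g) * h = f * h + g * h"
    by (rule mpser_eqI) (simp add: times_mpser.rep_eq plus_mpser.rep_eq distrib_right sum.distrib)
  show "(0 :: 'a mpser) \<noteq> 1"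
    by (metis one_mpser.rep_eq zero_mpser.rep_eq zero_neq_one)
qed (rule mpser_eqI, simp add: plus_mpser.rep_eq minus_mpser.rep_eq uminus_mpser.rep_eq
      zero_mpser.rep_eq)+

end

definition mconst :: "'a::zero \<Rightarrow> 'a mpser" where
  "mconst c = Abs_mpser (\<lambda>m. if m = {#} then c else 0)"

definition const_term :: "'a mpser \<Rightarrow> 'a" where
  "const_term f = mcoeff f {#}"

text \<open>The variable a_n, for n at least 1.\<close>

definition avar :: "nat \<Rightarrow> 'a::comm_ring_1 mpser" where
  "avar n = Abs_mpser (\<lambda>m. if m = {#n - 1#} then 1 else 0)"

text \<open>
  The formal sum of a family in which each monomial has a nonzero coefficient in only finitely
  many members (all families below are of this kind).
\<close>

definition formal_sum :: "nat set \<Rightarrow> (nat \<Rightarrow> 'a::comm_ring_1 mpser) \<Rightarrow> 'a mpser" where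
  "formal_sum I f = Abs_mpser (\<lambda>m. \<Sum>n | n \<in> I \<and> mcoeff (f n) m \<noteq> 0. mcoeff (f n) m)"

text \<open>Substitution of a series without constant term into a univariate series.\<close>

definition mcompose :: "'a::comm_ring_1 fps \<Rightarrow> 'a mpser \<Rightarrow> 'a mpser" where
  "mcompose P f = formal_sum UNIV (\<lambda>k. mconst (fps_nth P k) * f ^ k)"

text \<open>\<open>fps_exp 1\<close> is the series exp x, and \<open>fps_ln 1\<close> is the series log (1 + x).\<close>

definition mexp :: "'a::field_char_0 mpser \<Rightarrow> 'a mpser" where
  "mexp f = mcompose (fps_exp 1) f"

definition mlog :: "'a::field_char_0 mpser \<Rightarrow> 'a mpser" where
  "mlog f = mcompose (fps_ln 1) (f - 1)"


section \<open>The series R and S\<close>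

text \<open>
  The inner sums are cut at j = n: the omitted terms have a vanishing first binomial coefficient.
  When one of the natural-number exponents of S is truncated, the product of the two binomial
  coefficients is zero.
\<close>

definition RS_system :: "rat mpser \<Rightarrow> rat mpser \<Rightarrow> bool" where
  "RS_system R S \<longleftrightarrow>
     const_term R = 1 \<and> const_term S = 0 \<and>
     R = 1 + formal_sum {1..} (\<lambda>n. avar n *
           (\<Sum>j = 1..n. of_nat (((n - 1) choose (j - 1)) * ((n - j) choose j))
                          * R ^ j * S ^ (n - 2 * j))) \<and>
     S = formal_sum {1..} (\<lambda>n. avar n *
           (\<Sum>j = 0..n. of_nat (((n - 1) choose (2 * j)) * ((2 * j) choose j))
                          * R ^ j * S ^ (n - 2 * j - 1)))"

definition R_ser :: "rat mpser" where
  "R_ser = fst (THE (R, S). RS_system R S)"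

definition S_ser :: "rat mpser" where
  "S_ser = snd (THE (R, S). RS_system R S)"


section \<open>The Hermitian matrix integral and its genus expansion\<close>

definition hermitian_matrices :: "nat \<Rightarrow> complex mat set" where
  "hermitian_matrices N =
     {M \<in> carrier_mat N N. \<forall>i<N. \<forall>j<N. M $$ (j, i) = cnj (M $$ (i, j))}"

definition trace_mat :: "'a::comm_monoid_add mat \<Rightarrow> 'a" where
  "trace_mat M = (\<Sum>i<dim_row M. M $$ (i, i))"

text \<open>
  The real coordinates of a Hermitian matrix: x (i, i) is the i-th diagonal entry and, for i < j,
  x (i, j) and x (j, i) are the real and the imaginary part of the (i, j) entry.
\<close>

definition hermitian_of_coords :: "nat \<Rightarrow> (nat \<times> nat \<Rightarrow> real) \<Rightarrow> complex mat" where
  "hermitian_of_coords N x = mat N N (\<lambda>(i, j).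
     if i < j then Complex (x (i, j)) (x (j, i))
     else if i = j then complex_of_real (x (i, i))
     else Complex (x (j, i)) (- x (i, j)))"

definition hermitian_lebesgue :: "nat \<Rightarrow> complex mat measure" where
  "hermitian_lebesgue N =
     embed_measure (\<Pi>\<^sub>M p \<in> {..<N} \<times> {..<N}. lborel) (hermitian_of_coords N)"

lemma hermitian_of_coords_inj:
  "inj_on (hermitian_of_coords N) (space (\<Pi>\<^sub>M p \<in> {..<N} \<times> {..<N}. (lborel :: real measure)))"
proof (rule inj_onI)
  fix x y :: "nat \<times> nat \<Rightarrow> real"
  assume x: "x \<in> space (\<Pi>\<^sub>M p \<in> {..<N} \<times> {..<N}. lborel)"
    and y: "y \<in> space (\<Pi>\<^sub>M p \<in> {..<N} \<times> {..<N}. lborel)"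
    and eq: "hermitian_of_coords N x = hermitian_of_coords N y"
  have *: "hermitian_of_coords N x $$ (i, j) = hermitian_of_coords N y $$ (i, j)" for i j
    using eq by simp
  have "x (i, j) = y (i, j)" if "i < N" "j < N" for i j
    using *[of i j] *[of j i] that
    by (cases i j rule: linorder_cases) (auto simp: hermitian_of_coords_def)
  moreover have "x p = undefined" "y p = undefined" if "p \<notin> {..<N} \<times> {..<N}" for p
    using x y PiE_arb[OF _ that] by (simp_all only: space_PiM)
  ultimately show "x = y"
    by (intro ext) (metis lessThan_iff mem_Sigma_iff prod.exhaust)
qed

lemma space_hermitian_lebesgue: "space (hermitian_lebesgue N) = hermitian_matrices N"
proof (intro equalityI subsetI)
  fix M assume "M \<in> space (hermitian_lebesgue N)"
  then obtain x where "M = hermitian_of_coords N x"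
    by (auto simp: hermitian_lebesgue_def space_embed_measure)
  then show "M \<in> hermitian_matrices N"
    by (auto simp: hermitian_matrices_def hermitian_of_coords_def complex_eq_iff)
next
  fix M assume M: "M \<in> hermitian_matrices N"
  define x where "x = (\<lambda>p \<in> {..<N} \<times> {..<N}. case p of (i, j) \<Rightarrow>
    if i \<le> j then Re (M $$ (i, j)) else Im (M $$ (j, i)))"
  have cnj: "M $$ (j, i) = cnj (M $$ (i, j))" if "i < N" "j < N" for i j
    using M that unfolding hermitian_matrices_def by blast
  have "M = hermitian_of_coords N x"
  proof (rule eq_matI)
    fix i j assume "i < dim_row (hermitian_of_coords N x)" "j < dim_col (hermitian_of_coords N x)"
    then have ij: "i < N" "j < N" by (auto simp: hermitian_of_coords_def)
    show "M $$ (i, j) = hermitian_of_coords N x $$ (i, j)"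
    proof (cases i j rule: linorder_cases)
      case less
      with ij show ?thesis by (simp add: hermitian_of_coords_def x_def)
    next
      case equal
      have "Im (M $$ (i, i)) = 0"
        using arg_cong[OF cnj[of i i], of Im] ij by simp
      with equal ij show ?thesis
        by (simp add: hermitian_of_coords_def x_def complex_eq_iff)
    next
      case greater
      with ij show ?thesis
        by (simp add: hermitian_of_coords_def x_def cnj[of j i] complex_eq_iff)
    qed
  qed (use M in \<open>auto simp: hermitian_matrices_def hermitian_of_coords_def\<close>)
  moreover have "x \<in> space (\<Pi>\<^sub>M p \<in> {..<N} \<times> {..<N}. lborel)"
    by (auto simp: space_PiM x_def)
  ultimately show "M \<in> space (hermitian_lebesgue N)"
    by (auto simp: hermitian_lebesgue_def space_embed_measure)
qed

text \<open>The weight exp (N sum_n a_n/n Tr (M^n)), a series in the a_n for each matrix M.\<close>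

definition potential_weight :: "nat \<Rightarrow> complex mat \<Rightarrow> complex mpser" where
  "potential_weight N M =
     mexp (formal_sum {1..} (\<lambda>n. mconst (of_nat N / of_nat n * trace_mat (M ^\<^sub>m n)) * avar n))"

definition gaussian_weight :: "nat \<Rightarrow> complex mat \<Rightarrow> complex" where
  "gaussian_weight N M = exp (- of_nat N * (trace_mat (M ^\<^sub>m 2) / 2))"

definition partition_function :: "nat \<Rightarrow> complex mpser" where
  "partition_function N = Abs_mpser (\<lambda>m.
     (LINT M | hermitian_lebesgue N. gaussian_weight N M * mcoeff (potential_weight N M) m)
     / (LINT M | hermitian_lebesgue N. gaussian_weight N M))"

text \<open>
  The expansion log Z = sum_g N^(2-2g) F_g in N^2 A[[1/N^2]]. The coefficient of each monomial in
  the a_n is N^2 times a polynomial in 1/N^2, so that the identity makes sense, and is required,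
  for every actual matrix size N.
\<close>

definition genus_expansion :: "(nat \<Rightarrow> rat mpser) \<Rightarrow> bool" where
  "genus_expansion F \<longleftrightarrow>
     (\<forall>m. finite {g. mcoeff (F g) m \<noteq> 0} \<and>
       (\<forall>N\<ge>1. mcoeff (mlog (partition_function N)) m =
          (\<Sum>g | mcoeff (F g) m \<noteq> 0.
             of_nat N powi (2 - 2 * int g) * of_rat (mcoeff (F g) m))))"

definition free_energy :: "nat \<Rightarrow> rat mpser" where
  "free_energy = (THE F. genus_expansion F)"


section \<open>The scaled series in t\<close>

text \<open>
  The substitution a_1 = a_2 = 0 and a_n to a_n u^(n-2) for n at least 3, where u = t^(1/2).
\<close>

definition scale_sqrt :: "'a::comm_ring_1 mpser \<Rightarrow> 'a mpser fps" where
  "scale_sqrt f = Abs_fps (\<lambda>k. Abs_mpser (\<lambda>m.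
     let ns = image_mset Suc m in
       if (\<forall>n \<in># ns. n \<ge> 3) \<and> (\<Sum>n \<in># ns. n - 2) = k then mcoeff f m else 0))"

text \<open>The result as a power series P in t, that is, P(u^2) is the series in u above.\<close>

definition scale_t :: "'a::comm_ring_1 mpser \<Rightarrow> 'a mpser fps" where
  "scale_t f = (THE P. fps_compose P (fps_X ^ 2) = scale_sqrt f)"

definition fps_log :: "'a::field_char_0 mpser fps \<Rightarrow> 'a mpser fps" where
  "fps_log f = fps_compose (Abs_fps (\<lambda>k. mconst (fps_nth (fps_ln 1) k))) (f - 1)"

text \<open>
  The integral from 0 to t; \<open>fps_integral\<close> is not available because it needs inverses
  in the coefficient ring.
\<close>

definition fps_int0 :: "'a::field_char_0 mpser fps \<Rightarrow> 'a mpser fps" where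
  "fps_int0 f = Abs_fps (\<lambda>k. if k = 0 then 0 else mconst (1 / of_nat k) * fps_nth f (k - 1))"

text \<open>
  In the formal integral of (t - s) g(s) over s from 0 to t, the variable t is a constant for the
  integration in s.
\<close>

definition fps_int_kernel :: "'a::field_char_0 mpser fps \<Rightarrow> 'a mpser fps" where
  "fps_int_kernel g = fps_X * fps_int0 g - fps_int0 (fps_X * g)"

definition R_f :: "rat mpser fps" where
  "R_f = scale_t R_ser"

definition F0_f :: "rat mpser fps" where
  "F0_f = scale_t (free_energy 0)"

end

(*
  The matrix integral enters only through its loop equations, which follow from integration by
  parts for the Gaussian measure. Written for log Z they determine the moments w_n = (n/N^2) dF/da_n
  recursively, with 1/N^2 as the only parameter; hence every coefficient of log Z is N^2 times a
  polynomial in 1/N^2, and at 1/N^2 = 0 the generating function W(x) = sum_n w_n x^(-n-1) satisfies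
  the quadratic equation W^2 - V' W = (polynomial in x).

  That equation is solved by W = (V' - M sqrt q)/2 with q = (x - S)^2 - 4 R and M the polynomial part
  of V'/sqrt q: the equations for R and S say precisely that W = 1/x + O(x^-2). Let D be the
  derivation t d/dt of the scaling a_n -> t^(n/2-1) a_n. Comparing polynomial parts gives
  (D + 1 + n/2) w_n = c_n, where sum_n c_n x^(-n-1) = 1/sqrt q, and (D + n/2) c_n = n d(log R)/da_n.
  As n dF_0/da_n = w_n, it follows that (D + 1)(D + 2) F_0 = log R, and (D + 1)(D + 2) is the operator
  F |-> (t^2 F)''.
*)
theory Submission
  imports Defs
begin

section \<open>Series in infinitely many variables\<close>

text \<open>The calculus with sqrt q needs a potential that is polynomial in x, whereas V' has
  infinitely many terms. The planar analysis is therefore carried out in any commutative ring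
  containing 1/2, with finitely many couplings. Setting a_n = 0 for n > K is a ring homomorphism
  into this situation, and a given coefficient does not notice it once K is large. Division is
  avoided throughout: sqrt q is written q * C, and logarithmic derivatives are stated after
  multiplication by the series. The link between c_n and log R arises as follows. Apply the Euler
  derivation and a_n d/da_n to V' - 2 W = M sqrt q and multiply by sqrt q: both give polynomial
  identities in x. Eliminating M modulo q leaves a constant multiple of q, and comparing powers of x
  - S yields a_n dR/da_n. No matrix size has 1/N^2 = 0. The planar limit is reached because one
  rational polynomial in 1/N^2 serves all N and is determined by its infinitely many values, so that
  equations between these polynomials can be read at 0.\<close>

lemma mcoeff_simps [simp]:
  "mcoeff 0 m = 0"
  "mcoeff (f + g) m = mcoeff f m + mcoeff g m"
  "mcoeff (f - g) m = mcoeff f m - mcoeff g m"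
  "mcoeff (- f) m = - mcoeff f m"
  by (simp_all add: zero_mpser.rep_eq plus_mpser.rep_eq minus_mpser.rep_eq uminus_mpser.rep_eq)

lemma mcoeff_one: "mcoeff 1 m = (if m = {#} then 1 else 0)"
  by (simp add: one_mpser.rep_eq)

lemma mcoeff_mult: "mcoeff (f * g) m = (\<Sum>u | u \<subseteq># m. mcoeff f u * mcoeff g (m - u))"
  by (simp add: times_mpser.rep_eq)

lemma mcoeff_sum: "mcoeff (\<Sum>i\<in>I. f i) m = (\<Sum>i\<in>I. mcoeff (f i) m)"
  by (induction I rule: infinite_finite_induct) auto

lemma mcoeff_mconst: "mcoeff (mconst c) m = (if m = {#} then c else 0)"
  by (simp add: mconst_def)

lemma mcoeff_mconst_mult [simp]: "mcoeff (mconst c * f) m = c * mcoeff f m"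
proof -
  have "mcoeff (mconst c * f) m = (\<Sum>u | u \<subseteq># m. if u = {#} then c * mcoeff f m else 0)"
    unfolding mcoeff_mult by (rule sum.cong) (auto simp: mcoeff_mconst)
  then show ?thesis by (simp add: finite_submultisets)
qed

lemma mcoeff_mult_mconst [simp]: "mcoeff (f * mconst c) m = mcoeff f m * c"
  by (metis mcoeff_mconst_mult mult.commute)

lemma mconst_0: "mconst 0 = 0" and mconst_1: "mconst 1 = 1"
  by (rule mpser_eqI, simp add: mcoeff_mconst mcoeff_one)+

lemma mconst_add: "mconst (a + b) = mconst a + mconst b"
  by (rule mpser_eqI) (simp add: mcoeff_mconst)

lemma mconst_mult: "mconst (a * b) = mconst a * mconst b"
  by (rule mpser_eqI) (simp add: mcoeff_mconst)

lemma of_nat_mpser: "of_nat n = mconst (of_nat n)"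
  by (induction n) (simp_all add: mconst_0 mconst_1 mconst_add)

lemma numeral_mpser: "numeral n = mconst (numeral n)"
  using of_nat_mpser[of "numeral n"] by simp

lemma mcoeff_of_nat_mult [simp]: "mcoeff (of_nat n * f) m = of_nat n * mcoeff f m"
  by (simp add: of_nat_mpser)

lemma mcoeff_numeral_mult [simp]: "mcoeff (numeral n * f) m = numeral n * mcoeff f m"
  by (simp add: numeral_mpser)

lemma mcoeff_avar_mult:
  "mcoeff (avar n * f) m = (if n - 1 \<in># m then mcoeff f (m - {#n - 1#}) else 0)"
proof -
  have "mcoeff (avar n * f) m =
      (\<Sum>u | u \<subseteq># m. if u = {#n - 1#} then mcoeff f (m - {#n - 1#}) else 0)"
    unfolding mcoeff_mult by (rule sum.cong) (auto simp: avar_def)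
  then show ?thesis
    by (simp add: finite_submultisets)
qed

text \<open>Multiplication by a variable only relabels coefficients, so nothing is lost.\<close>

lemma avar_mult_cancel:
  assumes "avar n * f = avar n * g"
  shows "f = g"
proof (rule mpser_eqI)
  fix m :: "nat multiset"
  have "mcoeff (avar n * f) (add_mset (n - 1) m) = mcoeff (avar n * g) (add_mset (n - 1) m)"
    using assms by simp
  then show "mcoeff f m = mcoeff g m"
    by (simp add: mcoeff_avar_mult)
qed

lemma const_term_zero [simp]: "const_term 0 = 0"
  by (simp add: const_term_def)

text \<open>By induction on the size of \<open>m\<close>: the coefficient of the product at
  \<open>m\<close> is that of \<open>f\<close> plus terms with smaller coefficients of
  \<open>f\<close>, which are already zero. This replaces division by series such as Z and
  R.\<close>

lemma mpser_unit_cancel: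
  fixes f g :: "'a::comm_ring_1 mpser"
  assumes "f * g = 0" "const_term g = 1"
  shows "f = 0"
proof (rule mpser_eqI)
  fix m :: "nat multiset"
  show "mcoeff f m = mcoeff 0 m"
  proof (induction m rule: measure_induct_rule[where f = size])
    case (less m)
    have "0 = mcoeff (f * g) m" using assms by simp
    also have "\<dots> = (\<Sum>u | u \<subseteq># m. if u = m then mcoeff f m else 0)"
      unfolding mcoeff_mult
    proof (rule sum.cong)
      fix u assume "u \<in> {u. u \<subseteq># m}"
      then have u: "u \<subseteq># m" by simp
      show "mcoeff f u * mcoeff g (m - u) = (if u = m then mcoeff f m else 0)"
      proof (cases "u = m")
        case True
        then show ?thesis using assms(2) by (simp add: const_term_def)
      next
        case False
        then have "size u < size m"
          using u by (simp add: mset_subset_size subset_mset.less_le)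
        then show ?thesis using less False by simp
      qed
    qed simp
    finally show ?case by (simp add: finite_submultisets)
  qed
qed

lemma mpser_unit_cancel_eq:
  fixes f g h :: "'a::comm_ring_1 mpser"
  assumes "f * g = h * g" "const_term g = 1"
  shows "f = h"
  using mpser_unit_cancel[of "f - h" g] assms by (simp add: left_diff_distrib)

lemma mcoeff_power_eq_0:
  assumes "const_term f = 0" "size m < k"
  shows "mcoeff (f ^ k) m = 0"
  using assms(2)
proof (induction k arbitrary: m)
  case (Suc k)
  have "mcoeff f u * mcoeff (f ^ k) (m - u) = 0" if "u \<subseteq># m" for u
  proof (cases "u = {#}")
    case True
    then show ?thesis using assms(1) by (simp add: const_term_def)
  next
    case False
    then have "size (m - u) < k"
      using Suc.prems that size_Diff_submset[OF that] size_mset_mono[OF that]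
      by (cases "size u") auto
    then show ?thesis using Suc.IH by simp
  qed
  then show ?case by (simp add: mcoeff_mult)
qed simp

section \<open>Coefficients of formal sums and of compositions\<close>

lemma mcoeff_formal_sum:
  assumes "finite S" "S \<subseteq> I" "\<And>n. n \<in> I - S \<Longrightarrow> mcoeff (f n) m = 0"
  shows "mcoeff (formal_sum I f) m = (\<Sum>n\<in>S. mcoeff (f n) m)"
  unfolding formal_sum_def mcoeff_Abs
  by (rule sum.mono_neutral_left) (use assms in auto)

text \<open>The factor a_n confines the infinite sum to the variables that occur in
  \<open>m\<close>, and removing one of them shrinks the monomial. All defining equations become
  recursions in this way.\<close>

lemma mcoeff_formal_sum_avar:
  "mcoeff (formal_sum {1..} (\<lambda>n. avar n * g n)) m =
     (\<Sum>i\<in>set_mset m. mcoeff (g (Suc i)) (m - {#i#}))"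
proof -
  have "mcoeff (formal_sum {1..} (\<lambda>n. avar n * g n)) m =
      (\<Sum>n\<in>Suc ` set_mset m. mcoeff (avar n * g n) m)"
  proof (rule mcoeff_formal_sum)
    fix n assume n: "n \<in> {1..} - Suc ` set_mset m"
    then have "n - 1 \<notin># m" by (cases n) auto
    then show "mcoeff (avar n * g n) m = 0" by (simp add: mcoeff_avar_mult)
  qed auto
  also have "\<dots> = (\<Sum>i\<in>set_mset m. mcoeff (g (Suc i)) (m - {#i#}))"
    by (simp add: sum.reindex mcoeff_avar_mult)
  finally show ?thesis .
qed

text \<open>The bound \<open>B\<close> may exceed \<open>size m\<close>, so that one bound serves
  all sub-multisets of a monomial and can be shifted by one.\<close>

lemma mcoeff_mcompose:
  assumes "const_term f = 0" "size m \<le> B"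
  shows "mcoeff (mcompose P f) m = (\<Sum>k\<le>B. fps_nth P k * mcoeff (f ^ k) m)"
proof -
  have "mcoeff (mcompose P f) m = (\<Sum>k\<in>{..B}. mcoeff (mconst (fps_nth P k) * f ^ k) m)"
    unfolding mcompose_def
  proof (rule mcoeff_formal_sum)
    fix k assume "k \<in> UNIV - {..B}"
    then have "size m < k" using assms(2) by auto
    then show "mcoeff (mconst (fps_nth P k) * f ^ k) m = 0"
      using mcoeff_power_eq_0[OF assms(1)] by simp
  qed auto
  then show ?thesis by simp
qed

text \<open>For additive \<open>l\<close> this is a derivation, for example \<open>a\<^sub>n d/da\<^sub>n\<close> or an Euler operator.\<close>

definition mdiag :: "(nat multiset \<Rightarrow> 'a) \<Rightarrow> 'a::comm_ring_1 mpser \<Rightarrow> 'a mpser" where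
  "mdiag l f = Abs_mpser (\<lambda>m. l m * mcoeff f m)"

definition additive_weight :: "(nat multiset \<Rightarrow> 'a::comm_ring_1) \<Rightarrow> bool" where
  "additive_weight l \<longleftrightarrow> (\<forall>u v. l (u + v) = l u + l v)"

lemma mcoeff_mdiag [simp]: "mcoeff (mdiag l f) m = l m * mcoeff f m"
  by (simp add: mdiag_def)

lemma additive_weight_empty: "additive_weight l \<Longrightarrow> l {#} = 0"
  unfolding additive_weight_def by (metis add_cancel_right_right)

lemma mdiag_add: "mdiag l (f + g) = mdiag l f + mdiag l g"
  by (rule mpser_eqI) (simp add: distrib_left)

lemma mdiag_diff: "mdiag l (f - g) = mdiag l f - mdiag l g"
  by (rule mpser_eqI) (simp add: right_diff_distrib)

lemma mdiag_mult:
  assumes "additive_weight l"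
  shows "mdiag l (f * g) = mdiag l f * g + f * mdiag l g"
proof (rule mpser_eqI)
  fix m :: "nat multiset"
  have "l m = l u + l (m - u)" if "u \<subseteq># m" for u
    using assms that unfolding additive_weight_def by (metis subset_mset.add_diff_inverse)
  then show "mcoeff (mdiag l (f * g)) m = mcoeff (mdiag l f * g + f * mdiag l g) m"
    unfolding mcoeff_mdiag mcoeff_simps mcoeff_mult sum_distrib_left sum.distrib[symmetric]
    by (intro sum.cong) (simp_all add: algebra_simps)
qed

lemma mdiag_mconst: "additive_weight l \<Longrightarrow> mdiag l (mconst c) = 0"
  by (rule mpser_eqI) (simp add: mcoeff_mconst additive_weight_empty)

lemma mdiag_one: "additive_weight l \<Longrightarrow> mdiag l 1 = 0"
  using mdiag_mconst[of l 1] by (simp add: mconst_1)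

lemma mdiag_avar: "mdiag l (avar n) = mconst (l {#n - 1#}) * avar n"
  by (rule mpser_eqI) (auto simp: avar_def)

lemma mdiag_power:
  assumes "additive_weight l"
  shows "mdiag l (f ^ Suc k) = of_nat (Suc k) * (f ^ k * mdiag l f)"
proof (induction k)
  case (Suc k)
  have "mdiag l (f ^ Suc (Suc k)) = mdiag l f * f ^ Suc k + f * mdiag l (f ^ Suc k)"
    using assms by (simp add: mdiag_mult)
  then show ?case unfolding Suc.IH by (simp add: algebra_simps)
qed simp

lemma mdiag_mcompose:
  assumes l: "additive_weight l" and f: "const_term f = 0"
  shows "mdiag l (mcompose P f) = mcompose (fps_deriv P) f * mdiag l f"
proof (rule mpser_eqI)
  fix m :: "nat multiset"
  let ?n = "size m"
  have "mcoeff (mcompose (fps_deriv P) f * mdiag l f) m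
      = (\<Sum>u | u \<subseteq># m. \<Sum>k\<le>?n. fps_nth (fps_deriv P) k * (mcoeff (f ^ k) u * mcoeff (mdiag l f) (m - u)))"
    unfolding mcoeff_mult
  proof (rule sum.cong)
    fix u assume "u \<in> {u. u \<subseteq># m}"
    then have "size u \<le> ?n" by (simp add: size_mset_mono)
    then show "mcoeff (mcompose (fps_deriv P) f) u * mcoeff (mdiag l f) (m - u) =
      (\<Sum>k\<le>?n. fps_nth (fps_deriv P) k * (mcoeff (f ^ k) u * mcoeff (mdiag l f) (m - u)))"
      by (simp add: mcoeff_mcompose[OF f] sum_distrib_right mult.assoc)
  qed simp
  also have "\<dots> = (\<Sum>k\<le>?n. fps_nth (fps_deriv P) k * mcoeff (f ^ k * mdiag l f) m)"
    by (subst sum.swap) (simp add: mcoeff_mult sum_distrib_left)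
  also have "\<dots> = (\<Sum>k\<le>?n. fps_nth P (Suc k) * mcoeff (mdiag l (f ^ Suc k)) m)"
    by (intro sum.cong) (simp_all only: mdiag_power[OF l] mcoeff_of_nat_mult fps_deriv_nth, simp_all add: mult_ac)
  \<comment> \<open>The term \<open>k = 0\<close> adds nothing, because an additive weight vanishes
    on the empty monomial.\<close>
  also have "\<dots> = l m * (\<Sum>k\<le>Suc ?n. fps_nth P k * mcoeff (f ^ k) m)"
    by (subst sum.atMost_Suc_shift)
      (use l in \<open>simp add: sum_distrib_left distrib_left mult_ac mcoeff_one additive_weight_empty\<close>)
  also have "\<dots> = l m * mcoeff (mcompose P f) m"
    by (subst mcoeff_mcompose[OF f, of m "Suc ?n"]) auto
  finally show "mcoeff (mdiag l (mcompose P f)) m = mcoeff (mcompose (fps_deriv P) f * mdiag l f) m"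
    by simp
qed

lemma const_term_mcompose:
  assumes "const_term f = 0"
  shows "const_term (mcompose P f) = fps_nth P 0"
  using mcoeff_mcompose[OF assms, of "{#}" 0] by (simp add: const_term_def mcoeff_one)

lemma mdiag_mexp:
  assumes "additive_weight l" "const_term f = 0"
  shows "mdiag l (mexp f) = mexp f * mdiag l f"
  unfolding mexp_def by (subst mdiag_mcompose) (use assms in auto)

text \<open>The alternating geometric series is the derivative of log (1 + x); telescoping shows
  that it inverts 1 + f, which is what the logarithmic derivative requires.\<close>

lemma mcompose_geometric:
  assumes "const_term f = 0"
  shows "mcompose (Abs_fps (\<lambda>k. (- 1) ^ k)) f * (1 + f) = 1"
proof (rule mpser_eqI)
  fix m :: "nat multiset"
  let ?P = "Abs_fps (\<lambda>k. (- 1 :: 'a) ^ k)" and ?n = "size m"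
  have "mcoeff (mcompose ?P f * f) m
      = (\<Sum>u | u \<subseteq># m. \<Sum>k\<le>?n. (- 1) ^ k * (mcoeff (f ^ k) u * mcoeff f (m - u)))"
    unfolding mcoeff_mult
  proof (rule sum.cong)
    fix u assume "u \<in> {u. u \<subseteq># m}"
    then have "size u \<le> ?n" by (simp add: size_mset_mono)
    then show "mcoeff (mcompose ?P f) u * mcoeff f (m - u) =
      (\<Sum>k\<le>?n. (- 1) ^ k * (mcoeff (f ^ k) u * mcoeff f (m - u)))"
      by (simp add: mcoeff_mcompose[OF assms] sum_distrib_right mult.assoc)
  qed simp
  also have "\<dots> = (\<Sum>k\<le>?n. (- 1) ^ k * mcoeff (f ^ k * f) m)"
    by (subst sum.swap) (simp add: mcoeff_mult sum_distrib_left)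
  also have "\<dots> = - (\<Sum>k\<le>?n. (- 1) ^ Suc k * mcoeff (f ^ Suc k) m)"
    by (simp add: sum_negf mult.commute[of _ f])
  also have "(\<Sum>k\<le>?n. (- 1) ^ Suc k * mcoeff (f ^ Suc k) m) =
      (\<Sum>k\<le>Suc ?n. (- 1) ^ k * mcoeff (f ^ k) m) - mcoeff 1 m"
    by (subst sum.atMost_Suc_shift) simp
  also have "(\<Sum>k\<le>Suc ?n. (- 1) ^ k * mcoeff (f ^ k) m) = mcoeff (mcompose ?P f) m"
    by (subst mcoeff_mcompose[OF assms, of m "Suc ?n"]) auto
  finally show "mcoeff (mcompose ?P f * (1 + f)) m = mcoeff 1 m"
    by (simp add: distrib_left)
qed

lemma mdiag_mlog:
  assumes l: "additive_weight l" and f: "const_term f = 1"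
  shows "mdiag l (mlog f) * f = mdiag l f"
proof -
  have c: "const_term (f - 1) = 0" using f by (simp add: const_term_def mcoeff_one)
  have "fps_deriv (fps_ln 1) = Abs_fps (\<lambda>k. (- 1 :: 'a) ^ k)"
    by (rule fps_ext) (simp add: fps_ln_def del: of_nat_Suc)
  then have "mdiag l (mlog f) = mcompose (Abs_fps (\<lambda>k. (- 1) ^ k)) (f - 1) * mdiag l (f - 1)"
    unfolding mlog_def by (simp add: mdiag_mcompose[OF l c])
  then have "mdiag l (mlog f) * f =
      mcompose (Abs_fps (\<lambda>k. (- 1) ^ k)) (f - 1) * (1 + (f - 1)) * mdiag l (f - 1)"
    by (simp add: mult_ac)
  also have "\<dots> = mdiag l f"
    using mdiag_one[OF l] by (simp only: mcompose_geometric[OF c]) (simp add: mdiag_diff)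
  finally show ?thesis .
qed

lemma const_term_mlog: "const_term f = 1 \<Longrightarrow> const_term (mlog f) = 0"
  unfolding mlog_def
  by (subst const_term_mcompose) (auto simp: const_term_def mcoeff_one fps_ln_def)

lemma additive_weight_count: "additive_weight (\<lambda>m. of_nat (count m i))"
  by (simp add: additive_weight_def)

lemma additive_weight_sum_mset: "additive_weight (\<lambda>m. \<Sum>i\<in>#m. h i)"
  by (simp add: additive_weight_def)


section \<open>Diagonal trinomial coefficients\<close>

text \<open>Only the powers of \<open>v\<close> up to the n-th reach degree n, so both sides may be
  computed with polynomials in \<open>v\<close>, over any commutative ring.\<close>

lemma fps_compose_mult_distrib':
  fixes f g v :: "'a::comm_ring_1 fps"
  assumes v: "fps_nth v 0 = 0"
  shows "(f * g) oo v = (f oo v) * (g oo v)"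
proof (rule fps_ext)
  fix n
  have v_pow: "fps_nth (v ^ k) l = 0" if "l < k" for k l
    using startsby_zero_power_prefix[OF v] that by blast
  have nth: "fps_nth (h oo v) l = fps_nth (\<Sum>i\<le>n. fps_const (fps_nth h i) * v ^ i) l"
    if "l \<le> n" for h l
  proof -
    have "fps_nth (h oo v) l = (\<Sum>i\<le>n. fps_nth h i * fps_nth (v ^ i) l)"
      unfolding fps_compose_nth
      by (rule sum.mono_neutral_left) (use that v_pow in auto)
    then show ?thesis by (simp add: fps_sum_nth)
  qed
  have "fps_nth ((f oo v) * (g oo v)) n =
      fps_nth ((\<Sum>i\<le>n. fps_const (fps_nth f i) * v ^ i) * (\<Sum>j\<le>n. fps_const (fps_nth g j) * v ^ j)) n"
    unfolding fps_mult_nth by (intro sum.cong) (simp_all add: nth)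
  also have "\<dots> = (\<Sum>(i, j)\<in>{..n} \<times> {..n}. fps_nth f i * fps_nth g j * fps_nth (v ^ (i + j)) n)"
    unfolding sum_product fps_sum_nth sum.cartesian_product
    by (intro sum.cong)
      (auto simp: power_add mult_ac fps_mult_left_const_nth simp flip: mult.assoc)
  also have "\<dots> = (\<Sum>(s, i)\<in>(SIGMA s:{..n}. {..s}). fps_nth f i * fps_nth g (s - i) * fps_nth (v ^ s) n)"
  proof (rule sum.mono_neutral_cong_right[THEN trans])
    show "(\<Sum>(i, j)\<in>{(i, j). i + j \<le> n}. fps_nth f i * fps_nth g j * fps_nth (v ^ (i + j)) n) =
      (\<Sum>(s, i)\<in>(SIGMA s:{..n}. {..s}). fps_nth f i * fps_nth g (s - i) * fps_nth (v ^ s) n)"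
      by (rule sum.reindex_bij_witness[where i = "\<lambda>(s, i). (i, s - i)" and j = "\<lambda>(i, j). (i + j, i)"])
        auto
    show "\<forall>p\<in>{..n} \<times> {..n} - {(i, j). i + j \<le> n}.
        (case p of (i, j) \<Rightarrow> fps_nth f i * fps_nth g j * fps_nth (v ^ (i + j)) n) = 0"
    proof (clarify, goal_cases)
      case (1 i j)
      then show ?case using v_pow[of n "i + j"] by (metis mult_zero_right not_le)
    qed
  qed auto
  also have "\<dots> = (\<Sum>s\<le>n. \<Sum>i\<le>s. fps_nth f i * fps_nth g (s - i) * fps_nth (v ^ s) n)"
    by (simp add: sum.Sigma)
  also have "\<dots> = fps_nth ((f * g) oo v) n"
    unfolding fps_compose_nth atLeast0AtMost
    by (intro sum.cong) (simp_all add: fps_mult_nth sum_distrib_right atLeast0AtMost)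
  finally show "fps_nth ((f * g) oo v) n = fps_nth ((f oo v) * (g oo v)) n" ..
qed

lemma central_binomial_Suc:
  "Suc j * (2 * Suc j choose Suc j) = 2 * (2 * j + 1) * (2 * j choose j)"
proof -
  have "Suc j * (2 * Suc j choose Suc j) = 2 * Suc j * (2 * j + 1 choose j)"
    using Suc_times_binomial_eq[of "2 * j + 1" j] by simp
  moreover have "Suc j * (2 * j + 1 choose j) = (2 * j + 1) * (2 * j choose j)"
    using binomial_absorb_comp[of "2 * j + 1" j] by simp
  ultimately show ?thesis by (simp only: mult.assoc)
qed

text \<open>The generating function G is (1 - 4 x)^(-1/2): from (1 - 4 x) G' = 2 G the derivative of
  (1 - 4 x) G^2 vanishes. Rational coefficients make a series with zero derivative constant; the
  result, an identity of natural numbers, then passes to every ring.\<close>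

lemma central_binomial_conv:
  "(\<Sum>i\<le>n. (2 * i choose i) * (2 * (n - i) choose (n - i))) = 4 ^ n"
proof -
  define G :: "rat fps" where "G = Abs_fps (\<lambda>j. of_nat (2 * j choose j))"
  have G': "(1 - 4 * fps_X) * fps_deriv G = 2 * G"
  proof (rule fps_ext)
    fix j
    have eq: "of_nat (Suc j) * of_nat (2 * Suc j choose Suc j) =
        2 * (2 * of_nat j + 1) * (of_nat (2 * j choose j) :: rat)" for j
      using central_binomial_Suc[of j] by (metis (no_types, lifting) of_nat_mult of_nat_numeral of_nat_add of_nat_1)
    have d: "fps_nth (fps_deriv G) j = 2 * (2 * of_nat j + 1) * fps_nth G j" for j
      using eq[of j] by (simp add: G_def)
    have "fps_nth ((1 - 4 * fps_X) * fps_deriv G) j =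
        fps_nth (fps_deriv G) j - 4 * fps_nth (fps_X * fps_deriv G) j"
      by (simp add: left_diff_distrib mult.assoc numeral_fps_const)
    also have "fps_nth (fps_X * fps_deriv G) j = of_nat j * fps_nth G j"
      by (cases j) simp_all
    finally show "fps_nth ((1 - 4 * fps_X) * fps_deriv G) j = fps_nth (2 * G) j"
      unfolding d by (simp add: numeral_fps_const algebra_simps)
  qed
  define D where "D = (1 - 4 * fps_X) * G ^ 2"
  have d1: "fps_deriv (1 - 4 * fps_X :: rat fps) = - 4"
    by simp
  have "fps_deriv D = - 4 * G ^ 2 + 2 * G * ((1 - 4 * fps_X) * fps_deriv G)"
    unfolding D_def fps_deriv_mult d1 power2_eq_square by (simp add: algebra_simps)
  also have "\<dots> = 0" unfolding G' by (simp add: power2_eq_square algebra_simps)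
  finally have "D = fps_const (fps_nth D 0)" by simp
  also have "fps_nth D 0 = 1" by (simp add: D_def G_def power2_eq_square)
  finally have D1: "(1 - 4 * fps_X) * G ^ 2 = 1" by (simp add: D_def)
  have "(1 - 4 * fps_X) * Abs_fps (\<lambda>n. 4 ^ n) = (1 :: rat fps)"
  proof (rule fps_ext)
    fix n show "fps_nth ((1 - 4 * fps_X) * Abs_fps (\<lambda>n. 4 ^ n)) n = fps_nth (1 :: rat fps) n"
      by (cases n) (simp_all add: left_diff_distrib mult.assoc numeral_fps_const)
  qed
  then have "G ^ 2 = G ^ 2 * ((1 - 4 * fps_X) * Abs_fps (\<lambda>n. 4 ^ n))" by simp
  also have "\<dots> = ((1 - 4 * fps_X) * G ^ 2) * Abs_fps (\<lambda>n. 4 ^ n)" by (simp only: mult_ac)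
  finally have "G ^ 2 = Abs_fps (\<lambda>n. 4 ^ n)" unfolding D1 by simp
  then have "fps_nth (G ^ 2) n = 4 ^ n" by simp
  then have "of_nat (\<Sum>i\<le>n. (2 * i choose i) * (2 * (n - i) choose (n - i))) = (of_nat (4 ^ n) :: rat)"
    by (simp add: power2_eq_square fps_mult_nth G_def atLeast0AtMost)
  then show ?thesis by (simp only: of_nat_eq_iff)
qed

text \<open>The coefficient of z^0 in (z + S + R/z)^k; \<open>trinomial_off\<close> is that of
  z^(-1) in the same power. The factors with truncated exponents have vanishing binomial
  coefficients.\<close>

definition trinomial_diag :: "'a \<Rightarrow> 'a \<Rightarrow> nat \<Rightarrow> 'a::comm_ring_1" where
  "trinomial_diag R S k =
     (\<Sum>j = 0..k. of_nat ((k choose (2 * j)) * ((2 * j) choose j)) * R ^ j * S ^ (k - 2 * j))"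

definition trinomial_off :: "'a \<Rightarrow> 'a \<Rightarrow> nat \<Rightarrow> 'a::comm_ring_1" where
  "trinomial_off R S k =
     (\<Sum>j = 1..Suc k. of_nat ((k choose (j - 1)) * ((Suc k - j) choose j)) * R ^ j * S ^ (Suc k - 2 * j))"

lemma trinomial_coeff_Suc:
  assumes "j \<ge> 1"
  shows "(Suc k choose (2 * j)) * (2 * j choose j) =
    (k choose (2 * j)) * (2 * j choose j) + 2 * ((k choose (j - 1)) * ((Suc k - j) choose j))"
proof -
  obtain i where j: "j = Suc i" using assms by (cases j) auto
  have c: "2 * j choose j = 2 * (2 * i + 1 choose i)"
    using binomial_symmetric[of i "2 * i + 1"] j by simp
  have "(k choose (2 * i + 1)) * (2 * i + 1 choose i) = (k choose i) * ((k - i) choose Suc i)"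
  proof (cases "2 * i + 1 \<le> k")
    case True
    then show ?thesis using choose_mult[of i "2 * i + 1" k] by simp
  next
    case False
    then show ?thesis by (simp add: binomial_eq_0)
  qed
  moreover have "Suc k choose (2 * j) = (k choose (2 * j)) + (k choose (2 * i + 1))"
    using j by simp
  ultimately show ?thesis
    unfolding c using j by (simp add: algebra_simps)
qed

text \<open>Multiplying by one more factor z + S + R/z, the constant term collects S times the old
  constant term and contributions of the two neighbours, which coincide by the symmetry z ->
  R/z.\<close>

lemma trinomial_diag_Suc:
  "trinomial_diag R S (Suc k) = S * trinomial_diag R S k + 2 * trinomial_off R S k"
proof -
  let ?t = "\<lambda>j. R ^ j * S ^ (Suc k - 2 * j)"
  have "S * trinomial_diag R S k =
      (\<Sum>j = 0..k. of_nat ((k choose (2 * j)) * ((2 * j) choose j)) * ?t j)"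
    unfolding trinomial_diag_def sum_distrib_left
  proof (rule sum.cong)
    fix j
    show "S * (of_nat ((k choose (2 * j)) * (2 * j choose j)) * R ^ j * S ^ (k - 2 * j)) =
      of_nat ((k choose (2 * j)) * (2 * j choose j)) * ?t j"
      by (cases "2 * j \<le> k") (simp_all add: Suc_diff_le binomial_eq_0 mult_ac)
  qed simp
  also have "\<dots> = (\<Sum>j = 0..Suc k. of_nat ((k choose (2 * j)) * ((2 * j) choose j)) * ?t j)"
    by (simp add: binomial_eq_0)
  also have "\<dots> = ?t 0 + (\<Sum>j = 1..Suc k. of_nat ((k choose (2 * j)) * ((2 * j) choose j)) * ?t j)"
    by (subst sum.atLeast_Suc_atMost) simp_all
  finally have 1: "S * trinomial_diag R S k = \<dots>" .
  have "trinomial_diag R S (Suc k) =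
      ?t 0 + (\<Sum>j = 1..Suc k. of_nat ((Suc k choose (2 * j)) * ((2 * j) choose j)) * ?t j)"
    unfolding trinomial_diag_def by (subst sum.atLeast_Suc_atMost) (simp_all add: mult.assoc)
  also have "(\<Sum>j = 1..Suc k. of_nat ((Suc k choose (2 * j)) * ((2 * j) choose j)) * ?t j) =
      (\<Sum>j = 1..Suc k. of_nat ((k choose (2 * j)) * ((2 * j) choose j)) * ?t j) + 2 * trinomial_off R S k"
    unfolding trinomial_off_def sum_distrib_left sum.distrib[symmetric]
  proof (rule sum.cong)
    fix j assume "j \<in> {1..Suc k}"
    then have "of_nat ((Suc k choose (2 * j)) * (2 * j choose j)) =
       (of_nat ((k choose (2 * j)) * (2 * j choose j)) +
        2 * of_nat ((k choose (j - 1)) * (Suc k - j choose j)) :: 'a)"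
      by (subst trinomial_coeff_Suc) simp_all
    then show "of_nat ((Suc k choose (2 * j)) * (2 * j choose j)) * ?t j =
      of_nat ((k choose (2 * j)) * (2 * j choose j)) * ?t j +
      2 * (of_nat ((k choose (j - 1)) * (Suc k - j choose j)) * R ^ j * S ^ (Suc k - 2 * j))"
      by (simp add: algebra_simps)
  qed simp
  finally show ?thesis unfolding 1 by simp
qed

text \<open>With L = 1 / (1 - S x), summing over the exponent of S first gives C = L * G (R x^2
  L^2), where G is the series of central binomial coefficients. Its square is then known from (1 - 4
  x) G^2 = 1.\<close>

lemma trinomial_diag_gf:
  fixes R S :: "'a::comm_ring_1"
  defines "C \<equiv> Abs_fps (trinomial_diag R S)"
  shows "((1 - fps_const S * fps_X) ^ 2 - 4 * fps_const R * fps_X ^ 2) * C ^ 2 = 1"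
proof -
  define L where "L = Abs_fps (\<lambda>k. S ^ k)"
  define G :: "'a fps" where "G = Abs_fps (\<lambda>j. of_nat (2 * j choose j))"
  define v where "v = fps_const R * fps_X ^ 2 * L ^ 2"
  have v0: "fps_nth v 0 = 0" by (simp add: v_def power2_eq_square mult.assoc)
  have v_pow: "fps_nth (v ^ k) l = 0" if "l < k" for k l
    using startsby_zero_power_prefix[OF v0] that by blast
  have L: "(1 - fps_const S * fps_X) * L = 1"
  proof (rule fps_ext)
    fix n show "fps_nth ((1 - fps_const S * fps_X) * L) n = fps_nth 1 n"
      by (cases n) (simp_all add: L_def left_diff_distrib mult.assoc)
  qed
  have Lp: "fps_nth (L ^ Suc m) k = of_nat (m + k choose k) * S ^ k" for m k
  proof (induction m arbitrary: k)
    case 0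
    then show ?case by (simp add: L_def)
  next
    case (Suc m)
    have "fps_nth (L ^ Suc (Suc m)) k = (\<Sum>i\<le>k. fps_nth (L ^ Suc m) i * S ^ (k - i))"
      by (subst power_Suc2) (simp add: fps_mult_nth atLeast0AtMost L_def)
    also have "\<dots> = (\<Sum>i\<le>k. of_nat (m + i choose i) * S ^ k)"
      by (intro sum.cong) (auto simp: Suc.IH mult.assoc simp del: power_Suc simp flip: power_add)
    also have "\<dots> = of_nat (\<Sum>i\<le>k. m + i choose i) * S ^ k"
      by (simp add: sum_distrib_right)
    also have "(\<Sum>i\<le>k. m + i choose i) = Suc m + k choose k"
      by (simp add: sum_choose_lower)
    finally show ?case .
  qed
  have C: "C = L * (G oo v)"
  proof (rule fps_ext)
    fix n
    have "fps_nth (L * (G oo v)) n = (\<Sum>l\<le>n. fps_nth L l * (\<Sum>j\<le>n. fps_nth G j * fps_nth (v ^ j) (n - l)))"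
      unfolding fps_mult_nth atLeast0AtMost
    proof (rule sum.cong)
      fix l
      have "(\<Sum>i\<le>n - l. fps_nth G i * fps_nth (v ^ i) (n - l)) = (\<Sum>j\<le>n. fps_nth G j * fps_nth (v ^ j) (n - l))"
        by (rule sum.mono_neutral_left) (use v_pow in auto)
      then show "fps_nth L l * fps_nth (G oo v) (n - l) =
          fps_nth L l * (\<Sum>j\<le>n. fps_nth G j * fps_nth (v ^ j) (n - l))"
        by (simp add: fps_compose_nth atLeast0AtMost)
    qed simp
    also have "\<dots> = (\<Sum>j\<le>n. fps_nth G j * fps_nth (L * v ^ j) n)"
      unfolding sum_distrib_left
      by (subst sum.swap) (simp add: fps_mult_nth atLeast0AtMost sum_distrib_left mult_ac)
    also have "\<dots> = (\<Sum>j\<le>n. of_nat ((n choose (2 * j)) * (2 * j choose j)) * R ^ j * S ^ (n - 2 * j))"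
    proof (rule sum.cong)
      fix j
      have "L * v ^ j = fps_const (R ^ j) * (fps_X ^ (2 * j) * L ^ Suc (2 * j))"
        by (simp add: v_def power_mult_distrib fps_const_power mult_ac flip: power_mult)
      then have "fps_nth (L * v ^ j) n = (if n < 2 * j then 0 else R ^ j * (of_nat (n choose (2 * j)) * S ^ (n - 2 * j)))"
        using binomial_symmetric[of "2 * j" n]
        by (simp add: fps_X_power_mult_nth Lp del: power_Suc)
      then show "fps_nth G j * fps_nth (L * v ^ j) n =
          of_nat ((n choose (2 * j)) * (2 * j choose j)) * R ^ j * S ^ (n - 2 * j)"
        by (simp add: G_def binomial_eq_0 mult_ac)
    qed simp
    finally show "fps_nth C n = fps_nth (L * (G oo v)) n"
      by (simp add: C_def trinomial_diag_def atLeast0AtMost)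
  qed
  have GG: "(1 - 4 * fps_X) * (G * G) = 1"
  proof -
    have "fps_nth (G * G) n = 4 ^ n" for n
      using arg_cong[OF central_binomial_conv[of n], of "of_nat :: nat \<Rightarrow> 'a"]
      by (simp add: G_def fps_mult_nth atLeast0AtMost)
    then have "G * G = Abs_fps (\<lambda>n. 4 ^ n)" by (intro fps_ext) simp
    moreover have "(1 - 4 * fps_X) * Abs_fps (\<lambda>n. 4 ^ n) = (1 :: 'a fps)"
    proof (rule fps_ext)
      fix n show "fps_nth ((1 - 4 * fps_X) * Abs_fps (\<lambda>n. 4 ^ n)) n = fps_nth (1 :: 'a fps) n"
        by (cases n) (simp_all add: left_diff_distrib mult.assoc numeral_fps_const)
    qed
    ultimately show ?thesis by simp
  qed
  have "(1 - 4 * fps_X) oo v = (1 - 4 * v :: 'a fps)"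
    using v0 by (simp add: fps_compose_sub_distrib fps_compose_mult_distrib' numeral_fps_const)
  then have Gv: "(1 - 4 * v) * ((G oo v) * (G oo v)) = 1"
    using arg_cong[OF GG, of "\<lambda>f. f oo v"] v0
    by (simp add: fps_compose_mult_distrib')
  have "((1 - fps_const S * fps_X) ^ 2 - 4 * fps_const R * fps_X ^ 2) * L ^ 2 =
      ((1 - fps_const S * fps_X) * L) ^ 2 - 4 * v"
    by (simp add: v_def algebra_simps power2_eq_square)
  also have "\<dots> = 1 - 4 * v" unfolding L by simp
  finally have "((1 - fps_const S * fps_X) ^ 2 - 4 * fps_const R * fps_X ^ 2) * L ^ 2 = 1 - 4 * v" .
  note pL = this
  have "((1 - fps_const S * fps_X) ^ 2 - 4 * fps_const R * fps_X ^ 2) * C ^ 2 =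
      ((1 - fps_const S * fps_X) ^ 2 - 4 * fps_const R * fps_X ^ 2) * L ^ 2 * ((G oo v) * (G oo v))"
    unfolding C by (simp only: power_mult_distrib power2_eq_square mult_ac)
  also have "\<dots> = (1 - 4 * v) * ((G oo v) * (G oo v))" by (simp only: pL)
  finally show ?thesis using Gv by simp
qed


section \<open>Laurent series at infinity\<close>

notation fls_nth (infixl "\<section>" 75)

text \<open>Any lower bounds are allowed in place of subdegrees, since differentiation may raise a
  subdegree; all products in a Leibniz rule can then be summed over one range.\<close>

lemma fls_times_nth_cover:
  fixes f g :: "'a::comm_ring_1 fls"
  assumes "\<And>i. i < p \<Longrightarrow> f \<section> i = 0" "\<And>j. j < q \<Longrightarrow> g \<section> j = 0"
  shows "(f * g) \<section> n = (\<Sum>i=p..n - q. f \<section> i * g \<section> (n - i))"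
proof (cases "f = 0 \<or> g = 0")
  case False
  then have "p \<le> fls_subdegree f" "q \<le> fls_subdegree g"
    using assms by (auto intro: fls_subdegree_geI)
  then show ?thesis
    unfolding fls_times_nth(2) by (intro sum.mono_neutral_left) auto
qed auto

definition fls_vanishes :: "int \<Rightarrow> 'a::comm_ring_1 fls \<Rightarrow> bool" where
  "fls_vanishes p f \<longleftrightarrow> (\<forall>i<p. f \<section> i = 0)"

lemma fls_vanishes_subdegree: "fls_vanishes (fls_subdegree f) f"
  by (simp add: fls_vanishes_def)

lemma fls_vanishes_mult:
  assumes "fls_vanishes p f" "fls_vanishes q g"
  shows "fls_vanishes (p + q) (f * g)" "(f * g) \<section> (p + q) = f \<section> p * g \<section> q"
proof -
  have *: "(f * g) \<section> n = (\<Sum>i=p..n - q. f \<section> i * g \<section> (n - i))" for n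
    using assms by (intro fls_times_nth_cover) (auto simp: fls_vanishes_def)
  show "fls_vanishes (p + q) (f * g)" by (simp add: fls_vanishes_def *)
  show "(f * g) \<section> (p + q) = f \<section> p * g \<section> q" by (simp add: *)
qed

lemma fls_vanishes_mult':
  assumes "fls_vanishes p f" "fls_vanishes q g" "r \<le> p + q"
  shows "fls_vanishes r (f * g)"
  using fls_vanishes_mult(1)[OF assms(1,2)] assms(3) by (simp add: fls_vanishes_def)

lemma fls_vanishes_arith:
  "fls_vanishes p f \<Longrightarrow> fls_vanishes p g \<Longrightarrow> fls_vanishes p (f + g)"
  "fls_vanishes p f \<Longrightarrow> fls_vanishes p g \<Longrightarrow> fls_vanishes p (f - g)"
  "fls_vanishes p f \<Longrightarrow> fls_vanishes p (- f)"
  by (simp_all add: fls_vanishes_def)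

text \<open>Series in \<open>u = 1 / x\<close> that are polynomials in \<open>x\<close>.\<close>

definition xpoly :: "'a::comm_ring_1 fls \<Rightarrow> bool" where
  "xpoly f \<longleftrightarrow> (\<forall>i>0. f \<section> i = 0)"

lemma xpoly_arith:
  "xpoly f \<Longrightarrow> xpoly g \<Longrightarrow> xpoly (f + g)"
  "xpoly f \<Longrightarrow> xpoly g \<Longrightarrow> xpoly (f - g)"
  "xpoly f \<Longrightarrow> xpoly (- f)"
  "xpoly (fls_const c)"
  "xpoly fls_X_inv"
  "xpoly 0" "xpoly 1"
  by (auto simp: xpoly_def)

lemma xpoly_mult:
  assumes "xpoly f" "xpoly g"
  shows "xpoly (f * g)"
  unfolding xpoly_def
proof (intro allI impI)
  fix n :: int assume "n > 0"
  show "(f * g) \<section> n = 0"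
    unfolding fls_times_nth(2)
  proof (rule sum.neutral, rule ballI)
    fix i
    show "f \<section> i * g \<section> (n - i) = 0"
      using assms \<open>n > 0\<close> by (cases "i > 0") (auto simp: xpoly_def)
  qed
qed

lemma xpoly_sum: "(\<And>i. i \<in> I \<Longrightarrow> xpoly (f i)) \<Longrightarrow> xpoly (\<Sum>i\<in>I. f i)"
  by (induction I rule: infinite_finite_induct) (auto intro: xpoly_arith)

lemma xpoly_power: "xpoly f \<Longrightarrow> xpoly (f ^ n)"
  by (induction n) (auto intro: xpoly_arith xpoly_mult)

lemma xpoly_numeral: "xpoly (numeral n)"
  using xpoly_arith(4)[of "numeral n"] by (simp add: fls_const_numeral)

lemma xpoly_vanishes_eq_const:
  assumes "xpoly f" "fls_vanishes 0 f"
  shows "f = fls_const (f \<section> 0)"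
proof (rule fls_eqI)
  fix n :: int
  show "f \<section> n = fls_const (f \<section> 0) \<section> n"
    by (cases n "0 :: int" rule: linorder_cases)
      (use assms in \<open>auto simp: xpoly_def fls_vanishes_def\<close>)
qed

definition xpoly_part :: "'a::comm_ring_1 fls \<Rightarrow> 'a fls" where
  "xpoly_part f = Abs_fls (\<lambda>k. if k \<le> 0 then f \<section> k else 0)"

lemma xpoly_part_nth: "xpoly_part f \<section> k = (if k \<le> 0 then f \<section> k else 0)"
  unfolding xpoly_part_def
  by (rule nth_Abs_fls_lower_bound[of "min 0 (fls_subdegree f)", THEN trans]) auto

lemma xpoly_xpoly_part: "xpoly (xpoly_part f)"
  by (simp add: xpoly_def xpoly_part_nth)

section \<open>Derivations and their extension to Laurent series\<close>

locale derivation =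
  fixes d :: "'a::comm_ring_1 \<Rightarrow> 'a"
  assumes add: "d (x + y) = d x + d y"
    and mult: "d (x * y) = d x * y + x * d y"
begin

lemma zero: "d 0 = 0" using add[of 0 0] by simp
lemma one: "d 1 = 0" using mult[of 1 1] by simp
lemma minus: "d (- x) = - d x" using add[of x "- x"] by (simp add: zero add_eq_0_iff)
lemma diff: "d (x - y) = d x - d y" using add[of x "- y"] by (simp add: minus)
lemma of_nat: "d (of_nat n) = 0" by (induction n) (simp_all add: add zero one)
lemma numeral: "d (numeral n) = 0" using of_nat[of "numeral n"] by simp
lemmas const_simps = zero one of_nat numeral
lemma sum: "d (\<Sum>i\<in>I. f i) = (\<Sum>i\<in>I. d (f i))"
  by (induction I rule: infinite_finite_induct) (auto simp: add zero)
lemma square: "d (x ^ 2) = 2 * x * d x" by (simp add: power2_eq_square mult mult_ac)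

end

text \<open>This is \<open>d\<close> on coefficients plus \<open>l\<close> times u d/du, so x = 1/u
  goes to -l x. The Euler derivation is extended with \<open>l = 1\<close> and a_n d/da_n with
  \<open>l = 0\<close>; \<open>d = 0\<close> and \<open>l = 1\<close> give u d/du itself.\<close>

definition fls_lift :: "('a \<Rightarrow> 'a) \<Rightarrow> 'a \<Rightarrow> 'a::comm_ring_1 fls \<Rightarrow> 'a fls" where
  "fls_lift d l f = Abs_fls (\<lambda>k. d (f \<section> k) + of_int k * l * f \<section> k)"

context derivation
begin

lemma fls_lift_nth: "fls_lift d l f \<section> k = d (f \<section> k) + of_int k * l * f \<section> k"
  unfolding fls_lift_def
  by (rule nth_Abs_fls_lower_bound[of "fls_subdegree f", THEN trans]) (auto simp: zero)

lemma fls_lift_vanishes: "fls_vanishes p f \<Longrightarrow> fls_vanishes p (fls_lift d l f)"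
  by (simp add: fls_vanishes_def fls_lift_nth zero)

lemma fls_lift_xpoly: "xpoly f \<Longrightarrow> xpoly (fls_lift d l f)"
  by (simp add: xpoly_def fls_lift_nth zero)

lemma derivation_fls_lift: "derivation (fls_lift d l)"
proof
  fix f g :: "'a fls"
  show "fls_lift d l (f + g) = fls_lift d l f + fls_lift d l g"
    by (rule fls_eqI) (simp add: fls_lift_nth add distrib_left)
  let ?p = "fls_subdegree f" and ?q = "fls_subdegree g"
  show "fls_lift d l (f * g) = fls_lift d l f * g + f * fls_lift d l g"
  proof (rule fls_eqI)
    fix n
    have *: "(f' * g') \<section> n = (\<Sum>i=?p..n - ?q. f' \<section> i * g' \<section> (n - i))"
      if "fls_vanishes ?p f'" "fls_vanishes ?q g'" for f' g'
      using that by (intro fls_times_nth_cover) (auto simp: fls_vanishes_def)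
    have "fls_lift d l (f * g) \<section> n =
        (\<Sum>i=?p..n - ?q. d (f \<section> i * g \<section> (n - i)) + of_int n * l * (f \<section> i * g \<section> (n - i)))"
      by (simp add: fls_lift_nth *[OF fls_vanishes_subdegree fls_vanishes_subdegree] sum
          sum_distrib_left sum.distrib)
    also have "\<dots> = (\<Sum>i=?p..n - ?q. fls_lift d l f \<section> i * g \<section> (n - i) + f \<section> i * fls_lift d l g \<section> (n - i))"
      by (intro sum.cong) (simp_all add: fls_lift_nth mult algebra_simps)
    also have "\<dots> = (fls_lift d l f * g + f * fls_lift d l g) \<section> n"
      by (simp add: * fls_vanishes_subdegree fls_lift_vanishes sum.distrib)
    finally show "fls_lift d l (f * g) \<section> n = (fls_lift d l f * g + f * fls_lift d l g) \<section> n" .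
  qed
qed

lemma fls_lift_const: "fls_lift d l (fls_const c) = fls_const (d c)"
  by (rule fls_eqI) (simp add: fls_lift_nth zero one)

lemma fls_lift_X_inv: "fls_lift d l fls_X_inv = - fls_const l * fls_X_inv"
  by (rule fls_eqI) (simp add: fls_lift_nth zero one)

end

lemma derivation_zero: "derivation (\<lambda>_. 0 :: 'a::comm_ring_1)"
  by standard auto


section \<open>The planar resolvent\<close>

lemma fls_X_mult_X_inv: "fls_X * fls_X_inv = (1 :: 'a::comm_ring_1 fls)"
  by (rule fls_eqI) (simp add: fls_X_times_conv_shift)

lemma fls_X_inv_power_mult_nth:
  fixes f :: "'a::comm_ring_1 fls"
  shows "(fls_X_inv ^ n * f) \<section> k = f \<section> (k + int n)"
  by (simp add: fls_X_inv_power_times_conv_shift)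

lemma fls_X_inv_mult_nth:
  fixes f :: "'a::comm_ring_1 fls"
  shows "(fls_X_inv * f) \<section> k = f \<section> (k + 1)"
  using fls_X_inv_power_mult_nth[of 1 f k] by simp

lemma fls_X_mult_nth:
  fixes f :: "'a::comm_ring_1 fls"
  shows "(fls_X * f) \<section> k = f \<section> (k - 1)"
  using fls_X_power_times_conv_shift(1)[of 1 f] by simp

text \<open>Laurent series in \<open>u = 1 / x\<close>: \<open>V\<close> is the derivative of the potential, \<open>C\<close> is
  \<open>1 / sqrt q\<close> with \<open>q = (x - S)\<^sup>2 - 4 R\<close>, \<open>sigma\<close> is \<open>sqrt q\<close>, and \<open>W\<close> is the planar resolvent
  with moments \<open>w\<close>.\<close>

locale planar_data =
  fixes a :: "nat \<Rightarrow> 'a::comm_ring_1" and K :: nat and R S h :: 'a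
  assumes half: "2 * h = 1"
    and R_eq: "R = 1 + (\<Sum>n = 1..K. a n * trinomial_off R S (n - 1))"
    and S_eq: "S = (\<Sum>n = 1..K. a n * trinomial_diag R S (n - 1))"
begin

abbreviation c where "c \<equiv> trinomial_diag R S"

definition C where "C = fls_X * fps_to_fls (Abs_fps c)"
definition y where "y = fls_X_inv - fls_const S"
definition q where "q = y ^ 2 - 4 * fls_const R"
definition V where "V = fls_X_inv - (\<Sum>n = 1..K. fls_const (a n) * fls_X_inv ^ (n - 1))"
definition M where "M = xpoly_part (V * C)"
text \<open>\<open>M + T\<close> is the splitting of V / sqrt q into its polynomial part and its
  negative powers of x. Multiplied by \<open>sigma\<close> it splits \<open>V\<close> into
  \<open>sigma * M\<close> and twice the resolvent.\<close>

definition T where "T = V * C - M"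
definition sigma where "sigma = q * C"
definition W where "W = fls_const h * (sigma * T)"
definition w where "w k = W \<section> (int k + 1)"

lemma two_cancel:
  fixes x z :: 'a shows "2 * x = 2 * z \<Longrightarrow> x = z"
  using half by (metis mult.commute mult.left_commute mult_1_right)

lemma half_fls: "2 * fls_const h = 1"
  using half by (metis fls_const_1 fls_const_mult_const fls_const_numeral)

lemma two_cancel_fls:
  fixes f g :: "'a fls" shows "2 * f = 2 * g \<Longrightarrow> f = g"
  using half_fls by (metis mult.commute mult.left_commute mult_1_right)

lemma C_nth: "C \<section> k = (if k \<ge> 1 then c (nat (k - 1)) else 0)"
  by (simp add: C_def fls_X_mult_nth)

lemma C_nth': "C \<section> (int k + 1) = c k"
  by (simp add: C_nth)

lemma c_0: "c 0 = 1" by (simp add: trinomial_diag_def)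

lemma c_1: "c 1 = S" by (simp add: trinomial_diag_def binomial_eq_0)

lemma q_expand: "q = fls_X_inv ^ 2 - 2 * fls_const S * fls_X_inv + fls_const (S ^ 2 - 4 * R)"
proof -
  have "fls_const (S ^ 2 - 4 * R) = fls_const S ^ 2 - 4 * fls_const R"
    by (simp add: fls_const_power flip: fls_minus_const fls_const_mult_const fls_const_numeral)
  then show ?thesis by (simp add: q_def y_def power2_eq_square algebra_simps)
qed

lemma q_mult_nth:
  "(q * f) \<section> k = f \<section> (k + 2) - 2 * S * f \<section> (k + 1) + (S ^ 2 - 4 * R) * f \<section> k"
proof -
  have "q * f = fls_X_inv ^ 2 * f - 2 * (fls_const S * (fls_X_inv * f)) + fls_const (S ^ 2 - 4 * R) * f"
    by (simp add: q_expand algebra_simps)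
  then show ?thesis by (simp add: fls_X_inv_power_mult_nth fls_X_inv_mult_nth mult.assoc del: fls_const_mult_const)
qed

lemma q_C: "q * C ^ 2 = 1"
proof -
  have "q * fls_X ^ 2 = (y * fls_X) ^ 2 - 4 * fls_const R * fls_X ^ 2"
    by (simp add: q_def power_mult_distrib algebra_simps)
  also have "y * fls_X = 1 - fls_const S * fls_X"
    using fls_X_mult_X_inv by (simp add: y_def algebra_simps)
  also have "(1 - fls_const S * fls_X) ^ 2 - 4 * fls_const R * fls_X ^ 2 =
      fps_to_fls ((1 - fps_const S * fps_X) ^ 2 - 4 * fps_const R * fps_X ^ 2)"
    by (simp add: power2_eq_square fls_times_fps_to_fls fps_to_fls_minus)
  finally have "q * C ^ 2 = fps_to_fls ((1 - fps_const S * fps_X) ^ 2 - 4 * fps_const R * fps_X ^ 2)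
      * fps_to_fls (Abs_fps c) ^ 2"
    by (metis C_def power_mult_distrib mult.assoc)
  also have "\<dots> = fps_to_fls (((1 - fps_const S * fps_X) ^ 2 - 4 * fps_const R * fps_X ^ 2) * Abs_fps c ^ 2)"
    by (simp add: power2_eq_square fls_times_fps_to_fls)
  finally show ?thesis by (simp add: trinomial_diag_gf)
qed

lemma sigma_C: "sigma * C = 1"
  using q_C by (simp add: sigma_def power2_eq_square mult.assoc)

lemma sigma_sq: "sigma * sigma = q"
proof -
  have "sigma * sigma = q * (q * C ^ 2)" by (simp add: sigma_def power2_eq_square mult_ac)
  then show ?thesis by (simp add: q_C)
qed

lemma xpoly_y: "xpoly y" by (simp add: y_def xpoly_arith)

lemma xpoly_q: "xpoly q"
  by (simp add: q_def xpoly_arith xpoly_power xpoly_y xpoly_mult xpoly_numeral)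

lemma xpoly_V: "xpoly V"
  unfolding V_def by (intro xpoly_arith xpoly_sum xpoly_mult xpoly_power)

lemma xpoly_M: "xpoly M" by (simp add: M_def xpoly_xpoly_part)

lemma V_mult_nth: "(V * f) \<section> k = f \<section> (k + 1) - (\<Sum>n = 1..K. a n * f \<section> (k + int (n - 1)))"
  by (simp add: V_def left_diff_distrib sum_distrib_right fls_X_inv_mult_nth fls_nth_sum
      mult.assoc fls_X_inv_power_mult_nth)

text \<open>The defining equations of \<open>R\<close> and \<open>S\<close> enter only here.\<close>

lemma T_nth: "T \<section> 1 = 0" "T \<section> 2 = 2" "fls_vanishes 2 T"
proof -
  have s: "(\<Sum>n = 1..K. a n * c (n - 1)) = S" using S_eq ..
  have b: "(\<Sum>n = 1..K. a n * trinomial_off R S (n - 1)) = R - 1"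
    using R_eq by (metis add_diff_cancel_left')
  have c_suc: "c n = S * c (n - 1) + 2 * trinomial_off R S (n - 1)" if "n \<in> {1..K}" for n
    using trinomial_diag_Suc[of R S "n - 1"] that by simp
  have "(\<Sum>n = 1..K. a n * C \<section> (1 + int (n - 1))) = (\<Sum>n = 1..K. a n * c (n - 1))"
    by (intro sum.cong) (simp_all only: add.commute[of 1] C_nth')
  then have "(V * C) \<section> 1 = S - (\<Sum>n = 1..K. a n * c (n - 1))"
    using C_nth'[of 1] c_1 by (simp add: V_mult_nth del: One_nat_def)
  then have VC1: "(V * C) \<section> 1 = 0" by (simp add: s del: One_nat_def)
  \<comment> \<open>The second coefficient mixes the two defining equations: one step of the
    trinomial recursion splits this sum into the S-equation and the R-equation. The 1 in the latter
    is what leaves the value 2.\<close>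
  have "(\<Sum>n = 1..K. a n * c n) =
      (\<Sum>n = 1..K. S * (a n * c (n - 1)) + 2 * (a n * trinomial_off R S (n - 1)))"
  proof (rule sum.cong)
    fix n assume "n \<in> {1..K}"
    then show "a n * c n = S * (a n * c (n - 1)) + 2 * (a n * trinomial_off R S (n - 1))"
      by (simp only: c_suc) (simp add: algebra_simps)
  qed simp
  also have "\<dots> = S * S + 2 * (R - 1)"
    by (simp only: sum.distrib sum_distrib_left[symmetric] s b)
  finally have s2: "(\<Sum>n = 1..K. a n * c n) = S * S + 2 * (R - 1)" .
  have "c 2 = S * c 1 + 2 * trinomial_off R S 1"
    using trinomial_diag_Suc[of R S 1] by (simp add: numeral_2_eq_2)
  also have "trinomial_off R S 1 = R" by (simp add: trinomial_off_def)
  finally have c2: "c 2 = S * S + 2 * R" unfolding c_1 .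
  have "(\<Sum>n = 1..K. a n * C \<section> (2 + int (n - 1))) = (\<Sum>n = 1..K. a n * c n)"
  proof (rule sum.cong)
    fix n assume "n \<in> {1..K}"
    then have "2 + int (n - 1) = int n + 1" by simp
    then show "a n * C \<section> (2 + int (n - 1)) = a n * c n" by (simp only: C_nth')
  qed simp
  then have "(V * C) \<section> 2 = c 2 - (\<Sum>n = 1..K. a n * c n)"
    using C_nth'[of 2] by (simp add: V_mult_nth del: One_nat_def)
  then have VC2: "(V * C) \<section> 2 = 2" by (simp only: s2 c2) (simp add: algebra_simps)
  have T: "T \<section> k = (if k \<le> 0 then 0 else (V * C) \<section> k)" for k
    by (simp add: T_def M_def xpoly_part_nth)
  show T1: "T \<section> 1 = 0" and "T \<section> 2 = 2" by (simp_all add: T VC1 VC2)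
  show "fls_vanishes 2 T"
    unfolding fls_vanishes_def
  proof (intro allI impI)
    fix k :: int assume "k < 2"
    then show "T \<section> k = 0" using T1 by (cases "k = 1") (auto simp: T)
  qed
qed

lemma sigma_vanishes: "fls_vanishes (- 1) sigma" "sigma \<section> (- 1) = 1"
proof -
  have C: "fls_vanishes 1 C" by (simp add: fls_vanishes_def C_nth)
  have q: "fls_vanishes (- 2) q" "q \<section> (- 2) = 1"
    using q_mult_nth[of 1] by (simp_all add: fls_vanishes_def)
  show "fls_vanishes (- 1) sigma" "sigma \<section> (- 1) = 1"
    using fls_vanishes_mult[OF q(1) C] q(2) c_0 by (simp_all add: sigma_def C_nth)
qed

lemma W_vanishes: "fls_vanishes 1 W" "W \<section> 1 = 1"
proof -
  have 1: "fls_vanishes 1 (sigma * T)" "(sigma * T) \<section> 1 = 2"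
    using fls_vanishes_mult[OF sigma_vanishes(1) T_nth(3)] by (simp_all add: sigma_vanishes T_nth)
  show "fls_vanishes 1 W" using 1 by (simp add: W_def fls_vanishes_def)
  show "W \<section> 1 = 1" using 1 half by (simp add: W_def mult.commute)
qed

lemma w_0: "w 0 = 1" by (simp add: w_def W_vanishes)

lemma V_2W: "V - 2 * W = sigma * M"
proof -
  have "2 * W = sigma * T"
    using half_fls by (simp add: W_def flip: mult.assoc)
  also have "\<dots> = (sigma * C) * V - sigma * M" by (simp add: T_def algebra_simps)
  finally show ?thesis by (simp add: sigma_C)
qed

text \<open>From V - 2 W = sigma M one gets 4 (W^2 - V W) = q M^2 - V^2, in which no square root is
  left. It is a polynomial in x, and the loop equation is the vanishing of its coefficient of
  x^(-k-1).\<close>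

theorem planar_loop:
  "w (Suc k) = (\<Sum>n = 1..K. a n * w (n - 1 + k)) + (\<Sum>r<k. w r * w (k - 1 - r))"
proof -
  have "4 * (W * W - V * W) = (V - 2 * W) * (V - 2 * W) - V * V"
    by (simp add: algebra_simps)
  also have "\<dots> = (sigma * sigma) * (M * M) - V * V" unfolding V_2W by (simp add: mult_ac)
  finally have "4 * (W * W - V * W) = q * (M * M) - V * V" unfolding sigma_sq .
  moreover have "xpoly (q * (M * M) - V * V)"
    by (intro xpoly_arith xpoly_mult xpoly_M xpoly_q xpoly_V)
  ultimately have "(4 * (W * W - V * W)) \<section> (int k + 1) = 0"
    by (simp add: xpoly_def)
  then have "2 * (2 * ((W * W) \<section> (int k + 1))) = 2 * (2 * ((V * W) \<section> (int k + 1)))"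
    by (simp add: right_diff_distrib)
  then have eq: "(W * W) \<section> (int k + 1) = (V * W) \<section> (int k + 1)"
    using two_cancel by blast
  have "(W * W) \<section> (int k + 1) = (\<Sum>i=1..int k. W \<section> i * W \<section> (int k + 1 - i))"
    using fls_times_nth_cover[of 1 W 1 W "int k + 1"] W_vanishes(1) by (simp add: fls_vanishes_def)
  also have "\<dots> = (\<Sum>r<k. w r * w (k - 1 - r))"
    by (rule sum.reindex_bij_witness[where i = "\<lambda>r. int r + 1" and j = "\<lambda>i. nat (i - 1)"])
      (auto simp: w_def of_nat_diff algebra_simps)
  finally have "(W * W) \<section> (int k + 1) = (\<Sum>r<k. w r * w (k - 1 - r))" .
  moreover have "(V * W) \<section> (int k + 1) = w (Suc k) - (\<Sum>n = 1..K. a n * w (n - 1 + k))"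
    by (simp add: V_mult_nth w_def algebra_simps del: One_nat_def)
  ultimately show ?thesis using eq by (simp add: algebra_simps del: One_nat_def)
qed

end

text \<open>\<open>d\<close> is twice the operator \<open>t d/dt\<close> of the scaling \<open>a\<^sub>n \<rightarrow> t\<^bsup>n/2-1\<^esup> a\<^sub>n\<close>, which avoids
  half-integers; its extension \<open>D\<close> moves \<open>x\<close> so that \<open>V\<close> is an eigenvector.\<close>

locale planar_euler = planar_data a K R S h + derivation d
  for a :: "nat \<Rightarrow> 'a::comm_ring_1" and K R S h d +
  assumes d_a: "n \<ge> 1 \<Longrightarrow> d (a n) = (of_nat n - 2) * a n"
begin

abbreviation D where "D \<equiv> fls_lift d 1"

sublocale D: derivation D by (rule derivation_fls_lift)

lemma D_X_inv: "D fls_X_inv = - fls_X_inv"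
  by (simp add: fls_lift_X_inv)

text \<open>Every term has weight -1: a_n contributes n - 2, and x^(n-1) contributes 1 - n.\<close>

lemma D_V: "D V = - V"
proof -
  have pow: "D (fls_X_inv ^ m) = - of_nat m * fls_X_inv ^ m" for m
    by (induction m) (simp_all add: D.mult D_X_inv D.const_simps algebra_simps)
  have "D (fls_const (a n) * fls_X_inv ^ (n - 1)) = - (fls_const (a n) * fls_X_inv ^ (n - 1))"
    if "n \<in> {1..K}" for n
  proof -
    have da: "fls_const (d (a n)) = (of_nat (n - 1) - 1) * fls_const (a n)"
      using that by (simp add: d_a fls_of_nat flip: fls_const_mult_const fls_minus_const)
    show ?thesis
      unfolding D.mult pow fls_lift_const da by (simp add: algebra_simps)
  qed
  then show ?thesis
    by (simp add: V_def D.diff D.sum D_X_inv sum_negf)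
qed

lemma two_sigma_D: "2 * (sigma * D (sigma * M)) = 2 * q * D M + D q * M"
proof -
  have "D q = 2 * (sigma * D sigma)"
    using D.mult[of sigma sigma] by (simp add: sigma_sq mult_ac)
  moreover have "2 * (sigma * D (sigma * M)) = 2 * (sigma * D sigma) * M + 2 * (sigma * sigma) * D M"
    by (simp add: D.mult algebra_simps)
  ultimately show ?thesis by (simp add: sigma_sq algebra_simps)
qed

text \<open>Applying D to V - 2 W = sigma M and multiplying by 2 sigma removes the root on the left,
  leaving a polynomial in x. The right side is -4 sigma (D W + W), where sigma grows like x and D W
  + W decays like 2/x. Both sides are therefore the constant -8.\<close>

lemma D_M: "2 * q * D M + D q * M + 2 * q * M = - 8" and D_W: "D W + W = 2 * C"
proof -
  have DVW: "D (sigma * M) + sigma * M = - 2 * (D W + W)"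
    unfolding V_2W[symmetric] using D_V by (simp add: D.diff D.mult D.const_simps algebra_simps)
  have "2 * q * D M + D q * M + 2 * q * M = 2 * (sigma * D (sigma * M)) + 2 * (sigma * sigma) * M"
    by (simp add: two_sigma_D sigma_sq)
  also have "\<dots> = 2 * sigma * (D (sigma * M) + sigma * M)" by (simp add: algebra_simps)
  also have "\<dots> = - 4 * (sigma * (D W + W))" unfolding DVW by (simp add: algebra_simps)
  finally have eq: "2 * q * D M + D q * M + 2 * q * M = - 4 * (sigma * (D W + W))" .
  have v: "fls_vanishes 1 (D W + W)" "(D W + W) \<section> 1 = 2"
    using W_vanishes by (auto intro!: fls_vanishes_arith fls_lift_vanishes simp: fls_lift_nth const_simps)
  have v': "fls_vanishes 0 (sigma * (D W + W))" "(sigma * (D W + W)) \<section> 0 = 2"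
    using fls_vanishes_mult[OF sigma_vanishes(1) v(1)] v(2) sigma_vanishes by simp_all
  \<comment> \<open>a polynomial in \<open>x\<close> that is bounded at infinity is constant\<close>
  have "xpoly (- 4 * (sigma * (D W + W)))"
    unfolding eq[symmetric]
    by (intro xpoly_arith xpoly_mult xpoly_numeral fls_lift_xpoly xpoly_q xpoly_M)
  moreover have "fls_vanishes 0 (- 4 * (sigma * (D W + W)))" using v'(1) by (simp add: fls_vanishes_def)
  ultimately have 8: "- 4 * (sigma * (D W + W)) = fls_const (- 8)"
    using v'(2) by (subst xpoly_vanishes_eq_const) simp_all
  then show "2 * q * D M + D q * M + 2 * q * M = - 8" using eq by simp
  have "2 * (2 * (sigma * (D W + W))) = 2 * (2 * 2)" using 8 by (simp add: algebra_simps)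
  then have "sigma * (D W + W) = 2" using two_cancel_fls by blast
  then have "(sigma * C) * (D W + W) = 2 * C" by (metis mult.assoc mult.commute)
  then show "D W + W = 2 * C" by (simp add: sigma_C)
qed

theorem d_w: "d (w k) + of_nat (k + 2) * w k = 2 * c k"
proof -
  have "(D W + W) \<section> (int k + 1) = (2 * C) \<section> (int k + 1)" unfolding D_W ..
  then show ?thesis by (simp add: fls_lift_nth w_def C_nth algebra_simps)
qed

text \<open>If \<open>S\<close> counts as degree 1 and \<open>R\<close> as degree 2, then
  \<open>q\<close> is homogeneous of degree 2 in x. \<open>Rd\<close>, \<open>Sd\<close> and
  \<open>qd\<close> are what the derivations leave after this homogeneity is accounted for;
  \<open>qd\<close> equals \<open>D q + 2 * q\<close>. For n >= 1, \<open>beta n\<close> is twice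
  \<open>trinomial_off R S (n - 1)\<close>.\<close>

definition Rd where "Rd = d R + 2 * R"
definition Sd where "Sd = d S + S"
definition qd where "qd = - 2 * y * fls_const Sd - 4 * fls_const Rd"
definition beta where "beta n = c n - S * c (n - 1)"

lemma D_y: "D y = - y - fls_const Sd"
  by (simp add: y_def D.diff D_X_inv fls_lift_const Sd_def flip: fls_plus_const)

lemma D_q: "D q = qd - 2 * q"
proof -
  have "D q = 2 * y * D y - 4 * fls_const (d R)"
    by (simp add: q_def D.diff D.square D.mult D.const_simps fls_lift_const)
  also have "fls_const (d R) = fls_const Rd - 2 * fls_const R"
    by (simp add: Rd_def flip: fls_plus_const fls_const_mult_const fls_const_numeral)
  finally show ?thesis unfolding D_y qd_def q_def
    by (simp add: algebra_simps power2_eq_square)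
qed

text \<open>Differentiate q C^2 = 1 and multiply by C, which turns the inverse of q C into
  C^3.\<close>

lemma D_C: "D C - C = (y * fls_const Sd + 2 * fls_const Rd) * C ^ 3"
proof -
  have "D (q * C ^ 2) = 0" by (simp add: q_C D.const_simps)
  then have "D q * C ^ 2 + 2 * q * C * D C = 0"
    by (simp add: D.mult D.square algebra_simps)
  moreover have "D q * C ^ 3 + 2 * (q * C ^ 2) * D C = C * (D q * C ^ 2 + 2 * q * C * D C)"
    by (simp add: power2_eq_square power3_eq_cube algebra_simps)
  ultimately have "D q * C ^ 3 + 2 * (q * C ^ 2) * D C = 0" by simp
  then have "2 * D C = - (qd - 2 * q) * C ^ 3" by (simp add: q_C D_q algebra_simps add_eq_0_iff)
  also have "\<dots> = - qd * C ^ 3 + 2 * (q * C ^ 2) * C" by (simp add: algebra_simps power2_eq_square power3_eq_cube)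
  finally have "2 * (D C - C) = - qd * C ^ 3" by (simp add: q_C algebra_simps)
  also have "\<dots> = 2 * ((y * fls_const Sd + 2 * fls_const Rd) * C ^ 3)"
    by (simp add: qd_def algebra_simps)
  finally show ?thesis by (rule two_cancel_fls)
qed

text \<open>The cube of \<open>C\<close> in \<open>D_C\<close> is eliminated with u d/du, which
  fixes the coefficients: applied to q C^2 = 1 it expresses y C^3 through the \<open>c n\<close>.
  From 4 R = y^2 - q one then finds R C^3, though not C^3 itself, and this is why the identity
  carries the factor \<open>2 * R\<close>.\<close>

lemma d_c:
  assumes "n \<ge> 1"
  shows "2 * R * (d (c n) + of_nat n * c n) = of_nat n * (2 * R * Sd * c (n - 1) + Rd * beta n)"
proof -
  interpret z: derivation "\<lambda>_. 0 :: 'a" by (rule derivation_zero)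
  interpret t: derivation "fls_lift (\<lambda>_. 0 :: 'a) 1" by (rule z.derivation_fls_lift)
  let ?t = "fls_lift (\<lambda>_. 0 :: 'a) 1"
  have ty: "?t y = - fls_X_inv"
    by (simp add: y_def t.diff z.fls_lift_X_inv z.fls_lift_const)
  have tq: "?t q = - 2 * y * fls_X_inv"
    by (simp add: q_def t.diff t.square ty t.mult t.const_simps z.fls_lift_const)
  have "?t (q * C ^ 2) = 0" by (simp add: q_C t.const_simps)
  then have "?t q * C ^ 2 + 2 * q * C * ?t C = 0"
    by (simp add: t.mult t.square algebra_simps)
  moreover have "?t q * C ^ 3 + 2 * (q * C ^ 2) * ?t C = C * (?t q * C ^ 2 + 2 * q * C * ?t C)"
    by (simp add: power2_eq_square power3_eq_cube algebra_simps)
  ultimately have "?t q * C ^ 3 + 2 * (q * C ^ 2) * ?t C = 0" by simp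
  then have "2 * ?t C = 2 * (y * fls_X_inv * C ^ 3)" by (simp add: q_C tq algebra_simps add_eq_0_iff)
  then have tC: "?t C = y * fls_X_inv * C ^ 3" by (rule two_cancel_fls)
  have "fls_X * ?t C = (fls_X * fls_X_inv) * (y * C ^ 3)" unfolding tC by (simp add: mult_ac)
  then have yC: "y * C ^ 3 = fls_X * ?t C" by (simp add: fls_X_mult_X_inv)
  have tC_nth: "?t C \<section> (int k + 1) = of_nat (k + 1) * c k" for k
    by (simp add: z.fls_lift_nth C_nth algebra_simps)
  obtain m where n: "n = Suc m" using assms by (cases n) auto
  have XtC: "(fls_X * ?t C) \<section> (int n + 1) = of_nat n * c (n - 1)"
    using tC_nth[of m] by (simp add: fls_X_mult_nth n algebra_simps)
  have "4 * fls_const R * C ^ 3 = y * (y * C ^ 3) - (q * C ^ 2) * C"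
    by (simp add: q_def algebra_simps power2_eq_square power3_eq_cube)
  moreover have "y * (fls_X * f) = (fls_X * fls_X_inv) * f - fls_const S * (fls_X * f)" for f
    by (simp add: y_def algebra_simps)
  then have "y * (y * C ^ 3) = (fls_X * fls_X_inv) * ?t C - fls_const S * (fls_X * ?t C)"
    unfolding yC .
  ultimately have "4 * fls_const R * C ^ 3 = ?t C - fls_const S * (fls_X * ?t C) - C"
    by (simp add: q_C fls_X_mult_X_inv)
  moreover have "4 * fls_const R * C ^ 3 = fls_const (4 * R) * C ^ 3"
    by (simp flip: fls_const_mult_const)
  ultimately have "fls_const (4 * R) * C ^ 3 = ?t C - fls_const S * (fls_X * ?t C) - C" by simp
  from arg_cong[OF this, of "\<lambda>f. f \<section> (int n + 1)"]
  have "4 * R * (C ^ 3) \<section> (int n + 1) = of_nat (n + 1) * c n - S * (of_nat n * c (n - 1)) - c n"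
    by (simp only: fls_mult_const_nth fls_minus_nth XtC tC_nth C_nth')
  then have RC: "4 * (R * (C ^ 3) \<section> (int n + 1)) = of_nat n * beta n"
    by (simp add: beta_def algebra_simps)
  have "D C - C = fls_const Sd * (y * C ^ 3) + fls_const (2 * Rd) * C ^ 3"
    unfolding D_C by (simp add: algebra_simps flip: fls_const_mult_const)
  from arg_cong[OF this, of "\<lambda>f. f \<section> (int n + 1)"]
  have "d (c n) + of_int (int n + 1) * 1 * c n - c n =
      Sd * (of_nat n * c (n - 1)) + 2 * Rd * (C ^ 3) \<section> (int n + 1)"
    by (simp only: fls_mult_const_nth fls_minus_nth fls_plus_nth fls_lift_nth C_nth' yC XtC)
  then have "d (c n) + of_nat n * c n = Sd * (of_nat n * c (n - 1)) + 2 * (Rd * (C ^ 3) \<section> (int n + 1))"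
    by (simp add: algebra_simps)
  then have "2 * R * (d (c n) + of_nat n * c n) =
      2 * R * (Sd * (of_nat n * c (n - 1))) + Rd * (4 * (R * (C ^ 3) \<section> (int n + 1)))"
    by (simp add: algebra_simps)
  then show ?thesis unfolding RC by (simp add: algebra_simps)
qed

end

text \<open>As x - S is monic of degree one in x, the coefficients can be read off from the highest
  power of x downwards, even with zero divisors around.\<close>

lemma fls_quadratic_eq_0:
  fixes S :: "'a::comm_ring_1"
  assumes "fls_const A2 * (fls_X_inv - fls_const S) ^ 2 + fls_const A1 * (fls_X_inv - fls_const S) + fls_const A0 = 0"
  shows "A2 = 0" "A1 = 0" "A0 = 0"
proof -
  have eq: "fls_const A2 * fls_X_inv ^ 2 + fls_const (A1 - 2 * A2 * S) * fls_X_inv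
      + fls_const (A2 * S ^ 2 - A1 * S + A0) = 0"
    using assms
    by (simp add: power2_eq_square algebra_simps
        flip: fls_const_mult_const fls_plus_const fls_minus_const)
  have k: "A2 * (fls_X_inv ^ 2) \<section> k + (A1 - 2 * A2 * S) * fls_X_inv \<section> k
      + (fls_const (A2 * S ^ 2 - A1 * S + A0)) \<section> k = 0" for k
    using arg_cong[OF eq, of "\<lambda>f. f \<section> k"]
    by (simp only: fls_mult_const_nth fls_plus_nth fls_zero_nth)
  show A2: "A2 = 0" using k[of "-2"] by simp
  show A1: "A1 = 0" using k[of "-1"] A2 by simp
  show "A0 = 0" using k[of 0] A2 A1 by simp
qed

text \<open>\<open>N\<close> plays the role of \<open>a\<^sub>n d/da\<^sub>n\<close>.\<close>

locale planar_partial = planar_euler a K R S h d + N: derivation N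
  for a :: "nat \<Rightarrow> 'a::comm_ring_1" and K R S h d N +
  fixes n :: nat
  assumes n: "1 \<le> n" "n \<le> K"
    and N_a: "\<And>m. m \<ge> 1 \<Longrightarrow> N (a m) = (if m = n then a n else 0)"
begin

abbreviation NN where "NN \<equiv> fls_lift N 0"

sublocale NN: derivation NN by (rule N.derivation_fls_lift)

definition P where "P = xpoly_part (C * fls_X_inv ^ (n - 1))"
definition ell where "ell = fls_const (c (n - 1)) * y + fls_const (beta n)"

lemma NN_X_inv: "NN fls_X_inv = 0"
  by (simp add: N.fls_lift_X_inv)

lemma NN_V: "NN V = - fls_const (a n) * fls_X_inv ^ (n - 1)"
proof -
  have pow: "NN (fls_X_inv ^ m) = 0" for m
    by (induction m) (simp_all add: NN.mult NN_X_inv NN.const_simps)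
  have "NN V = - (\<Sum>m = 1..K. fls_const (N (a m)) * fls_X_inv ^ (m - 1))"
    by (simp add: V_def NN.diff NN_X_inv NN.sum NN.mult pow N.fls_lift_const)
  also have "(\<Sum>m = 1..K. fls_const (N (a m)) * fls_X_inv ^ (m - 1)) =
      (\<Sum>m = 1..K. if m = n then fls_const (a n) * fls_X_inv ^ (n - 1) else 0)"
    by (intro sum.cong) (auto simp: N_a)
  finally show ?thesis using n by simp
qed

text \<open>C x^(n-1) is P + c_(n-1)/x + c_n/x^2 + ..., and sigma = q C. Multiplying the tail by q,
  of degree two in x, leaves a linear polynomial, which is \<open>ell\<close>, up to O(1/x).\<close>

lemma sigma_X_inv_power:
  "fls_vanishes 1 (sigma * fls_X_inv ^ (n - 1) - (q * P + ell))"
proof -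
  define G where "G = C * fls_X_inv ^ (n - 1) - P"
  have CX: "(C * fls_X_inv ^ (n - 1)) \<section> k = C \<section> (k + int (n - 1))" for k
    by (subst mult.commute) (rule fls_X_inv_power_mult_nth)
  have G: "G \<section> k = (if k \<le> 0 then 0 else C \<section> (k + int (n - 1)))" for k
    by (simp add: G_def P_def xpoly_part_nth CX del: One_nat_def)
  have "1 + int (n - 1) = int (n - 1) + 1" "2 + int (n - 1) = int n + 1" using n by simp_all
  then have G12: "G \<section> 1 = c (n - 1)" "G \<section> 2 = c n"
    by (simp_all only: G C_nth') simp_all
  have 1: "sigma * fls_X_inv ^ (n - 1) - (q * P + ell) = q * G - ell"
    by (simp add: sigma_def G_def algebra_simps)
  have 2: "ell = fls_const (c (n - 1)) * fls_X_inv + fls_const (c n - 2 * S * c (n - 1))"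
    by (simp add: ell_def y_def beta_def algebra_simps
        flip: fls_plus_const fls_minus_const fls_const_mult_const)
  have "(q * G - ell) \<section> k = 0" if "k < 1" for k
    using that G12 by (cases "k = 0"; cases "k = - 1") (auto simp: 2 q_mult_nth G)
  then show ?thesis unfolding 1 fls_vanishes_def by blast
qed

text \<open>The counterpart of \<open>D_M\<close> for a_n d/da_n. The leading coefficient 1 of W is
  killed, so the derivative of W is O(x^-2); the expression is a polynomial in x that tends to 0 at
  infinity, hence zero.\<close>

lemma NN_M: "2 * q * NN M + NN q * M + 2 * fls_const (a n) * (q * P + ell) = 0" (is "?L = 0")
proof -
  have "NN q = 2 * (sigma * NN sigma)"
    using NN.mult[of sigma sigma] by (simp add: sigma_sq mult_ac)
  moreover have "2 * (sigma * NN (sigma * M)) = 2 * (sigma * NN sigma) * M + 2 * (sigma * sigma) * NN M"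
    by (simp add: NN.mult algebra_simps)
  ultimately have 1: "2 * q * NN M + NN q * M = 2 * (sigma * NN (sigma * M))"
    by (simp add: sigma_sq algebra_simps)
  have 2: "NN (sigma * M) = - fls_const (a n) * fls_X_inv ^ (n - 1) - 2 * NN W"
    unfolding V_2W[symmetric] by (simp add: NN.diff NN.mult NN_V NN.const_simps)
  have L: "?L = - 2 * (fls_const (a n) * (sigma * fls_X_inv ^ (n - 1) - (q * P + ell))) - 4 * (sigma * NN W)"
    unfolding 1 2 by (simp add: algebra_simps)
  have "fls_vanishes 2 (NN W)"
    unfolding fls_vanishes_def
  proof (intro allI impI)
    fix i :: int assume "i < 2"
    then show "NN W \<section> i = 0"
      using W_vanishes by (cases "i = 1") (auto simp: N.fls_lift_nth fls_vanishes_def N.const_simps)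
  qed
  then have "fls_vanishes 1 (sigma * NN W)"
    using sigma_vanishes(1) by (rule_tac fls_vanishes_mult'[of "-1" _ 2]) auto
  then have v: "fls_vanishes 1 ?L"
    unfolding L using sigma_X_inv_power by (simp add: fls_vanishes_def)
  have "xpoly ?L"
    unfolding ell_def P_def
    by (intro xpoly_arith xpoly_mult xpoly_numeral N.fls_lift_xpoly xpoly_q xpoly_M xpoly_xpoly_part xpoly_y)
  with v show "?L = 0"
    by (intro fls_eqI) (auto simp: xpoly_def fls_vanishes_def, metis int_one_le_iff_zero_less not_le)
qed

lemma NN_q: "NN q = - 2 * y * fls_const (N S) - 4 * fls_const (N R)"
  by (simp add: q_def y_def NN.diff NN.square NN.mult NN_X_inv NN.const_simps N.fls_lift_const algebra_simps)

text \<open>Modulo \<open>q\<close>, \<open>D_M\<close> and \<open>NN_M\<close> say that M times D q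
  is -8 and that M times NN q is -2 a_n ell. Cross-multiplying shows that q divides 8 NN q - 2 a_n
  ell qd, a polynomial of degree at most two in x, so the quotient is a constant k. With q = y^2 - 4
  R, the y^2 coefficient gives k and the constant one gives \<open>N R\<close>.\<close>

lemma four_N_R: "4 * N R = a n * (beta n * Rd + 2 * R * c (n - 1) * Sd)"
proof -
  define Y where "Y = 2 * (NN M * D q - D M * NN q - M * NN q) + 2 * fls_const (a n) * P * D q
    - 4 * fls_const (a n) * ell"
  \<comment> \<open>eliminating \<open>M\<close> between the two equations, modulo \<open>q\<close>\<close>
  have "0 = (2 * q * NN M + NN q * M + 2 * fls_const (a n) * (q * P + ell)) * D q
      - (2 * q * D M + D q * M + 2 * q * M + 8) * NN q"
    unfolding NN_M D_M by simp
  also have "\<dots> = q * Y - (8 * NN q - 2 * fls_const (a n) * ell * (D q + 2 * q))"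
    unfolding Y_def by (simp add: algebra_simps)
  finally have qY: "q * Y = 8 * NN q - 2 * fls_const (a n) * ell * qd"
    by (simp add: D_q)
  have xY: "xpoly Y"
    unfolding Y_def ell_def P_def
    by (intro xpoly_arith xpoly_mult xpoly_numeral N.fls_lift_xpoly fls_lift_xpoly xpoly_q xpoly_M
        xpoly_xpoly_part xpoly_y)
  have v: "fls_vanishes (- 1) (fls_const s * y + fls_const r)" for r s
    by (simp add: fls_vanishes_def y_def)
  have qd: "qd = fls_const (- 2 * Sd) * y + fls_const (- 4 * Rd)"
    and NNq: "NN q = fls_const (- 2 * N S) * y + fls_const (- 4 * N R)"
    by (simp_all add: qd_def NN_q mult_ac flip: fls_const_mult_const)
  have vell: "fls_vanishes (- 1) ell" and vqd: "fls_vanishes (- 1) qd" and vN: "fls_vanishes (- 1) (NN q)"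
    unfolding ell_def qd NNq by (rule v)+
  \<comment> \<open>Degree at most two for q Y; multiplying by C^2 = 1/q, which is O(x^-2), bounds Y
    at infinity.\<close>
  have "fls_vanishes (- 2) (q * Y)"
    unfolding qY using fls_vanishes_mult(1)[OF vell vqd] vN
    by (simp add: fls_vanishes_def mult.assoc del: fls_const_mult_const)
  moreover have vC: "fls_vanishes 1 C" by (simp add: fls_vanishes_def C_nth)
  ultimately have "fls_vanishes 0 (C ^ 2 * (q * Y))"
    using fls_vanishes_mult(1)[OF fls_vanishes_mult(1)[OF vC vC], of "- 2" "q * Y"]
    by (simp add: power2_eq_square)
  moreover have "C ^ 2 * (q * Y) = (q * C ^ 2) * Y" by (simp only: mult_ac)
  ultimately have "fls_vanishes 0 Y" by (simp add: q_C)
  with xY obtain k where k: "Y = fls_const k" using xpoly_vanishes_eq_const by blast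
  have "fls_const (k - 4 * a n * c (n - 1) * Sd) * y ^ 2
      + fls_const (16 * N S - 4 * a n * (2 * c (n - 1) * Rd + beta n * Sd)) * y
      + fls_const (32 * N R - 8 * a n * beta n * Rd - 4 * R * k)
      = q * Y - (8 * NN q - 2 * fls_const (a n) * ell * qd)"
    unfolding k NN_q qd_def ell_def unfolding q_def
    by (simp add: algebra_simps power2_eq_square flip: fls_plus_const fls_minus_const fls_const_mult_const)
  then have "fls_const (k - 4 * a n * c (n - 1) * Sd) * y ^ 2
      + fls_const (16 * N S - 4 * a n * (2 * c (n - 1) * Rd + beta n * Sd)) * y
      + fls_const (32 * N R - 8 * a n * beta n * Rd - 4 * R * k) = 0"
    using qY by simp
  note A = fls_quadratic_eq_0[OF this[unfolded y_def]]
  have "k = 4 * a n * c (n - 1) * Sd" using A(1) by simp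
  then have "2 * (2 * (2 * (4 * N R))) = 2 * (2 * (2 * (a n * (beta n * Rd + 2 * R * c (n - 1) * Sd))))"
    using A(3) by (simp add: algebra_simps)
  then show ?thesis using two_cancel by blast
qed

text \<open>The brackets on the right of \<open>four_N_R\<close> and \<open>d_c\<close> agree. As
  \<open>d\<close> is twice D, this is (D + n/2) c_n = n d(log R)/da_n multiplied by 2 a_n
  R.\<close>

theorem N_R: "2 * of_nat n * N R = a n * R * (d (c n) + of_nat n * c n)"
proof -
  have "2 * (2 * of_nat n * N R) = of_nat n * (4 * N R)" by (simp add: mult_ac)
  also have "\<dots> = a n * (of_nat n * (2 * R * Sd * c (n - 1) + Rd * beta n))"
    unfolding four_N_R by (simp add: algebra_simps)
  also have "\<dots> = a n * (2 * R * (d (c n) + of_nat n * c n))" using d_c[OF n(1)] by simp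
  also have "\<dots> = 2 * (a n * R * (d (c n) + of_nat n * c n))" by (simp add: mult_ac)
  finally show ?thesis by (rule two_cancel)
qed

end


section \<open>The series R and S\<close>

lemma formal_sum_cong: "(\<And>n. n \<in> I \<Longrightarrow> f n = g n) \<Longrightarrow> formal_sum I f = formal_sum I g"
  unfolding formal_sum_def by (intro arg_cong[where f = Abs_mpser] ext sum.cong) auto

definition RS_map1 :: "rat mpser \<Rightarrow> rat mpser \<Rightarrow> rat mpser" where
  "RS_map1 R S = 1 + formal_sum {1..} (\<lambda>n. avar n * trinomial_off R S (n - 1))"

definition RS_map2 :: "rat mpser \<Rightarrow> rat mpser \<Rightarrow> rat mpser" where
  "RS_map2 R S = formal_sum {1..} (\<lambda>n. avar n * trinomial_diag R S (n - 1))"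

lemma RS_system_iff:
  "RS_system R S \<longleftrightarrow> const_term R = 1 \<and> const_term S = 0 \<and> R = RS_map1 R S \<and> S = RS_map2 R S"
proof -
  have 1: "(\<Sum>j = 1..n. of_nat (((n - 1) choose (j - 1)) * ((n - j) choose j)) * R ^ j * S ^ (n - 2 * j))
      = trinomial_off R S (n - 1)" if "n \<in> {1..}" for n
    using that by (simp add: trinomial_off_def)
  have 2: "(\<Sum>j = 0..n. of_nat (((n - 1) choose (2 * j)) * ((2 * j) choose j)) * R ^ j * S ^ (n - 2 * j - 1))
      = trinomial_diag R S (n - 1)" if n: "n \<in> {1..}" for n
  proof -
    obtain k where k: "n = Suc k" using n by (cases n) auto
    show ?thesis by (simp add: k trinomial_diag_def binomial_eq_0)
  qed
  have "formal_sum {1..} (\<lambda>n. avar n * (\<Sum>j = 1..n. of_nat (((n - 1) choose (j - 1)) * ((n - j) choose j))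
         * R ^ j * S ^ (n - 2 * j))) = formal_sum {1..} (\<lambda>n. avar n * trinomial_off R S (n - 1))"
    by (rule formal_sum_cong) (simp only: 1)
  moreover have "formal_sum {1..} (\<lambda>n. avar n * (\<Sum>j = 0..n. of_nat (((n - 1) choose (2 * j)) * ((2 * j) choose j))
         * R ^ j * S ^ (n - 2 * j - 1))) = formal_sum {1..} (\<lambda>n. avar n * trinomial_diag R S (n - 1))"
    by (rule formal_sum_cong) (simp only: 2)
  ultimately show ?thesis unfolding RS_system_def RS_map1_def RS_map2_def by (simp only:)
qed

lemma RS_map1_coeff:
  "mcoeff (RS_map1 R S) m = (if m = {#} then 1 else 0) +
     (\<Sum>i\<in>set_mset m. mcoeff (trinomial_off R S i) (m - {#i#}))"
  by (simp only: RS_map1_def mcoeff_simps mcoeff_one mcoeff_formal_sum_avar diff_Suc_1)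

lemma RS_map2_coeff:
  "mcoeff (RS_map2 R S) m = (\<Sum>i\<in>set_mset m. mcoeff (trinomial_diag R S i) (m - {#i#}))"
  by (simp only: RS_map2_def mcoeff_formal_sum_avar diff_Suc_1)

section \<open>Solving the system for R and S by contraction\<close>

definition magree :: "nat \<Rightarrow> 'a::comm_ring_1 mpser \<Rightarrow> 'a mpser \<Rightarrow> bool" where
  "magree k f g \<longleftrightarrow> (\<forall>m. size m < k \<longrightarrow> mcoeff f m = mcoeff g m)"

lemma magree_mult:
  assumes "magree k f f'" "magree k g g'"
  shows "magree k (f * g) (f' * g')"
  unfolding magree_def
proof (intro allI impI)
  fix m :: "nat multiset" assume m: "size m < k"
  have "mcoeff f u * mcoeff g (m - u) = mcoeff f' u * mcoeff g' (m - u)" if "u \<subseteq># m" for u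
  proof -
    have "size u < k" "size (m - u) < k"
      using m size_mset_mono[OF that] size_Diff_submset[OF that] by linarith+
    then show ?thesis using assms by (simp add: magree_def)
  qed
  then show "mcoeff (f * g) m = mcoeff (f' * g') m" by (simp add: mcoeff_mult)
qed

lemma magree_refl: "magree k f f" by (simp add: magree_def)

lemma magree_power: "magree k f f' \<Longrightarrow> magree k (f ^ n) (f' ^ n)"
  by (induction n) (auto intro: magree_mult magree_refl)

lemma magree_sum: "(\<And>i. i \<in> I \<Longrightarrow> magree k (f i) (g i)) \<Longrightarrow> magree k (\<Sum>i\<in>I. f i) (\<Sum>i\<in>I. g i)"
  by (auto simp: magree_def mcoeff_sum)

lemma magree_trinomial:
  assumes "magree k R R'" "magree k S S'"
  shows "magree k (trinomial_off R S i) (trinomial_off R' S' i)"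
    "magree k (trinomial_diag R S i) (trinomial_diag R' S' i)"
  unfolding trinomial_off_def trinomial_diag_def
  by (intro magree_sum magree_mult magree_power magree_refl assms)+

text \<open>Each summand carries a variable, so agreement below degree k improves by one degree.
  This contraction yields both existence and uniqueness of the solution.\<close>

lemma magree_RS_map:
  assumes "magree k R R'" "magree k S S'"
  shows "magree (Suc k) (RS_map1 R S) (RS_map1 R' S')"
    "magree (Suc k) (RS_map2 R S) (RS_map2 R' S')"
proof -
  have sz: "size (m - {#i#}) < k" if "i \<in># m" "size m < Suc k" for i m
    using that by (simp add: size_Diff_singleton) (metis Suc_less_SucD Suc_pred nonempty_has_size empty_iff set_mset_empty)
  have "mcoeff (trinomial_off R S i) (m - {#i#}) = mcoeff (trinomial_off R' S' i) (m - {#i#})"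
    "mcoeff (trinomial_diag R S i) (m - {#i#}) = mcoeff (trinomial_diag R' S' i) (m - {#i#})"
    if "i \<in># m" "size m < Suc k" for i m
    using magree_trinomial[OF assms, of i] sz[OF that]
    by (simp_all only: magree_def)
  then show "magree (Suc k) (RS_map1 R S) (RS_map1 R' S')"
    "magree (Suc k) (RS_map2 R S) (RS_map2 R' S')"
    by (simp_all add: magree_def RS_map1_coeff RS_map2_coeff)
qed

lemma magree_all: "(\<And>k. magree k f g) \<Longrightarrow> f = g"
  unfolding magree_def by (intro mpser_eqI) blast

primrec RS_iter :: "nat \<Rightarrow> rat mpser \<times> rat mpser" where
  "RS_iter 0 = (1, 0)"
| "RS_iter (Suc k) = (case RS_iter k of (R, S) \<Rightarrow> (RS_map1 R S, RS_map2 R S))"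

text \<open>The coefficient of \<open>m\<close> is stationary from stage \<open>Suc (size m)\<close>
  of the iteration on.\<close>

definition R_lim :: "rat mpser" where
  "R_lim = Abs_mpser (\<lambda>m. mcoeff (fst (RS_iter (Suc (size m)))) m)"

definition S_lim :: "rat mpser" where
  "S_lim = Abs_mpser (\<lambda>m. mcoeff (snd (RS_iter (Suc (size m)))) m)"

lemma RS_iter_Suc':
  "fst (RS_iter (Suc k)) = RS_map1 (fst (RS_iter k)) (snd (RS_iter k))"
  "snd (RS_iter (Suc k)) = RS_map2 (fst (RS_iter k)) (snd (RS_iter k))"
  by (simp_all add: case_prod_unfold)

lemma magree_RS_iter:
  "magree k (fst (RS_iter (k + j))) (fst (RS_iter k)) \<and> magree k (snd (RS_iter (k + j))) (snd (RS_iter k))"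
proof (induction k)
  case 0
  show ?case by (simp add: magree_def)
next
  case (Suc k)
  show ?case
    unfolding add_Suc RS_iter_Suc' using Suc.IH by (auto intro: magree_RS_map)
qed

lemma magree_RS_lim: "magree k R_lim (fst (RS_iter k))" "magree k S_lim (snd (RS_iter k))"
proof -
  have "mcoeff (fst (RS_iter k)) m = mcoeff (fst (RS_iter (Suc (size m)))) m"
    "mcoeff (snd (RS_iter k)) m = mcoeff (snd (RS_iter (Suc (size m)))) m" if "size m < k" for m
    using magree_RS_iter[of "Suc (size m)" "k - Suc (size m)"] that by (simp_all add: magree_def)
  then show "magree k R_lim (fst (RS_iter k))" "magree k S_lim (snd (RS_iter k))"
    by (simp_all add: magree_def R_lim_def S_lim_def del: RS_iter.simps)
qed

lemma RS_system_lim: "RS_system R_lim S_lim"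
proof -
  have "magree k R_lim (RS_map1 R_lim S_lim)" "magree k S_lim (RS_map2 R_lim S_lim)" for k
  proof -
    have "magree (Suc k) (RS_map1 R_lim S_lim) (fst (RS_iter (Suc k)))"
      "magree (Suc k) (RS_map2 R_lim S_lim) (snd (RS_iter (Suc k)))"
      unfolding RS_iter_Suc' by (intro magree_RS_map magree_RS_lim)+
    with magree_RS_lim[of "Suc k"]
    show "magree k R_lim (RS_map1 R_lim S_lim)" "magree k S_lim (RS_map2 R_lim S_lim)"
      by (simp_all add: magree_def)
  qed
  then have eq: "R_lim = RS_map1 R_lim S_lim" "S_lim = RS_map2 R_lim S_lim"
    by (auto intro: magree_all)
  have "const_term (RS_map1 R_lim S_lim) = 1" "const_term (RS_map2 R_lim S_lim) = 0"
    by (simp_all add: const_term_def RS_map1_coeff RS_map2_coeff)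
  with eq show ?thesis unfolding RS_system_iff by metis
qed

lemma RS_system_unique:
  assumes "RS_system R S" "RS_system R' S'"
  shows "R = R'" "S = S'"
proof -
  have eqs: "R = RS_map1 R S" "S = RS_map2 R S" "R' = RS_map1 R' S'" "S' = RS_map2 R' S'"
    using assms by (auto simp: RS_system_iff)
  have "magree k R R' \<and> magree k S S'" for k
  proof (induction k)
    case (Suc k)
    then have "magree (Suc k) (RS_map1 R S) (RS_map1 R' S')" "magree (Suc k) (RS_map2 R S) (RS_map2 R' S')"
      by (auto intro: magree_RS_map)
    then show ?case using eqs by simp
  qed (simp add: magree_def)
  then show "R = R'" "S = S'" by (auto intro: magree_all)
qed

lemma RS_ser_eq: "R_ser = R_lim" "S_ser = S_lim"
proof -
  have "(THE (R, S). RS_system R S) = (R_lim, S_lim)"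
    using RS_system_lim RS_system_unique by (intro the_equality) auto
  then show "R_ser = R_lim" "S_ser = S_lim" by (simp_all add: R_ser_def S_ser_def)
qed

lemma RS_system_ser: "RS_system R_ser S_ser"
  unfolding RS_ser_eq by (rule RS_system_lim)

section \<open>Parity of the total index of a monomial\<close>

definition mweight :: "nat multiset \<Rightarrow> nat" where
  "mweight m = (\<Sum>i\<in>#m. Suc i)"

lemma mweight_add: "mweight (u + v) = mweight u + mweight v"
  by (simp add: mweight_def)

lemma mweight_diff: "u \<subseteq># m \<Longrightarrow> mweight m = mweight u + mweight (m - u)"
  using mweight_add[of u "m - u"] by simp

lemma mweight_remove: "i \<in># m \<Longrightarrow> mweight m = Suc i + mweight (m - {#i#})"
  using mweight_diff[of "{#i#}" m] by (simp add: mweight_def)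

text \<open>Behaviour under a_n -> (-1)^n a_n: R is even and S is odd. Evenness is what leaves only
  integral powers of t after the scaling by powers of t^(1/2).\<close>

definition mparity :: "nat \<Rightarrow> 'a::comm_ring_1 mpser \<Rightarrow> bool" where
  "mparity e f \<longleftrightarrow> (\<forall>m. odd (mweight m + e) \<longrightarrow> mcoeff f m = 0)"

lemma mparity_mult:
  assumes "mparity e f" "mparity e' g"
  shows "mparity (e + e') (f * g)"
  unfolding mparity_def mcoeff_mult
proof (intro allI impI sum.neutral ballI)
  fix m u :: "nat multiset" assume "odd (mweight m + (e + e'))" "u \<in> {u. u \<subseteq># m}"
  then have "odd (mweight u + e) \<or> odd (mweight (m - u) + e')"
    by (auto simp: mweight_diff[of u m])
  then show "mcoeff f u * mcoeff g (m - u) = 0"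
    using assms by (auto simp: mparity_def)
qed

lemma mparity_mconst: "mparity 0 (mconst c)"
  by (auto simp: mparity_def mcoeff_mconst mweight_def)

lemma mparity_power: "mparity e f \<Longrightarrow> mparity (n * e) (f ^ n)"
proof (induction n)
  case 0
  then show ?case using mparity_mconst[of 1] by (simp add: mconst_1)
next
  case (Suc n)
  then show ?case using mparity_mult[of e f "n * e" "f ^ n"] by simp
qed

lemma mparity_trinomial:
  assumes R: "mparity 0 R" and S: "mparity 1 S"
  shows "mparity (Suc i) (trinomial_off R S i)" "mparity i (trinomial_diag R S i)"
proof -
  have t: "mparity k (of_nat c * R ^ j * S ^ (k - 2 * j))" if "2 * j \<le> k \<or> c = 0" for c j k
  proof (cases "2 * j \<le> k")
    case True
    have "mparity (0 + j * 0 + (k - 2 * j) * 1) (of_nat c * R ^ j * S ^ (k - 2 * j))"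
      unfolding of_nat_mpser by (intro mparity_mult mparity_power mparity_mconst R S)
    with True show ?thesis by (simp add: mparity_def)
  qed (use that in \<open>auto simp: mparity_def\<close>)
  have s: "mparity k (\<Sum>j\<in>I. f j)" if "\<And>j. j \<in> I \<Longrightarrow> mparity k (f j)" for k I and f :: "nat \<Rightarrow> 'a mpser"
    using that by (auto simp: mparity_def mcoeff_sum)
  show "mparity (Suc i) (trinomial_off R S i)"
    unfolding trinomial_off_def by (rule s, rule t) (auto simp: binomial_eq_0_iff)
  show "mparity i (trinomial_diag R S i)"
    unfolding trinomial_diag_def by (rule s, rule t) (auto simp: binomial_eq_0_iff)
qed

lemma mparity_RS_map:
  assumes "mparity 0 R" "mparity 1 S"
  shows "mparity 0 (RS_map1 R S)" "mparity 1 (RS_map2 R S)"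
proof -
  note t = mparity_trinomial[OF assms, unfolded mparity_def]
  have "mcoeff (trinomial_off R S i) (m - {#i#}) = 0" if "odd (mweight m)" "i \<in># m" for i m
    using t(1) mweight_remove[OF that(2)] that(1) by (metis add.commute)
  moreover have "mcoeff (trinomial_diag R S i) (m - {#i#}) = 0" if "odd (Suc (mweight m))" "i \<in># m" for i m
    using t(2) mweight_remove[OF that(2)] that(1) by (metis add.commute add_Suc even_Suc)
  ultimately show "mparity 0 (RS_map1 R S)" "mparity 1 (RS_map2 R S)"
    by (auto simp: mparity_def RS_map1_coeff RS_map2_coeff mweight_def intro!: sum.neutral)
qed

lemma mparity_R_ser: "mparity 0 R_ser"
proof -
  have "mparity 0 (fst (RS_iter k)) \<and> mparity 1 (snd (RS_iter k))" for k
  proof (induction k)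
    case 0
    show ?case using mparity_mconst[of "1 :: rat"] by (simp add: mconst_1) (simp add: mparity_def)
  next
    case (Suc k)
    then show ?case unfolding RS_iter_Suc' using mparity_RS_map by blast
  qed
  then show ?thesis unfolding RS_ser_eq by (simp add: mparity_def R_lim_def del: RS_iter.simps)
qed


section \<open>The planar loop equation\<close>

text \<open>Setting \<open>a\<^sub>n = 0\<close> for \<open>n > K\<close> makes the potential a polynomial in \<open>x\<close>.\<close>

definition mtrunc :: "nat \<Rightarrow> 'a::comm_ring_1 mpser \<Rightarrow> 'a mpser" where
  "mtrunc K f = Abs_mpser (\<lambda>m. if set_mset m \<subseteq> {..<K} then mcoeff f m else 0)"

lemma mcoeff_mtrunc: "mcoeff (mtrunc K f) m = (if set_mset m \<subseteq> {..<K} then mcoeff f m else 0)"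
  by (simp add: mtrunc_def)

lemma mtrunc_add: "mtrunc K (f + g) = mtrunc K f + mtrunc K g"
  by (rule mpser_eqI) (simp add: mcoeff_mtrunc)

lemma mtrunc_mconst: "mtrunc K (mconst c) = mconst c"
  by (rule mpser_eqI) (simp add: mcoeff_mtrunc mcoeff_mconst)

lemma mtrunc_one: "mtrunc K 1 = 1"
  using mtrunc_mconst[of K 1] by (simp add: mconst_1)

lemma mtrunc_mult: "mtrunc K (f * g) = mtrunc K f * mtrunc K g"
proof (rule mpser_eqI)
  fix m
  show "mcoeff (mtrunc K (f * g)) m = mcoeff (mtrunc K f * mtrunc K g) m"
  proof (cases "set_mset m \<subseteq> {..<K}")
    case True
    have "set_mset u \<subseteq> {..<K}" "set_mset (m - u) \<subseteq> {..<K}" if "u \<subseteq># m" for u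
      using True set_mset_mono[OF that] by (auto dest: in_diffD)
    then show ?thesis using True by (simp add: mcoeff_mtrunc mcoeff_mult)
  next
    case False
    have "\<not> (set_mset u \<subseteq> {..<K} \<and> set_mset (m - u) \<subseteq> {..<K})" if "u \<subseteq># m" for u
      using False that by (metis Un_least set_mset_union subset_mset.add_diff_inverse)
    then show ?thesis using False by (auto simp: mcoeff_mtrunc mcoeff_mult intro!: sum.neutral)
  qed
qed

lemma mtrunc_power: "mtrunc K (f ^ n) = mtrunc K f ^ n"
  by (induction n) (simp_all add: mtrunc_one mtrunc_mult)

lemma mtrunc_sum: "mtrunc K (\<Sum>i\<in>I. f i) = (\<Sum>i\<in>I. mtrunc K (f i))"
  by (rule mpser_eqI) (simp add: mcoeff_mtrunc mcoeff_sum)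

lemma mtrunc_of_nat: "mtrunc K (of_nat n) = of_nat n"
  by (simp add: of_nat_mpser mtrunc_mconst)

lemma mtrunc_trinomial:
  "mtrunc K (trinomial_off R S i) = trinomial_off (mtrunc K R) (mtrunc K S) i"
  "mtrunc K (trinomial_diag R S i) = trinomial_diag (mtrunc K R) (mtrunc K S) i"
  by (simp_all add: trinomial_off_def trinomial_diag_def mtrunc_sum mtrunc_mult mtrunc_power mtrunc_of_nat
      del: of_nat_mult)

lemma mtrunc_mdiag: "mtrunc K (mdiag l f) = mdiag l (mtrunc K f)"
  by (rule mpser_eqI) (simp add: mcoeff_mtrunc)

lemma mtrunc_formal_sum_avar:
  "mtrunc K (formal_sum {1..} (\<lambda>n. avar n * g n)) = (\<Sum>n = 1..K. avar n * mtrunc K (g n))"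
proof (rule mpser_eqI)
  fix m
  have "mcoeff (\<Sum>n = 1..K. avar n * mtrunc K (g n)) m =
      (\<Sum>n\<in>Suc ` {..<K}. mcoeff (avar n * mtrunc K (g n)) m)"
    unfolding mcoeff_sum by (intro sum.cong) (auto simp: image_iff Suc_le_eq gr0_conv_Suc)
  also have "\<dots> = (\<Sum>i<K. mcoeff (avar (Suc i) * mtrunc K (g (Suc i))) m)"
    by (simp add: sum.reindex)
  also have "\<dots> = (\<Sum>i\<in>{..<K} \<inter> set_mset m. mcoeff (mtrunc K (g (Suc i))) (m - {#i#}))"
    by (subst sum.inter_restrict) (auto simp: mcoeff_avar_mult intro!: sum.cong)
  also have "\<dots> = mcoeff (mtrunc K (formal_sum {1..} (\<lambda>n. avar n * g n))) m"
  proof (cases "set_mset m \<subseteq> {..<K}")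
    case True
    then have "{..<K} \<inter> set_mset m = set_mset m" by auto
    moreover have "set_mset (m - {#i#}) \<subseteq> {..<K}" for i using True by (auto dest: in_diffD)
    ultimately show ?thesis using True by (simp add: mcoeff_mtrunc mcoeff_formal_sum_avar del: One_nat_def)
  next
    case False
    have "\<not> set_mset (m - {#i#}) \<subseteq> {..<K}" if "i < K" "i \<in># m" for i
      using False that by (metis insert_DiffM insert_subset lessThan_iff set_mset_add_mset_insert)
    then show ?thesis using False by (auto simp: mcoeff_mtrunc intro!: sum.neutral)
  qed
  finally show "mcoeff (mtrunc K (formal_sum {1..} (\<lambda>n. avar n * g n))) m =
      mcoeff (\<Sum>n = 1..K. avar n * mtrunc K (g n)) m" ..
qed

definition planar_solution :: "(nat \<Rightarrow> rat mpser) \<Rightarrow> bool" where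
  "planar_solution w \<longleftrightarrow> w 0 = 1 \<and> (\<forall>k. w (Suc k) =
     formal_sum {1..} (\<lambda>n. avar n * w (n - 1 + k)) + (\<Sum>r<k. w r * w (k - 1 - r)))"

text \<open>The index plus the weight of the monomial decreases: removing a_n costs weight n while
  the index changes from k + 1 to n - 1 + k, and the two indices in a product add up to k - 1
  only.\<close>

lemma finite_planar_unique:
  fixes w w' :: "nat \<Rightarrow> 'a::comm_ring_1 mpser"
  assumes w0: "w 0 = 1" "w' 0 = 1"
    and w: "\<And>k. w (Suc k) = (\<Sum>n = 1..K. avar n * w (n - 1 + k)) + (\<Sum>r<k. w r * w (k - 1 - r))"
    and w': "\<And>k. w' (Suc k) = (\<Sum>n = 1..K. avar n * w' (n - 1 + k)) + (\<Sum>r<k. w' r * w' (k - 1 - r))"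
  shows "w k = w' k"
proof (rule mpser_eqI)
  fix m
  show "mcoeff (w k) m = mcoeff (w' k) m"
  proof (induction "k + mweight m" arbitrary: k m rule: less_induct)
    case less
    show ?case
    proof (cases k)
      case 0
      then show ?thesis by (simp add: w0)
    next
      case (Suc l)
      have "mcoeff (avar n * w (n - 1 + l)) m = mcoeff (avar n * w' (n - 1 + l)) m" if "n \<in> {1..K}" for n
        using that mweight_remove[of "n - 1" m] by (auto simp: mcoeff_avar_mult Suc intro!: less)
      moreover have "mcoeff (w r * w (l - 1 - r)) m = mcoeff (w' r * w' (l - 1 - r)) m" if "r < l" for r
        unfolding mcoeff_mult
      proof (rule sum.cong)
        fix u assume "u \<in> {u. u \<subseteq># m}"
        then have "mweight m = mweight u + mweight (m - u)" using mweight_diff by simp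
        with \<open>r < l\<close> show "mcoeff (w r) u * mcoeff (w (l - 1 - r)) (m - u) =
            mcoeff (w' r) u * mcoeff (w' (l - 1 - r)) (m - u)"
          by (intro arg_cong2[where f = "(*)"] less) (auto simp: Suc)
      qed simp
      ultimately show ?thesis
        unfolding Suc w w' mcoeff_simps mcoeff_sum by simp
    qed
  qed
qed

text \<open>The eigenvalue of 2 t d/dt: index \<open>i\<close> stands for a_(i+1), of weight i - 1.
  It is rational because a_1 has weight -1.\<close>

definition euler_weight :: "nat multiset \<Rightarrow> rat" where
  "euler_weight m = (\<Sum>i\<in>#m. of_nat (Suc i) - 2)"

lemma additive_euler_weight: "additive_weight euler_weight"
  unfolding euler_weight_def by (rule additive_weight_sum_mset)

lemma derivation_mdiag: "additive_weight l \<Longrightarrow> derivation (mdiag l)"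
  by standard (simp_all add: mdiag_add mdiag_mult)

text \<open>With d = 2 D, the operator (D + 1)(D + 2) becomes (d + 2)(d + 4) / 4, which acts on each
  monomial by a scalar. For a nonempty monomial the identity is checked after applying a_n d/da_n
  for some variable a_n in it.\<close>

theorem planar_free_energy_eq:
  assumes w: "planar_solution w" and F0: "const_term F = 0"
    and F: "\<And>n. n \<ge> 1 \<Longrightarrow> of_nat n * mdiag (\<lambda>m. of_nat (count m (n - 1))) F = avar n * w n"
  shows "(euler_weight m + 2) * (euler_weight m + 4) * mcoeff F m = 4 * mcoeff (mlog R_ser) m"
proof (cases "m = {#}")
  case True
  have "const_term R_ser = 1" using RS_system_ser by (simp add: RS_system_def)
  then show ?thesis
    using F0 const_term_mlog[of R_ser] True by (simp add: const_term_def)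
next
  case False
  then obtain i where i: "i \<in># m" by (meson multiset_nonemptyE)
  \<comment> \<open>Large enough that truncation keeps the coefficient of \<open>m\<close> and of
    its sub-multisets.\<close>
  define K where "K = Suc (Max (set_mset m))"
  have mK: "set_mset m \<subseteq> {..<K}" by (auto simp: K_def le_imp_less_Suc)
  define n where "n = Suc i"
  have ni: "1 \<le> n" "n \<le> K" "n - 1 = i" using i mK by (auto simp: n_def)
  let ?R = "mtrunc K R_ser" and ?S = "mtrunc K S_ser"
  let ?d = "mdiag euler_weight" and ?N = "mdiag (\<lambda>m. of_nat (count m (n - 1)) :: rat)"
  have addN: "additive_weight (\<lambda>m. of_nat (count m (n - 1)) :: rat)" by (rule additive_weight_count)
  have RS: "R_ser = RS_map1 R_ser S_ser" "S_ser = RS_map2 R_ser S_ser" "const_term R_ser = 1"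
    using RS_system_ser by (simp_all add: RS_system_iff)
  interpret planar_partial avar K ?R ?S "mconst (1 / 2)" ?d ?N n
  proof (intro planar_partial.intro planar_euler.intro planar_data.intro planar_euler_axioms.intro
      planar_partial_axioms.intro derivation_mdiag additive_euler_weight addN ni(1,2))
    show "2 * mconst (1 / 2 :: rat) = 1"
      by (simp add: numeral_mpser mconst_1 flip: mconst_mult)
    show "?R = 1 + (\<Sum>n = 1..K. avar n * trinomial_off ?R ?S (n - 1))"
      by (subst RS(1)) (simp only: RS_map1_def mtrunc_add mtrunc_one mtrunc_formal_sum_avar mtrunc_trinomial)
    show "?S = (\<Sum>n = 1..K. avar n * trinomial_diag ?R ?S (n - 1))"
      by (subst RS(2)) (simp only: RS_map2_def mtrunc_formal_sum_avar mtrunc_trinomial)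
    show "?d (avar k) = (of_nat k - 2) * avar k" if "k \<ge> 1" for k
      using that by (intro mpser_eqI)
        (auto simp: mdiag_avar euler_weight_def left_diff_distrib of_nat_diff)
    show "?N (avar k) = (if k = n then avar n else 0)" if "k \<ge> 1" for k
      using that ni(1) by (intro mpser_eqI) (auto simp: mdiag_avar)
  qed
  let ?w = "planar_data.w avar K ?R ?S (mconst (1 / 2))"
  have w_eq: "mtrunc K (w k) = planar_data.w avar K ?R ?S (mconst (1 / 2)) k" for k
  proof (rule finite_planar_unique)
    show "mtrunc K (w 0) = 1" using w by (simp add: planar_solution_def mtrunc_one)
    show "mtrunc K (w (Suc k)) = (\<Sum>n = 1..K. avar n * mtrunc K (w (n - 1 + k))) +
        (\<Sum>r<k. mtrunc K (w r) * mtrunc K (w (k - 1 - r)))" for k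
      using w by (simp only: planar_solution_def mtrunc_add mtrunc_sum mtrunc_mult mtrunc_formal_sum_avar)
  qed (rule w_0 planar_loop)+
  define L where "L = mlog R_ser"
  have L: "?N L * R_ser = ?N R_ser"
    unfolding L_def by (rule mdiag_mlog[OF addN RS(3)])
  define cn where "cn = ?d (c n) + of_nat n * c n"
  have "2 * of_nat n * ?N (mtrunc K L) * ?R = 2 * of_nat n * ?N ?R"
    using arg_cong[OF L, of "mtrunc K"] by (simp add: mtrunc_mult mtrunc_mdiag mult.assoc)
  also have "\<dots> = avar n * cn * ?R" unfolding N_R cn_def by (simp only: mult_ac)
  finally have "2 * of_nat n * ?N (mtrunc K L) = avar n * cn"
    by (rule mpser_unit_cancel_eq) (use RS(3) in \<open>simp add: const_term_def mcoeff_mtrunc\<close>)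
  from arg_cong[OF this, of "\<lambda>f. mcoeff f m"]
  have 1: "2 * of_nat n * of_nat (count m i) * mcoeff L m =
      (euler_weight (m - {#i#}) + of_nat n) * mcoeff (c n) (m - {#i#})"
    using i ni mK by (simp add: mcoeff_avar_mult cn_def mcoeff_mtrunc mult.assoc distrib_right del: One_nat_def)
  have "?d (mtrunc K (w n)) + of_nat (n + 2) * mtrunc K (w n) = 2 * c n"
    unfolding w_eq by (rule d_w)
  from arg_cong[OF this, of "\<lambda>f. mcoeff f (m - {#i#})"]
  have 2: "(euler_weight (m - {#i#}) + of_nat n + 2) * mcoeff (w n) (m - {#i#}) =
      2 * mcoeff (c n) (m - {#i#})"
    using mK in_diffD[of _ m "{#i#}"] by (simp add: mcoeff_mtrunc subset_iff algebra_simps split: if_splits)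
  from arg_cong[OF F[OF ni(1)], of "\<lambda>f. mcoeff f m"]
  have 3: "of_nat n * of_nat (count m i) * mcoeff F m = mcoeff (w n) (m - {#i#})"
    using i ni by (simp add: mcoeff_avar_mult mult.assoc del: One_nat_def)
  \<comment> \<open>After this shift the eigenvalue in \<open>2\<close> is
    \<open>euler_weight m + 4\<close> and the one in \<open>1\<close> is
    \<open>euler_weight m + 2\<close>: the two factors of the claim.\<close>
  have e: "euler_weight m = euler_weight (m - {#i#}) + of_nat n - 2"
    using additive_euler_weight[unfolded additive_weight_def, rule_format, of "{#i#}" "m - {#i#}"] i
    by (simp add: euler_weight_def n_def)
  have nz: "of_nat n * of_nat (count m i) \<noteq> (0 :: rat)" using i ni by simp
  have "of_nat n * of_nat (count m i) * ((euler_weight m + 2) * (euler_weight m + 4) * mcoeff F m)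
      = (euler_weight m + 2) * ((euler_weight m + 4) * mcoeff (w n) (m - {#i#}))"
    unfolding 3[symmetric] by (simp only: mult_ac)
  also have "\<dots> = 2 * (2 * of_nat n * of_nat (count m i) * mcoeff L m)"
    unfolding 1 using 2 by (simp add: e algebra_simps)
  also have "\<dots> = of_nat n * of_nat (count m i) * (4 * mcoeff L m)" by simp
  finally show ?thesis using nz unfolding L_def by (metis mult_left_cancel)
qed


section \<open>Gaussian integration by parts\<close>

definition gauss_moment :: "real \<Rightarrow> nat \<Rightarrow> complex" where
  "gauss_moment s k = (LINT x|lborel. complex_of_real (x ^ k * exp (- s * x\<^sup>2 / 2)))"

lemma gaussian_power_integral:
  assumes s: "s > 0"
  shows "integrable lborel (\<lambda>x. x ^ k * exp (- s * x\<^sup>2 / 2))"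
    and "(LINT x|lborel. x ^ k * exp (- s * x\<^sup>2 / 2)) =
      (if even k then sqrt (2 * pi / s) * fact k / ((2 * s) ^ (k div 2) * fact (k div 2)) else 0)"
proof -
  define \<sigma> where "\<sigma> = 1 / sqrt s"
  have \<sigma>: "\<sigma> > 0" "\<sigma>\<^sup>2 = 1 / s" using s by (simp_all add: \<sigma>_def power_divide)
  have nd: "sqrt (2 * pi / s) * (normal_density 0 \<sigma> x * (x - 0) ^ k) = x ^ k * exp (- s * x\<^sup>2 / 2)" for x
    using s by (simp add: normal_density_def \<sigma>(2) real_sqrt_divide mult_ac)
  show "integrable lborel (\<lambda>x. x ^ k * exp (- s * x\<^sup>2 / 2))"
    unfolding nd[symmetric] by (intro integrable_mult_right integrable_normal_moment \<sigma>)
  have "(LINT x|lborel. x ^ k * exp (- s * x\<^sup>2 / 2)) =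
      sqrt (2 * pi / s) * (LINT x|lborel. normal_density 0 \<sigma> x * (x - 0) ^ k)"
    unfolding nd[symmetric] by (rule integral_mult_right_zero)
  also have "(LINT x|lborel. normal_density 0 \<sigma> x * (x - 0) ^ k) =
      (if even k then fact k / ((2 * s) ^ (k div 2) * fact (k div 2)) else 0)"
  proof (cases "even k")
    case True
    then obtain j where "k = 2 * j" by (elim evenE)
    then show ?thesis using integral_normal_moment_even[OF \<sigma>(1), of 0 j] \<sigma>(2) by simp
  next
    case False
    then obtain j where "k = 2 * j + 1" by (elim oddE)
    then show ?thesis using integral_normal_moment_odd[OF \<sigma>(1), of 0 j] by simp
  qed
  finally show "(LINT x|lborel. x ^ k * exp (- s * x\<^sup>2 / 2)) =
      (if even k then sqrt (2 * pi / s) * fact k / ((2 * s) ^ (k div 2) * fact (k div 2)) else 0)"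
    by simp
qed

lemma gauss_moment_integrable:
  "s > 0 \<Longrightarrow> integrable lborel (\<lambda>x. complex_of_real (x ^ k * exp (- s * x\<^sup>2 / 2)))"
  by (intro integrable_of_real gaussian_power_integral(1))

text \<open>Integration by parts in one variable, read off from the closed form of the moments. At
  \<open>k = 0\<close> the truncated index is multiplied by zero.\<close>

lemma gauss_moment_Suc:
  assumes "s > 0"
  shows "of_real s * gauss_moment s (Suc k) = of_nat k * gauss_moment s (k - 1)"
proof -
  let ?m = "\<lambda>k. if even k then sqrt (2 * pi / s) * fact k / ((2 * s) ^ (k div 2) * fact (k div 2)) else 0"
  have g: "gauss_moment s k = of_real (?m k)" for k
    unfolding gauss_moment_def using gaussian_power_integral(2)[OF assms] by (simp only: integral_complex_of_real)
  have "s * ?m (Suc k) = real k * ?m (k - 1)"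
  proof (cases "odd k")
    case True
    then obtain j where k: "k = 2 * j + 1" by (elim oddE)
    define Q P where "Q = sqrt (2 * pi / s)" and "P = (2 * s) ^ j"
    have f: "fact (2 * j + 2) = (2 * (real j + 1)) * ((2 * real j + 1) * fact (2 * j))"
      by (simp add: algebra_simps)
    have "s * ?m (Suc k) = s * (Q * fact (2 * j + 2) / (2 * s * P * ((real j + 1) * fact j)))"
      by (simp add: k Q_def P_def algebra_simps)
    also have "\<dots> = (2 * real j + 1) * (Q * fact (2 * j) / (P * fact j))"
      using assms by (simp only: f) (simp add: P_def divide_simps)
    also have "\<dots> = real k * ?m (k - 1)"
      by (simp add: k Q_def P_def)
    finally show ?thesis .
  next
    case False
    then show ?thesis by (cases "k = 0") auto
  qed
  then have "complex_of_real (s * ?m (Suc k)) = complex_of_real (real k * ?m (k - 1))"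
    by (rule arg_cong)
  then show ?thesis by (simp only: g of_real_mult of_real_of_nat_eq)
qed

lemma gauss_moment_0: "s > 0 \<Longrightarrow> gauss_moment s 0 \<noteq> 0"
  unfolding gauss_moment_def using gaussian_power_integral(2)[of s 0] by (simp only: integral_complex_of_real) simp

section \<open>Product Gaussian measures and integration by parts in a complex direction\<close>

locale gauss_coords =
  fixes I :: "'i set" and s :: "'i \<Rightarrow> real"
  assumes finite_I: "finite I" and s_pos: "\<And>p. s p > 0"
begin

definition weight :: "('i \<Rightarrow> real) \<Rightarrow> complex" where
  "weight x = (\<Prod>p\<in>I. complex_of_real (exp (- s p * (x p)\<^sup>2 / 2)))"

definition monomial :: "('i \<Rightarrow> nat) \<Rightarrow> ('i \<Rightarrow> real) \<Rightarrow> complex" where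
  "monomial k x = (\<Prod>p\<in>I. complex_of_real (x p) ^ k p)"

definition GI :: "(('i \<Rightarrow> real) \<Rightarrow> complex) \<Rightarrow> complex" where
  "GI f = (LINT x|(\<Pi>\<^sub>M p\<in>I. lborel). weight x * f x)"

definition gint :: "(('i \<Rightarrow> real) \<Rightarrow> complex) \<Rightarrow> bool" where
  "gint f \<longleftrightarrow> integrable (\<Pi>\<^sub>M p\<in>I. lborel) (\<lambda>x. weight x * f x)"

lemma weight_monomial:
  "weight x * monomial k x = (\<Prod>p\<in>I. complex_of_real (x p ^ k p * exp (- s p * (x p)\<^sup>2 / 2)))"
  by (simp add: weight_def monomial_def mult.commute flip: prod.distrib)

lemma gint_monomial: "gint (monomial k)"
proof -
  interpret product_sigma_finite "\<lambda>_ :: 'i. lborel :: real measure" ..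
  show ?thesis
    unfolding gint_def weight_monomial
    by (rule product_integrable_prod, rule finite_I, rule gauss_moment_integrable, rule s_pos)
qed

lemma GI_monomial: "GI (monomial k) = (\<Prod>p\<in>I. gauss_moment (s p) (k p))"
proof -
  interpret product_sigma_finite "\<lambda>_ :: 'i. lborel :: real measure" ..
  show ?thesis
    unfolding GI_def weight_monomial gauss_moment_def
    by (rule product_integral_prod, rule finite_I, rule gauss_moment_integrable, rule s_pos)
qed

lemma monomial_Suc: "p \<in> I \<Longrightarrow> monomial (k(p := Suc (k p))) x = of_real (x p) * monomial k x"
  using finite_I by (simp add: monomial_def prod.remove)

lemma monomial_0: "monomial (\<lambda>_. 0) x = 1"
  by (simp add: monomial_def)

lemma GI_monomial_Suc:
  assumes "p \<in> I"
  shows "of_real (s p) * GI (monomial (k(p := Suc (k p)))) = of_nat (k p) * GI (monomial (k(p := k p - 1)))"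
  using gauss_moment_Suc[OF s_pos[of p], of "k p"] assms finite_I
  by (simp add: GI_monomial prod.remove mult.assoc[symmetric])

lemma GI_1_nonzero: "GI (\<lambda>x. 1) \<noteq> 0"
proof -
  have "GI (\<lambda>x. 1) = GI (monomial (\<lambda>_. 0))"
    by (rule arg_cong[where f = GI]) (simp add: fun_eq_iff monomial_0)
  then show ?thesis using finite_I gauss_moment_0 s_pos by (simp add: GI_monomial)
qed

lemma gint_add: "gint f \<Longrightarrow> gint g \<Longrightarrow> gint (\<lambda>x. f x + g x)"
  unfolding gint_def distrib_left by (rule Bochner_Integration.integrable_add)

lemma gint_scale: "gint f \<Longrightarrow> gint (\<lambda>x. c * f x)"
  unfolding gint_def using integrable_mult_right[of c] by (simp add: mult.left_commute)

lemma gint_sum: "(\<And>i. i \<in> J \<Longrightarrow> gint (f i)) \<Longrightarrow> gint (\<lambda>x. \<Sum>i\<in>J. f i x)"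
  unfolding gint_def sum_distrib_left by (rule Bochner_Integration.integrable_sum)

lemma GI_add: "gint f \<Longrightarrow> gint g \<Longrightarrow> GI (\<lambda>x. f x + g x) = GI f + GI g"
  unfolding gint_def GI_def distrib_left by (rule Bochner_Integration.integral_add)

lemma GI_scale: "GI (\<lambda>x. c * f x) = c * GI f"
  unfolding GI_def by (simp add: mult.left_commute)

lemma GI_sum: "(\<And>i. i \<in> J \<Longrightarrow> gint (f i)) \<Longrightarrow> GI (\<lambda>x. \<Sum>i\<in>J. f i x) = (\<Sum>i\<in>J. GI (f i))"
  unfolding gint_def GI_def sum_distrib_left by (rule Bochner_Integration.integral_sum)

text \<open>Relates a polynomial function to its derivative in the complex direction \<open>v\<close>.\<close>

inductive pderiv_dir :: "('i \<Rightarrow> complex) \<Rightarrow> (('i \<Rightarrow> real) \<Rightarrow> complex) \<Rightarrow> (('i \<Rightarrow> real) \<Rightarrow> complex) \<Rightarrow> bool"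
  for v where
  one: "pderiv_dir v (\<lambda>x. 1) (\<lambda>x. 0)"
| var: "p \<in> I \<Longrightarrow> pderiv_dir v f g \<Longrightarrow>
    pderiv_dir v (\<lambda>x. of_real (x p) * f x) (\<lambda>x. v p * f x + of_real (x p) * g x)"
| add: "pderiv_dir v f g \<Longrightarrow> pderiv_dir v f' g' \<Longrightarrow> pderiv_dir v (\<lambda>x. f x + f' x) (\<lambda>x. g x + g' x)"
| scale: "pderiv_dir v f g \<Longrightarrow> pderiv_dir v (\<lambda>x. c * f x) (\<lambda>x. c * g x)"

lemma pderiv_dir_const: "pderiv_dir v (\<lambda>x. c) (\<lambda>x. 0)"
  using pderiv_dir.scale[OF pderiv_dir.one, of v c] by simp

lemma pderiv_dir_coord: "p \<in> I \<Longrightarrow> pderiv_dir v (\<lambda>x. of_real (x p)) (\<lambda>x. v p)"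
  using pderiv_dir.var[OF _ pderiv_dir.one, of p v] by simp

lemma pderiv_dir_mult:
  assumes "pderiv_dir v f g" "pderiv_dir v f' g'"
  shows "pderiv_dir v (\<lambda>x. f x * f' x) (\<lambda>x. g x * f' x + f x * g' x)"
  using assms(1)
proof induction
  case one
  then show ?case using assms(2) by simp
next
  case (var p f g)
  from pderiv_dir.var[OF var.hyps(1) var.IH]
  show ?case by (simp add: algebra_simps)
next
  case (add f1 g1 f2 g2)
  from pderiv_dir.add[OF add.IH] show ?case by (simp add: algebra_simps)
next
  case (scale f g c)
  from pderiv_dir.scale[OF scale.IH, of c] show ?case by (simp add: algebra_simps)
qed

lemma pderiv_dir_sum:
  "finite J \<Longrightarrow> (\<And>i. i \<in> J \<Longrightarrow> pderiv_dir v (f i) (g i)) \<Longrightarrow>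
    pderiv_dir v (\<lambda>x. \<Sum>i\<in>J. f i x) (\<lambda>x. \<Sum>i\<in>J. g i x)"
  by (induction J rule: finite_induct) (simp_all add: pderiv_dir_const pderiv_dir.add)

lemma pderiv_dir_gint:
  assumes "pderiv_dir v f g"
  shows "gint (\<lambda>x. monomial k x * f x) \<and> gint (\<lambda>x. monomial k x * g x)"
  using assms
proof (induction arbitrary: k)
  case one
  show ?case using gint_monomial gint_scale[OF gint_monomial, of 0] by simp
next
  case (var p f g)
  note * = var.IH[of "k(p := Suc (k p))", unfolded monomial_Suc[OF var.hyps(1)]]
  have "gint (\<lambda>x. v p * (monomial k x * f x) + (of_real (x p) * monomial k x * g x))"
    using var.IH[of k] * by (intro gint_add gint_scale) auto
  with * show ?case by (simp add: algebra_simps)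
next
  case (add f1 g1 f2 g2)
  then show ?case using gint_add by (simp add: distrib_left)
next
  case (scale f g c)
  then show ?case using gint_scale[of _ c] by (simp add: mult.left_commute)
qed

lemma pderiv_dir_gint': "pderiv_dir v f g \<Longrightarrow> gint f" "pderiv_dir v f g \<Longrightarrow> gint g"
  using pderiv_dir_gint[of v f g "\<lambda>_. 0"] by (simp_all add: monomial_0)

definition monomial_deriv :: "('i \<Rightarrow> complex) \<Rightarrow> ('i \<Rightarrow> nat) \<Rightarrow> ('i \<Rightarrow> real) \<Rightarrow> complex" where
  "monomial_deriv v k x = (\<Sum>p\<in>I. v p * of_nat (k p) * monomial (k(p := k p - 1)) x)"

text \<open>Minus the derivative of the logarithm of \<open>weight\<close> in the direction
  \<open>v\<close>.\<close>

definition dual_form :: "('i \<Rightarrow> complex) \<Rightarrow> ('i \<Rightarrow> real) \<Rightarrow> complex" where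
  "dual_form v x = (\<Sum>p\<in>I. of_real (s p) * v p * of_real (x p))"

lemma monomial_deriv_Suc:
  assumes q: "q \<in> I"
  shows "monomial_deriv v (k(q := Suc (k q))) x = v q * monomial k x + of_real (x q) * monomial_deriv v k x"
proof -
  let ?k = "k(q := Suc (k q))"
  have *: "of_nat (?k p) * monomial (?k(p := ?k p - 1)) x = of_real (x q) * (of_nat (k p) * monomial (k(p := k p - 1)) x)"
    if "p \<in> I - {q}" for p
  proof -
    have "?k(p := ?k p - 1) = (k(p := k p - 1))(q := Suc ((k(p := k p - 1)) q))"
      using that by (auto simp: fun_eq_iff)
    then show ?thesis using that monomial_Suc[OF q, of "k(p := k p - 1)" x] by simp
  qed
  have k_q: "of_nat (?k q) * monomial (?k(q := ?k q - 1)) x =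
      monomial k x + of_real (x q) * (of_nat (k q) * monomial (k(q := k q - 1)) x)"
  proof (cases "k q")
    case (Suc l)
    have "monomial k x = of_real (x q) * monomial (k(q := k q - 1)) x"
      using monomial_Suc[OF q, of "k(q := l)" x] Suc by (simp add: fun_upd_idem)
    then show ?thesis by (simp add: algebra_simps)
  qed (simp add: fun_upd_idem)
  have "monomial_deriv v ?k x = v q * (of_nat (?k q) * monomial (?k(q := ?k q - 1)) x) +
      (\<Sum>p\<in>I - {q}. v p * (of_nat (?k p) * monomial (?k(p := ?k p - 1)) x))"
    using finite_I q by (simp add: monomial_deriv_def sum.remove mult.assoc)
  also have "\<dots> = v q * monomial k x + of_real (x q) * (v q * (of_nat (k q) * monomial (k(q := k q - 1)) x) +
      (\<Sum>p\<in>I - {q}. v p * (of_nat (k p) * monomial (k(p := k p - 1)) x)))"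
    unfolding k_q by (simp only: * sum_distrib_left distrib_left cong: sum.cong) (simp add: mult_ac)
  also have "\<dots> = v q * monomial k x + of_real (x q) * monomial_deriv v k x"
    using finite_I q by (simp add: monomial_deriv_def sum.remove mult.assoc)
  finally show ?thesis .
qed

lemma
  assumes "pderiv_dir v f g"
  shows gint_dual_form: "gint (\<lambda>x. dual_form v x * (monomial k x * f x))"
    and gint_monomial_deriv: "gint (\<lambda>x. monomial_deriv v k x * f x)"
    and gint_coord_monomial_deriv: "q \<in> I \<Longrightarrow> gint (\<lambda>x. of_real (x q) * monomial_deriv v k x * f x)"
proof -
  have gf: "gint (\<lambda>x. monomial k x * f x)" for k using pderiv_dir_gint[OF assms] by simp
  have "gint (\<lambda>x. \<Sum>p\<in>I. of_real (s p) * v p * (monomial (k(p := Suc (k p))) x * f x))"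
    by (intro gint_sum gint_scale gf)
  moreover have "(\<lambda>x. \<Sum>p\<in>I. of_real (s p) * v p * (monomial (k(p := Suc (k p))) x * f x)) =
      (\<lambda>x. dual_form v x * (monomial k x * f x))"
    unfolding dual_form_def sum_distrib_right
    by (intro ext sum.cong refl) (simp add: monomial_Suc mult_ac)
  ultimately show "gint (\<lambda>x. dual_form v x * (monomial k x * f x))" by simp
  have "gint (\<lambda>x. \<Sum>p\<in>I. v p * of_nat (k p) * (monomial (k(p := k p - 1)) x * f x))"
    by (intro gint_sum gint_scale gf)
  then show *: "gint (\<lambda>x. monomial_deriv v k x * f x)"
    unfolding monomial_deriv_def sum_distrib_right by (simp add: mult.assoc)
  assume q: "q \<in> I"
  have "gint (\<lambda>x. \<Sum>p\<in>I. v p * of_nat (k p) * (monomial ((k(p := k p - 1))(q := Suc ((k(p := k p - 1)) q))) x * f x))"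
    by (intro gint_sum gint_scale gf)
  then show "gint (\<lambda>x. of_real (x q) * monomial_deriv v k x * f x)"
    unfolding monomial_Suc[OF q] monomial_deriv_def
    by (simp add: sum_distrib_left sum_distrib_right mult_ac)
qed

text \<open>Integration by parts is proved against all monomials simultaneously, so that the
  induction over the structure of \<open>f\<close> can absorb one variable at a time.\<close>

lemma gauss_ibp_monomial:
  assumes "pderiv_dir v f g"
  shows "GI (\<lambda>x. dual_form v x * (monomial k x * f x)) =
    GI (\<lambda>x. monomial k x * g x) + GI (\<lambda>x. monomial_deriv v k x * f x)"
  using assms
proof (induction arbitrary: k)
  case one
  have "GI (\<lambda>x. dual_form v x * (monomial k x * 1)) =
      GI (\<lambda>x. \<Sum>p\<in>I. of_real (s p) * v p * monomial (k(p := Suc (k p))) x)"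
    unfolding dual_form_def
    by (intro arg_cong[where f = GI] ext) (simp add: sum_distrib_right monomial_Suc mult.assoc)
  also have "\<dots> = (\<Sum>p\<in>I. of_real (s p) * v p * GI (monomial (k(p := Suc (k p)))))"
    by (subst GI_sum) (auto intro: gint_scale gint_monomial simp: GI_scale)
  also have "\<dots> = (\<Sum>p\<in>I. v p * (of_real (s p) * GI (monomial (k(p := Suc (k p))))))"
    by (simp add: mult_ac)
  also have "\<dots> = (\<Sum>p\<in>I. v p * of_nat (k p) * GI (monomial (k(p := k p - 1))))"
    by (intro sum.cong refl) (simp only: GI_monomial_Suc mult.assoc)
  also have "\<dots> = GI (\<lambda>x. monomial_deriv v k x * 1)"
    unfolding monomial_deriv_def mult_1_right
    by (subst GI_sum) (auto intro: gint_scale gint_monomial simp: GI_scale)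
  finally have "GI (\<lambda>x. dual_form v x * (monomial k x * 1)) = \<dots>" .
  moreover have "GI (\<lambda>x. monomial k x * 0) = 0" using GI_scale[of 0] by simp
  ultimately show ?case by simp
next
  case (var q f g)
  let ?k = "k(q := Suc (k q))"
  have gf: "gint (\<lambda>x. monomial k x * f x)" "gint (\<lambda>x. monomial k x * g x)" for k
    using pderiv_dir_gint[OF var.hyps(2)] by auto
  note gDf = gint_coord_monomial_deriv[OF var.hyps(2,1), of k]
  have "GI (\<lambda>x. dual_form v x * (monomial k x * (of_real (x q) * f x))) = GI (\<lambda>x. dual_form v x * (monomial ?k x * f x))"
    unfolding monomial_Suc[OF var.hyps(1)] by (simp add: mult_ac)
  also have "\<dots> = GI (\<lambda>x. monomial ?k x * g x) + GI (\<lambda>x. v q * (monomial k x * f x) + of_real (x q) * monomial_deriv v k x * f x)"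
    unfolding var.IH by (simp only: monomial_deriv_Suc[OF var.hyps(1)] distrib_right mult.assoc)
  also have "\<dots> = GI (\<lambda>x. monomial ?k x * g x) + GI (\<lambda>x. v q * (monomial k x * f x)) +
      GI (\<lambda>x. of_real (x q) * monomial_deriv v k x * f x)"
    using GI_add[OF gint_scale[OF gf(1)] gDf] by simp
  also have "GI (\<lambda>x. monomial ?k x * g x) + GI (\<lambda>x. v q * (monomial k x * f x)) =
      GI (\<lambda>x. v q * (monomial k x * f x) + monomial ?k x * g x)"
    using GI_add[OF gint_scale[OF gf(1)] gf(2)] by simp
  finally show ?case
    unfolding monomial_Suc[OF var.hyps(1)] by (simp add: algebra_simps)
next
  case (add f1 g1 f2 g2)
  have gg: "gint (\<lambda>x. monomial k x * g1 x)" "gint (\<lambda>x. monomial k x * g2 x)"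
    using pderiv_dir_gint add.hyps by blast+
  show ?case
    unfolding distrib_left
    using add.IH[of k] GI_add[OF gint_dual_form[OF add.hyps(1)] gint_dual_form[OF add.hyps(2)]]
      GI_add[OF gint_monomial_deriv[OF add.hyps(1)] gint_monomial_deriv[OF add.hyps(2)]] GI_add[OF gg] by simp
next
  case (scale f g c)
  show ?case
    using arg_cong[OF scale.IH[of k], of "(*) c"]
    unfolding distrib_left GI_scale[symmetric] by (simp add: mult.left_commute)
qed

lemma gauss_ibp:
  assumes "pderiv_dir v f g"
  shows "GI (\<lambda>x. dual_form v x * f x) = GI g"
  using gauss_ibp_monomial[OF assms, of "\<lambda>_. 0"] GI_scale[of 0] by (simp add: monomial_0 monomial_deriv_def)

end


section \<open>Loop equations of the matrix integral\<close>

lemma sum_swap3: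
  "(\<Sum>i\<in>A. \<Sum>j\<in>B. \<Sum>r\<in>C. f i j r) = (\<Sum>r\<in>C. \<Sum>i\<in>A. \<Sum>j\<in>B. f i j r)"
proof -
  have "(\<Sum>j\<in>B. \<Sum>r\<in>C. f i j r) = (\<Sum>r\<in>C. \<Sum>j\<in>B. f i j r)" for i
    by (rule sum.swap)
  then show ?thesis by (simp only: sum.swap[of _ A C])
qed

locale gue =
  fixes N :: nat
  assumes N_pos: "N \<ge> 1"

text \<open>In Tr H^2 a diagonal coordinate occurs as one square, while |H_ij|^2 occurs for (i, j)
  and for (j, i); this gives the factors 1 and 2.\<close>

sublocale gue \<subseteq> gauss_coords "{..<N} \<times> {..<N}"
  "\<lambda>p. of_nat N * (if fst p = snd p then 1 else 2)"
  using N_pos by unfold_locales auto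

context gue
begin

definition ent :: "nat \<Rightarrow> nat \<Rightarrow> nat \<Rightarrow> (nat \<times> nat \<Rightarrow> real) \<Rightarrow> complex" where
  "ent n i j x = (hermitian_of_coords N x ^\<^sub>m n) $$ (i, j)"

definition herm :: "nat \<Rightarrow> nat \<Rightarrow> (nat \<times> nat \<Rightarrow> real) \<Rightarrow> complex" where
  "herm i j x = hermitian_of_coords N x $$ (i, j)"

definition tr :: "nat \<Rightarrow> (nat \<times> nat \<Rightarrow> real) \<Rightarrow> complex" where
  "tr n x = trace_mat (hermitian_of_coords N x ^\<^sub>m n)"

definition pot :: "nat multiset \<Rightarrow> (nat \<times> nat \<Rightarrow> real) \<Rightarrow> complex" where
  "pot m x = mcoeff (potential_weight N (hermitian_of_coords N x)) m"

text \<open>The direction in which the Wirtinger derivative with respect to the \<open>(j, i)\<close> entry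
  differentiates; its dual linear form is a multiple of the \<open>(i, j)\<close> entry.\<close>

definition dir :: "nat \<Rightarrow> nat \<Rightarrow> nat \<times> nat \<Rightarrow> complex" where
  "dir i j p = (if i = j then of_bool (p = (i, i))
     else if p = (min i j, max i j) then 1 / 2
     else if p = (max i j, min i j) then (if i < j then \<i> / 2 else - \<i> / 2) else 0)"

lemma H_carrier: "hermitian_of_coords N x \<in> carrier_mat N N"
  by (simp add: hermitian_of_coords_def)

lemma H_pow_carrier: "hermitian_of_coords N x ^\<^sub>m n \<in> carrier_mat N N"
  by (rule pow_carrier_mat[OF H_carrier])

lemma herm_eq: "i < N \<Longrightarrow> j < N \<Longrightarrow> herm i j x =
   (if i < j then of_real (x (i, j)) + \<i> * of_real (x (j, i))
    else if i = j then of_real (x (i, i)) else of_real (x (j, i)) - \<i> * of_real (x (i, j)))"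
  using H_carrier[of x] by (simp add: herm_def hermitian_of_coords_def complex_eq_iff)

lemma ent_0: "i < N \<Longrightarrow> j < N \<Longrightarrow> ent 0 i j x = of_bool (i = j)"
  using H_carrier[of x] by (simp add: ent_def)

lemma ent_Suc:
  assumes "i < N" "j < N"
  shows "ent (Suc n) i j x = (\<Sum>k<N. ent n i k x * herm k j x)"
proof -
  have "(hermitian_of_coords N x ^\<^sub>m n * hermitian_of_coords N x) $$ (i, j) =
      (\<Sum>k<N. (hermitian_of_coords N x ^\<^sub>m n) $$ (i, k) * hermitian_of_coords N x $$ (k, j))"
    using H_pow_carrier[of x n] H_carrier[of x] assms
    by (simp add: times_mat_def scalar_prod_def atLeast0LessThan)
  then show ?thesis by (simp add: ent_def herm_def)
qed

lemma ent_add: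
  "i < N \<Longrightarrow> j < N \<Longrightarrow> ent (m + n) i j x = (\<Sum>k<N. ent m i k x * ent n k j x)"
proof (induction n arbitrary: j)
  case 0
  have "(\<Sum>k<N. ent m i k x * ent 0 k j x) = (\<Sum>k<N. if k = j then ent m i j x else 0)"
    using 0 by (intro sum.cong) (auto simp: ent_0)
  then show ?case using 0 by simp
next
  case (Suc n)
  have "ent (m + Suc n) i j x = (\<Sum>l<N. \<Sum>k<N. ent m i k x * (ent n k l x * herm l j x))"
    using Suc by (simp add: ent_Suc sum_distrib_right mult.assoc)
  also have "\<dots> = (\<Sum>k<N. ent m i k x * ent (Suc n) k j x)"
    using Suc.prems by (subst sum.swap) (simp add: ent_Suc sum_distrib_left)
  finally show ?case .
qed

lemma ent_1: "i < N \<Longrightarrow> j < N \<Longrightarrow> ent 1 i j x = herm i j x"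
  using H_carrier[of x] by (simp add: ent_def herm_def)

lemma ent_Suc': "i < N \<Longrightarrow> j < N \<Longrightarrow> ent (Suc n) i j x = (\<Sum>k<N. herm i k x * ent n k j x)"
  using ent_add[of i j 1 n x] ent_1[of i _ x] by simp

lemma tr_ent: "tr n x = (\<Sum>i<N. ent n i i x)"
  using H_carrier[of x] by (simp add: tr_def trace_mat_def ent_def)

lemma tr_0: "tr 0 x = of_nat N"
  by (simp add: tr_ent ent_0)

text \<open>The halves in \<open>dir\<close> cancel the doubled coefficients 2 N off the diagonal,
  so all entries are treated alike.\<close>

lemma dual_form_dir:
  assumes ij: "i < N" "j < N"
  shows "dual_form (dir i j) x = of_nat N * herm i j x"
proof -
  let ?I = "{..<N} \<times> {..<N}"
  let ?f = "\<lambda>p. of_real (of_nat N * (if fst p = snd p then 1 else 2)) * dir i j p * of_real (x p) :: complex"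
  have "dual_form (dir i j) x = (\<Sum>p\<in>{(i, j), (j, i)}. ?f p)"
    unfolding dual_form_def
    by (rule sum.mono_neutral_right) (use ij in \<open>auto simp: dir_def min_def max_def\<close>)
  also have "\<dots> = of_nat N * herm i j x"
  proof (cases i j rule: linorder_cases)
    case less
    then show ?thesis using ij by (simp add: herm_eq dir_def min_def max_def algebra_simps)
  next
    case equal
    then show ?thesis using ij by (simp add: herm_eq dir_def)
  next
    case greater
    then show ?thesis using ij by (simp add: herm_eq dir_def min_def max_def algebra_simps)
  qed
  finally show ?thesis .
qed

text \<open>The Wirtinger derivative in H_ji treats an entry and its conjugate as independent, so
  the matrix entries behave like free coordinates.\<close>

lemma pderiv_herm:
  assumes ij: "i < N" "j < N" and ab: "a < N" "b < N"
  shows "pderiv_dir (dir i j) (herm a b) (\<lambda>x. of_bool (a = j \<and> b = i))"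
proof -
  note coord = pderiv_dir_coord[of _ "dir i j"]
  have lin: "pderiv_dir (dir i j) (\<lambda>x. of_real (x p) + c * of_real (x q)) (\<lambda>x. dir i j p + c * dir i j q)"
    if "p \<in> {..<N} \<times> {..<N}" "q \<in> {..<N} \<times> {..<N}" for p q c
    by (intro pderiv_dir.add pderiv_dir.scale coord that)
  show ?thesis
  proof (cases a b rule: linorder_cases)
    case less
    have "herm a b = (\<lambda>x. of_real (x (a, b)) + \<i> * of_real (x (b, a)))"
      using less ab by (auto simp: herm_eq)
    moreover have "dir i j (a, b) + \<i> * dir i j (b, a) = of_bool (a = j \<and> b = i)"
      using less by (auto simp: dir_def min_def max_def)
    ultimately show ?thesis using lin[of "(a, b)" "(b, a)" \<i>] ab by simp
  next
    case equal
    have "herm a b = (\<lambda>x. of_real (x (a, a)))"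
      using equal ab by (auto simp: herm_eq)
    moreover have "dir i j (a, a) = of_bool (a = j \<and> b = i)"
      using equal by (auto simp: dir_def min_def max_def)
    ultimately show ?thesis using coord[of "(a, a)"] ab by simp
  next
    case greater
    have "herm a b = (\<lambda>x. of_real (x (b, a)) + (- \<i>) * of_real (x (a, b)))"
      using greater ab by (auto simp: herm_eq)
    moreover have "dir i j (b, a) + (- \<i>) * dir i j (a, b) = of_bool (a = j \<and> b = i)"
      using greater by (auto simp: dir_def min_def max_def)
    ultimately show ?thesis using lin[of "(b, a)" "(a, b)" "- \<i>"] ab by simp
  qed
qed

text \<open>Leibniz rule: deleting a factor H_ji at position r splits the word into H^r, ending at
  j, and H^(n-1-r), starting at i.\<close>

lemma pderiv_ent:
  assumes ij: "i < N" "j < N" and a: "a < N"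
  shows "b < N \<Longrightarrow> pderiv_dir (dir i j) (ent n a b) (\<lambda>x. \<Sum>r<n. ent r a j x * ent (n - 1 - r) i b x)"
proof (induction n arbitrary: b)
  case 0
  have "ent 0 a b = (\<lambda>x. of_bool (a = b))" using a 0 by (auto simp: ent_0)
  then show ?case using pderiv_dir_const by simp
next
  case (Suc n)
  have e: "ent (Suc n) a b = (\<lambda>x. \<Sum>k<N. ent n a k x * herm k b x)"
    using a Suc.prems by (auto simp: ent_Suc)
  have "pderiv_dir (dir i j) (ent (Suc n) a b) (\<lambda>x. \<Sum>k<N. (\<Sum>r<n. ent r a j x * ent (n - 1 - r) i k x) * herm k b x
      + ent n a k x * of_bool (k = j \<and> b = i))"
    unfolding e by (intro pderiv_dir_sum pderiv_dir_mult Suc.IH pderiv_herm ij Suc.prems) auto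
  moreover have "(\<Sum>k<N. (\<Sum>r<n. ent r a j x * ent (n - 1 - r) i k x) * herm k b x
      + ent n a k x * of_bool (k = j \<and> b = i)) = (\<Sum>r<Suc n. ent r a j x * ent (Suc n - 1 - r) i b x)" for x
  proof -
    have "(\<Sum>k<N. (\<Sum>r<n. ent r a j x * ent (n - 1 - r) i k x) * herm k b x) =
        (\<Sum>r<n. ent r a j x * (\<Sum>k<N. ent (n - 1 - r) i k x * herm k b x))"
      unfolding sum_distrib_right sum_distrib_left by (subst sum.swap) (simp add: mult.assoc)
    also have "\<dots> = (\<Sum>r<n. ent r a j x * ent (n - r) i b x)"
    proof (rule sum.cong)
      fix r assume "r \<in> {..<n}"
      then have "n - r = Suc (n - 1 - r)" by auto
      then show "ent r a j x * (\<Sum>k<N. ent (n - 1 - r) i k x * herm k b x) = ent r a j x * ent (n - r) i b x"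
        using ij Suc.prems by (simp only: ent_Suc)
    qed simp
    moreover have "(\<Sum>k<N. ent n a k x * of_bool (k = j \<and> b = i)) = ent n a j x * ent 0 i b x"
    proof -
      have "(\<Sum>k<N. ent n a k x * of_bool (k = j \<and> b = i)) = (\<Sum>k<N. if k = j then ent n a j x * of_bool (b = i) else 0)"
        by (intro sum.cong) auto
      then show ?thesis using ij Suc.prems by (auto simp: ent_0)
    qed
    ultimately show ?thesis by (simp add: sum.distrib)
  qed
  ultimately show ?case by simp
qed

lemma pderiv_tr:
  assumes ij: "i < N" "j < N"
  shows "pderiv_dir (dir i j) (tr n) (\<lambda>x. of_nat n * ent (n - 1) i j x)"
proof -
  have e: "tr n = (\<lambda>x. \<Sum>a<N. ent n a a x)" by (auto simp: tr_ent)
  have "pderiv_dir (dir i j) (tr n) (\<lambda>x. \<Sum>a<N. \<Sum>r<n. ent r a j x * ent (n - 1 - r) i a x)"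
    unfolding e by (intro pderiv_dir_sum pderiv_ent ij) auto
  moreover have "(\<Sum>a<N. \<Sum>r<n. ent r a j x * ent (n - 1 - r) i a x) = of_nat n * ent (n - 1) i j x" for x
  proof -
    have "(\<Sum>a<N. \<Sum>r<n. ent r a j x * ent (n - 1 - r) i a x) =
        (\<Sum>r<n. \<Sum>a<N. ent (n - 1 - r) i a x * ent r a j x)"
      by (subst sum.swap) (simp add: mult.commute)
    also have "\<dots> = (\<Sum>r<n. ent (n - 1) i j x)"
    proof (rule sum.cong)
      fix r assume "r \<in> {..<n}"
      then have "n - 1 = (n - 1 - r) + r" by auto
      then show "(\<Sum>a<N. ent (n - 1 - r) i a x * ent r a j x) = ent (n - 1) i j x"
        using ent_add[OF ij, of "n - 1 - r" r x] by simp
    qed simp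
    finally show ?thesis by simp
  qed
  ultimately show ?thesis by simp
qed

text \<open>The derivative of exp V in one variable is exp V times that of V. The resulting
  recursion shows each coefficient to be a polynomial in traces, without an explicit
  formula.\<close>

lemma pot_empty: "pot {#} x = 1"
  and pot_add: "of_nat (count m l + 1) * pot (add_mset l m) x = of_nat N / of_nat (Suc l) * tr (Suc l) x * pot m x"
proof -
  define z where "z n = of_nat N / of_nat n * tr n x" for n
  define V where "V = formal_sum {1..} (\<lambda>n. avar n * mconst (z n))"
  have P: "potential_weight N (hermitian_of_coords N x) = mexp V"
    by (simp add: potential_weight_def V_def z_def tr_def mult.commute)
  have V: "mcoeff V m = (\<Sum>i\<in>set_mset m. if m = {#i#} then z (Suc i) else 0)" for m
    unfolding V_def mcoeff_formal_sum_avar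
    by (intro sum.cong refl) (auto simp: mcoeff_mconst diff_single_eq_union dest: multi_member_split)
  have V0: "const_term V = 0" by (simp add: const_term_def V)
  show "pot {#} x = 1"
    using const_term_mcompose[OF V0, of "fps_exp 1"] by (simp add: pot_def P mexp_def const_term_def)
  have "mdiag (\<lambda>m. of_nat (count m l)) V = avar (Suc l) * mconst (z (Suc l))"
  proof (rule mpser_eqI)
    fix m
    show "mcoeff (mdiag (\<lambda>m. of_nat (count m l)) V) m = mcoeff (avar (Suc l) * mconst (z (Suc l))) m"
    proof (cases "m = {#l#}")
      case True
      then show ?thesis by (simp add: V mcoeff_avar_mult mcoeff_mconst del: mcoeff_mult_mconst)
    next
      case False
      then have "m - {#l#} \<noteq> {#}" if "l \<in># m" using that by (metis add_mset_remove_trivial_If diff_single_trivial insert_DiffM)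
      moreover have "of_nat (count m l) * mcoeff V m = 0"
        using False by (auto simp: V intro!: sum.neutral) 
      ultimately show ?thesis by (auto simp: mcoeff_avar_mult mcoeff_mconst simp del: mcoeff_mult_mconst)
    qed
  qed
  then have "mdiag (\<lambda>m. of_nat (count m l)) (mexp V) = avar (Suc l) * (mconst (z (Suc l)) * mexp V)"
    using mdiag_mexp[OF additive_weight_count V0, of l] by (simp add: mult_ac)
  from arg_cong[OF this, of "\<lambda>f. mcoeff f (add_mset l m)"]
  show "of_nat (count m l + 1) * pot (add_mset l m) x = of_nat N / of_nat (Suc l) * tr (Suc l) x * pot m x"
    by (simp add: mcoeff_avar_mult pot_def P z_def)
qed

text \<open>Coefficientwise form of the derivative of exp (N sum a_n/n Tr H^n) in H_ji, which is N
  sum a_n (H^(n-1))_ij times the exponential.\<close>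

lemma pderiv_pot:
  assumes ij: "i < N" "j < N"
  shows "pderiv_dir (dir i j) (pot m) (\<lambda>x. \<Sum>l\<in>set_mset m. of_nat N * ent l i j x * pot (m - {#l#}) x)"
proof (induction m)
  case empty
  then show ?case using pderiv_dir.one by (simp add: pot_empty)
next
  case (add k m)
  define c K where "c = (of_nat (count m k + 1) :: complex)" and "K = (of_nat (Suc k) :: complex)"
  have c: "c \<noteq> 0" and K: "K \<noteq> 0" by (simp_all add: c_def K_def del: of_nat_Suc of_nat_add)
  have e: "pot (add_mset k m) = (\<lambda>x. of_nat N / K / c * (tr (Suc k) x * pot m x))"
  proof
    fix x
    have "c * pot (add_mset k m) x = of_nat N / K * tr (Suc k) x * pot m x"
      unfolding c_def K_def by (rule pot_add)
    then show "pot (add_mset k m) x = of_nat N / K / c * (tr (Suc k) x * pot m x)"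
      using c K by (simp add: field_simps)
  qed
  let ?D = "\<lambda>x. \<Sum>l\<in>set_mset m. of_nat N * ent l i j x * pot (m - {#l#}) x"
  let ?E = "\<lambda>x. \<Sum>l\<in>set_mset (add_mset k m). of_nat N * ent l i j x * pot (add_mset k m - {#l#}) x"
  have "pderiv_dir (dir i j) (pot (add_mset k m)) (\<lambda>x. of_nat N / K / c *
      (K * ent (Suc k - 1) i j x * pot m x + tr (Suc k) x * ?D x))"
    unfolding e K_def by (intro pderiv_dir.scale pderiv_dir_mult pderiv_tr add.IH ij)
  moreover have "of_nat N / K / c *
      (K * ent (Suc k - 1) i j x * pot m x + tr (Suc k) x * ?D x) = ?E x" for x
  proof -
    have trp: "of_nat N / K * tr (Suc k) x * pot (m - {#l#}) x =
        of_nat (count (m - {#l#}) k + 1) * pot (add_mset k (m - {#l#})) x" for l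
      unfolding K_def using pot_add[of "m - {#l#}" k x] by simp
    have "of_nat N / K * tr (Suc k) x * ?D x =
        (\<Sum>l\<in>set_mset m. of_nat N * ent l i j x * (of_nat N / K * tr (Suc k) x * pot (m - {#l#}) x))"
      by (simp add: sum_distrib_left mult_ac)
    also have "\<dots> = (\<Sum>l\<in>set_mset m. of_nat N * ent l i j x *
        (of_nat (count (m - {#l#}) k + 1) * pot (add_mset k m - {#l#}) x))"
      unfolding trp by (intro sum.cong refl) simp
    \<comment> \<open>Removing \<open>l\<close> lowers the multiplicity of \<open>k\<close> only for
      \<open>l = k\<close>, so that term carries c - 1 in place of c. The missing copy comes from
      the derivative of \<open>tr (Suc k)\<close>.\<close>
    also have "\<dots> = c * ?E x - of_nat N * ent k i j x * pot m x"
    proof (cases "k \<in># m")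
      case True
      then have kk: "of_nat (count (m - {#k#}) k + 1) + 1 = c"
        by (simp add: c_def Suc_diff_le)
      have "(\<Sum>l\<in>set_mset m. of_nat N * ent l i j x * (of_nat (count (m - {#l#}) k + 1) * pot (add_mset k m - {#l#}) x)) =
          of_nat N * ent k i j x * (of_nat (count (m - {#k#}) k + 1) * pot m x) +
          (\<Sum>l\<in>set_mset m - {k}. of_nat N * ent l i j x * (c * pot (add_mset k m - {#l#}) x))"
        using True by (subst sum.remove[of _ k]) (auto simp: c_def intro!: sum.cong)
      also have "(\<Sum>l\<in>set_mset m - {k}. of_nat N * ent l i j x * (c * pot (add_mset k m - {#l#}) x)) =
          c * (?E x - of_nat N * ent k i j x * pot m x)"
      proof -
        have "?E x = of_nat N * ent k i j x * pot m x +
            (\<Sum>l\<in>set_mset m - {k}. of_nat N * ent l i j x * pot (add_mset k m - {#l#}) x)"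
          using True by (subst sum.remove[of _ k]) (auto simp: insert_absorb)
        then show ?thesis by (simp add: sum_distrib_left mult_ac)
      qed
      finally show ?thesis unfolding kk[symmetric] by (simp add: algebra_simps)
    next
      case False
      have "?E x = of_nat N * ent k i j x * pot m x +
          (\<Sum>l\<in>set_mset m. of_nat N * ent l i j x * pot (add_mset k m - {#l#}) x)"
        using False by simp
      moreover have "count (m - {#l#}) k = 0" for l
        using False by (simp add: not_in_iff)
      ultimately show ?thesis using False by (simp add: not_in_iff c_def)
    qed
    finally have "of_nat N / K * tr (Suc k) x * ?D x + of_nat N * ent k i j x * pot m x = c * ?E x"
      by simp
    moreover have "of_nat N / K / c *
      (K * ent (Suc k - 1) i j x * pot m x + tr (Suc k) x * ?D x) =
      (of_nat N / K * tr (Suc k) x * ?D x + of_nat N * ent k i j x * pot m x) / c"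
      using c K by (simp add: field_simps)
    ultimately show ?thesis using c by simp
  qed
  ultimately show ?case by (simp only:)
qed

lemma gint_polys:
  "gint (\<lambda>x. tr k x * pot m x)" "gint (\<lambda>x. tr r x * tr k x * pot m x)" "gint (pot m)"
proof -
  \<comment> \<open>Any direction would do: a directional derivative is exhibited only to certify
    that these functions are polynomial in the coordinates.\<close>
  have "0 < N" using N_pos by simp
  note p = pderiv_tr[OF this this] pderiv_pot[OF this this]
  show "gint (\<lambda>x. tr k x * pot m x)" by (rule pderiv_dir_gint'(1)[OF pderiv_dir_mult[OF p]])
  show "gint (\<lambda>x. tr r x * tr k x * pot m x)"
    by (rule pderiv_dir_gint'(1)[OF pderiv_dir_mult[OF pderiv_dir_mult[OF p(1) p(1)] p(2)]])
  show "gint (pot m)" by (rule pderiv_dir_gint'(1)[OF p(2)])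
qed

text \<open>Integrate by parts against (H^k)_ji times the weight in the direction whose dual form is
  N H_ij, and sum over i and j. Differentiating H^k splits one trace into two; differentiating the
  weight joins H^l to H^k.\<close>

theorem loop_equation:
  "of_nat N * GI (\<lambda>x. tr (Suc k) x * pot m x) =
     (\<Sum>r<k. GI (\<lambda>x. tr r x * tr (k - 1 - r) x * pot m x)) +
     of_nat N * (\<Sum>l\<in>set_mset m. GI (\<lambda>x. tr (l + k) x * pot (m - {#l#}) x))"
proof -
  let ?I = "{..<N} \<times> {..<N}"
  let ?F = "\<lambda>(i, j) x. ent k j i x * pot m x"
  let ?D = "\<lambda>(i, j) x. (\<Sum>r<k. ent r j j x * ent (k - 1 - r) i i x) * pot m x +
      ent k j i x * (\<Sum>l\<in>set_mset m. of_nat N * ent l i j x * pot (m - {#l#}) x)"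
  have D: "pderiv_dir (dir i j) (?F (i, j)) (?D (i, j))" if "i < N" "j < N" for i j
    using pderiv_dir_mult[OF pderiv_ent[OF that(1,2,2,1)] pderiv_pot[OF that]] by simp
  have ibp: "GI (\<lambda>x. of_nat N * herm i j x * ?F (i, j) x) = GI (?D (i, j))" if "i < N" "j < N" for i j
    using gauss_ibp[OF D[OF that]] dual_form_dir[OF that] by simp
  have gF: "gint (\<lambda>x. of_nat N * herm i j x * ?F (i, j) x)" if "i < N" "j < N" for i j
    using gint_dual_form[OF D[OF that], of "\<lambda>_. 0"] dual_form_dir[OF that] by (simp add: monomial_0)
  have gD: "gint (?D (i, j))" if "i < N" "j < N" for i j
    by (rule pderiv_dir_gint'(2)[OF D[OF that]])
  have L: "(\<Sum>i<N. \<Sum>j<N. of_nat N * herm i j x * ?F (i, j) x) = of_nat N * (tr (Suc k) x * pot m x)" for x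
  proof -
    have "tr (Suc k) x = (\<Sum>i<N. \<Sum>j<N. herm i j x * ent k j i x)"
      unfolding tr_ent by (simp add: ent_Suc')
    then show ?thesis by (simp add: sum_distrib_left sum_distrib_right mult_ac)
  qed
  have Rt: "(\<Sum>i<N. \<Sum>j<N. ?D (i, j) x) = (\<Sum>r<k. tr r x * tr (k - 1 - r) x * pot m x) +
      of_nat N * (\<Sum>l\<in>set_mset m. tr (l + k) x * pot (m - {#l#}) x)" for x
  proof -
    have "(\<Sum>i<N. \<Sum>j<N. (\<Sum>r<k. ent r j j x * ent (k - 1 - r) i i x) * pot m x) =
        (\<Sum>r<k. \<Sum>i<N. \<Sum>j<N. ent r j j x * ent (k - 1 - r) i i x * pot m x)"
      unfolding sum_distrib_right by (rule sum_swap3)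
    also have "\<dots> = (\<Sum>r<k. tr r x * tr (k - 1 - r) x * pot m x)"
    proof (rule sum.cong)
      fix r
      show "(\<Sum>i<N. \<Sum>j<N. ent r j j x * ent (k - 1 - r) i i x * pot m x) = tr r x * tr (k - 1 - r) x * pot m x"
        by (simp only: tr_ent sum_product) (simp only: sum_distrib_right, rule sum.swap)
    qed simp
    finally have 1: "(\<Sum>i<N. \<Sum>j<N. (\<Sum>r<k. ent r j j x * ent (k - 1 - r) i i x) * pot m x) = \<dots>" .
    have "(\<Sum>i<N. \<Sum>j<N. ent k j i x * (\<Sum>l\<in>set_mset m. of_nat N * ent l i j x * pot (m - {#l#}) x)) =
        (\<Sum>l\<in>set_mset m. \<Sum>i<N. \<Sum>j<N. of_nat N * pot (m - {#l#}) x * (ent l i j x * ent k j i x))"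
      unfolding sum_distrib_left by (subst sum_swap3) (simp only: mult_ac)
    also have "\<dots> = (\<Sum>l\<in>set_mset m. of_nat N * pot (m - {#l#}) x * tr (l + k) x)"
      unfolding tr_ent sum_distrib_left by (intro sum.cong refl) (simp add: ent_add sum_distrib_left)
    finally have 2: "(\<Sum>i<N. \<Sum>j<N. ent k j i x * (\<Sum>l\<in>set_mset m. of_nat N * ent l i j x * pot (m - {#l#}) x)) = \<dots>" .
    show ?thesis using 1 2 by (simp add: sum.distrib sum_distrib_left mult_ac)
  qed
  have "of_nat N * GI (\<lambda>x. tr (Suc k) x * pot m x) = GI (\<lambda>x. \<Sum>i<N. \<Sum>j<N. of_nat N * herm i j x * ?F (i, j) x)"
    unfolding L GI_scale ..
  also have "\<dots> = (\<Sum>i<N. \<Sum>j<N. GI (\<lambda>x. of_nat N * herm i j x * ?F (i, j) x))"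
    using gF by (subst GI_sum; (intro gint_sum sum.cong refl GI_sum)?) auto
  also have "\<dots> = (\<Sum>i<N. \<Sum>j<N. GI (?D (i, j)))"
    using ibp by (intro sum.cong refl) auto
  also have "\<dots> = GI (\<lambda>x. \<Sum>i<N. \<Sum>j<N. ?D (i, j) x)"
    using gD by (subst GI_sum; (intro gint_sum sum.cong refl GI_sum[symmetric])?) auto
  also have "\<dots> = GI (\<lambda>x. \<Sum>r<k. tr r x * tr (k - 1 - r) x * pot m x) +
      GI (\<lambda>x. of_nat N * (\<Sum>l\<in>set_mset m. tr (l + k) x * pot (m - {#l#}) x))"
    unfolding Rt by (rule GI_add) (intro gint_sum gint_scale gint_polys)+
  also have "\<dots> = (\<Sum>r<k. GI (\<lambda>x. tr r x * tr (k - 1 - r) x * pot m x)) +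
     of_nat N * (\<Sum>l\<in>set_mset m. GI (\<lambda>x. tr (l + k) x * pot (m - {#l#}) x))"
    unfolding GI_scale by (subst (1 2) GI_sum) (auto intro: gint_polys)
  finally show ?thesis .
qed

section \<open>From coordinates to the integral over Hermitian matrices\<close>

lemma gaussian_weight_coords: "gaussian_weight N (hermitian_of_coords N x) = weight x"
proof -
  let ?I = "{..<N} \<times> {..<N}"
  have "tr 2 x = (\<Sum>i<N. \<Sum>j<N. herm i j x * herm j i x)"
    unfolding tr_ent
  proof (rule sum.cong)
    fix i assume "i \<in> {..<N}"
    then show "ent 2 i i x = (\<Sum>j<N. herm i j x * herm j i x)"
      using ent_Suc'[of i i 1 x] ent_1[of _ i x] by (simp add: numeral_2_eq_2)
  qed simp
  also have "\<dots> = (\<Sum>(i, j)\<in>?I. herm i j x * herm j i x)" by (simp add: sum.cartesian_product)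
  also have "\<dots> = (\<Sum>(i, j)\<in>?I. if i = j then of_real ((x (i, i))\<^sup>2) else of_real ((x (i, j))\<^sup>2) + of_real ((x (j, i))\<^sup>2))"
  proof (rule sum.cong)
    fix p assume "p \<in> ?I"
    then obtain i j where p: "p = (i, j)" "i < N" "j < N" by auto
    have "herm i j x * herm j i x = (if i = j then of_real ((x (i, i))\<^sup>2) else of_real ((x (i, j))\<^sup>2) + of_real ((x (j, i))\<^sup>2))"
      using p by (cases i j rule: linorder_cases)
        (auto simp: herm_eq power2_eq_square algebra_simps simp del: One_nat_def)
    then show "(case p of (i, j) \<Rightarrow> herm i j x * herm j i x) = (case p of (i, j) \<Rightarrow>
        if i = j then of_real ((x (i, i))\<^sup>2) else of_real ((x (i, j))\<^sup>2) + of_real ((x (j, i))\<^sup>2))"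
      using p by simp
  qed simp
  also have "\<dots> = (\<Sum>(i, j)\<in>?I. if i = j then of_real ((x (i, i))\<^sup>2) else of_real ((x (i, j))\<^sup>2)) +
      (\<Sum>(i, j)\<in>?I. if i = j then 0 else of_real ((x (j, i))\<^sup>2))"
    by (subst sum.distrib[symmetric]) (auto intro!: sum.cong)
  also have "(\<Sum>(i, j)\<in>?I. if i = j then 0 else of_real ((x (j, i))\<^sup>2)) =
      (\<Sum>(i, j)\<in>?I. if i = j then 0 else (of_real ((x (i, j))\<^sup>2) :: complex))"
    by (rule sum.reindex_bij_witness[where i = prod.swap and j = prod.swap]) auto
  also have "(\<Sum>(i, j)\<in>?I. if i = j then of_real ((x (i, i))\<^sup>2) else of_real ((x (i, j))\<^sup>2)) + \<dots> =
      (\<Sum>p\<in>?I. of_real ((if fst p = snd p then 1 else 2) * (x p)\<^sup>2))"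
    by (subst sum.distrib[symmetric]) (auto intro!: sum.cong)
  finally have tr2: "tr 2 x = (\<Sum>p\<in>?I. of_real ((if fst p = snd p then 1 else 2) * (x p)\<^sup>2))" .
  have "weight x = (\<Prod>p\<in>?I. exp (complex_of_real (- (of_nat N * (if fst p = snd p then 1 else 2)) * (x p)\<^sup>2 / 2)))"
    unfolding weight_def by (simp only: exp_of_real)
  also have "\<dots> = exp (\<Sum>p\<in>?I. complex_of_real (- (of_nat N * (if fst p = snd p then 1 else 2)) * (x p)\<^sup>2 / 2))"
    by (rule exp_sum[symmetric]) simp
  also have "(\<Sum>p\<in>?I. complex_of_real (- (of_nat N * (if fst p = snd p then 1 else 2)) * (x p)\<^sup>2 / 2)) =
      - of_nat N * (tr 2 x / 2)"
    unfolding tr2 sum_divide_distrib sum_distrib_left by (intro sum.cong refl) simp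
  finally show ?thesis by (simp add: gaussian_weight_def tr_def)
qed

lemma hermitian_integral:
  assumes "gint (\<lambda>x. f (hermitian_of_coords N x))"
  shows "(LINT M|hermitian_lebesgue N. gaussian_weight N M * f M) = GI (\<lambda>x. f (hermitian_of_coords N x))"
proof -
  let ?P = "\<Pi>\<^sub>M p\<in>{..<N} \<times> {..<N}. (lborel :: real measure)"
  have m: "(\<lambda>M. gaussian_weight N M * f M) \<in> borel_measurable (hermitian_lebesgue N)"
    unfolding hermitian_lebesgue_def
    by (rule measurable_embed_measure1)
      (use assms in \<open>simp add: gint_def gaussian_weight_coords borel_measurable_integrable\<close>)
  have h: "hermitian_of_coords N \<in> measurable ?P (hermitian_lebesgue N)"
    unfolding hermitian_lebesgue_def by (rule measurable_embed_measure2'[OF hermitian_of_coords_inj])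
  have "hermitian_lebesgue N = distr ?P (hermitian_lebesgue N) (hermitian_of_coords N)"
    using embed_measure_eq_distr'[OF hermitian_of_coords_inj] by (simp add: hermitian_lebesgue_def)
  then have "(LINT M|hermitian_lebesgue N. gaussian_weight N M * f M) =
      (LINT M|distr ?P (hermitian_lebesgue N) (hermitian_of_coords N). gaussian_weight N M * f M)"
    by simp
  also have "\<dots> = (LINT x|?P. gaussian_weight N (hermitian_of_coords N x) * f (hermitian_of_coords N x))"
    by (rule integral_distr[OF h m])
  finally show ?thesis by (simp add: gaussian_weight_coords GI_def)
qed

lemma partition_function_coeff: "mcoeff (partition_function N) m = GI (pot m) / GI (\<lambda>x. 1)"
proof -
  have "gint (\<lambda>x. 1)" by (rule pderiv_dir_gint'(1)[OF pderiv_dir.one])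
  moreover have "pot m = (\<lambda>x. mcoeff (potential_weight N (hermitian_of_coords N x)) m)"
    by (simp add: fun_eq_iff pot_def)
  ultimately show ?thesis
    using hermitian_integral[of "\<lambda>M. mcoeff (potential_weight N M) m"] hermitian_integral[of "\<lambda>M. 1"]
      gint_polys(3)[of m]
    by (simp add: partition_function_def)
qed

end


section \<open>Loop equations for the logarithm of the partition function\<close>

text \<open>The partial derivative d/da_(i+1), since index \<open>i\<close> stands for
  a_(i+1).\<close>

definition mpd :: "nat \<Rightarrow> 'a::comm_ring_1 mpser \<Rightarrow> 'a mpser" where
  "mpd i f = Abs_mpser (\<lambda>m. of_nat (count m i + 1) * mcoeff f (add_mset i m))"

lemma mcoeff_mpd: "mcoeff (mpd i f) m = of_nat (count m i + 1) * mcoeff f (add_mset i m)"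
  by (simp add: mpd_def)

text \<open>Rules for partial derivatives are inherited from the diagonal derivation by multiplying
  with the variable and cancelling it.\<close>

lemma avar_mpd: "avar (Suc i) * mpd i f = mdiag (\<lambda>m. of_nat (count m i)) f"
proof (rule mpser_eqI)
  fix m
  show "mcoeff (avar (Suc i) * mpd i f) m = mcoeff (mdiag (\<lambda>m. of_nat (count m i)) f) m"
  proof (cases "i \<in># m")
    case True
    then obtain m' where "m = add_mset i m'" by (blast dest: multi_member_split)
    then show ?thesis by (simp add: mcoeff_avar_mult mcoeff_mpd)
  next
    case False
    then have "count m i = 0" by (simp add: not_in_iff)
    with False show ?thesis by (simp add: mcoeff_avar_mult)
  qed
qed

lemma mpd_mult: "mpd i (f * g) = mpd i f * g + f * mpd i g"
proof (rule avar_mult_cancel)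
  show "avar (Suc i) * mpd i (f * g) = avar (Suc i) * (mpd i f * g + f * mpd i g)"
    unfolding distrib_left avar_mpd mdiag_mult[OF additive_weight_count]
    by (simp add: mult.left_commute[of _ f] flip: mult.assoc avar_mpd)
qed

lemma mpd_mconst_mult: "mpd i (mconst c * f) = mconst c * mpd i f"
  by (rule mpser_eqI) (simp add: mcoeff_mpd)

lemma mpd_mlog:
  assumes "const_term f = 1"
  shows "mpd i (mlog f) * f = mpd i f"
proof (rule avar_mult_cancel)
  show "avar (Suc i) * (mpd i (mlog f) * f) = avar (Suc i) * mpd i f"
    unfolding avar_mpd mult.assoc[symmetric] by (rule mdiag_mlog[OF additive_weight_count assms])
qed

lemma mtrunc_ext: "(\<And>K. mtrunc K f = mtrunc K g) \<Longrightarrow> f = g"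
proof (rule mpser_eqI)
  fix m assume *: "\<And>K. mtrunc K f = mtrunc K g"
  have "set_mset m \<subseteq> {..<Suc (Max (set_mset m))}" by (auto simp: le_imp_less_Suc)
  then show "mcoeff f m = mcoeff g m"
    using arg_cong[OF *[of "Suc (Max (set_mset m))"], of "\<lambda>f. mcoeff f m"]
    by (simp only: mcoeff_mtrunc if_True)
qed

lemma formal_sum_avar_mult:
  "formal_sum {1..} (\<lambda>n. avar n * f n) * g = formal_sum {1..} (\<lambda>n. avar n * (f n * g))"
  by (rule mtrunc_ext) (simp only: mtrunc_mult mtrunc_formal_sum_avar sum_distrib_right mult.assoc)

text \<open>The parameter \<open>e\<close> stands for \<open>1 / N\<^sup>2\<close>. The index \<open>k - 2 - r\<close> is truncated only when the
  factor \<open>k - 1 - r\<close> vanishes.\<close>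

definition topological_solution :: "complex \<Rightarrow> (nat \<Rightarrow> complex mpser) \<Rightarrow> bool" where
  "topological_solution e w \<longleftrightarrow> w 0 = 1 \<and> (\<forall>k. w (Suc k) =
     formal_sum {1..} (\<lambda>n. avar n * w (n - 1 + k)) +
     (\<Sum>r<k. w r * w (k - 1 - r) + mconst (of_nat (k - 1 - r) * e) * mpd (k - 2 - r) (w r)))"

context gue
begin

definition w_ser :: "nat \<Rightarrow> complex mpser" where
  "w_ser n = (if n = 0 then 1 else
     mconst (of_nat n / of_nat N ^ 2) * mpd (n - 1) (mlog (partition_function N)))"

definition T_ser :: "nat \<Rightarrow> complex mpser" where
  "T_ser n = Abs_mpser (\<lambda>m. GI (\<lambda>x. tr n x * pot m x) / GI (\<lambda>x. 1))"

lemma const_term_partition_function: "const_term (partition_function N) = 1"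
proof -
  have "pot {#} = (\<lambda>x. 1)" by (simp add: fun_eq_iff pot_empty)
  then show ?thesis using GI_1_nonzero by (simp add: const_term_def partition_function_coeff)
qed

text \<open>Inserting Tr H^s in front of the weight amounts to applying (s/N) d/da_s to it.\<close>

lemma GI_pot_add:
  assumes "s \<ge> 1"
  shows "GI (\<lambda>x. f x * tr s x * pot m x) =
    of_nat s / of_nat N * of_nat (count m (s - 1) + 1) * GI (\<lambda>x. f x * pot (add_mset (s - 1) m) x)"
proof -
  have "f x * tr s x * pot m x =
      of_nat s / of_nat N * of_nat (count m (s - 1) + 1) * (f x * pot (add_mset (s - 1) m) x)" for x
  proof -
    have s: "Suc (s - 1) = s" using assms by simp
    have nz: "(of_nat s :: complex) \<noteq> 0" "(of_nat N :: complex) \<noteq> 0" using assms N_pos by simp_all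
    have "of_nat s / of_nat N * of_nat (count m (s - 1) + 1) * (f x * pot (add_mset (s - 1) m) x) =
       of_nat s / of_nat N * f x * (of_nat (count m (s - 1) + 1) * pot (add_mset (s - 1) m) x)"
      by (simp only: mult_ac)
    also have "\<dots> = f x * tr s x * pot m x"
      unfolding pot_add s using nz by simp
    finally show ?thesis ..
  qed
  then show ?thesis by (simp only: GI_scale)
qed

lemma w_ser_0: "w_ser 0 = 1" by (simp add: w_ser_def)

lemma mpd_partition_function:
  assumes "n \<ge> 1"
  shows "mconst (of_nat n) * mpd (n - 1) (partition_function N) =
    mconst (of_nat N ^ 2) * w_ser n * partition_function N"
proof -
  have "mconst (of_nat N ^ 2) * w_ser n = mconst (of_nat n) * mpd (n - 1) (mlog (partition_function N))"
    using assms N_pos by (simp add: w_ser_def mult.assoc[symmetric] flip: mconst_mult)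
  then show ?thesis
    by (simp add: mult.assoc mpd_mlog[OF const_term_partition_function])
qed

lemma T_ser_eq: "T_ser n = mconst (of_nat N) * w_ser n * partition_function N"
proof (cases "n = 0")
  case True
  have "T_ser 0 = mconst (of_nat N) * partition_function N"
    by (rule mpser_eqI) (simp add: T_ser_def tr_0 partition_function_coeff GI_scale)
  then show ?thesis using True by (simp add: w_ser_0)
next
  case False
  then have n: "n \<ge> 1" by simp
  have "T_ser n = mconst (1 / of_nat N) * (mconst (of_nat n) * mpd (n - 1) (partition_function N))"
    using GI_pot_add[OF n, of "\<lambda>x. 1"]
    by (intro mpser_eqI) (simp add: T_ser_def mcoeff_mpd partition_function_coeff)
  also have "\<dots> = mconst (of_nat N) * w_ser n * partition_function N"
    unfolding mpd_partition_function[OF n] using N_pos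
    by (simp add: mult.assoc[symmetric] power2_eq_square flip: mconst_mult)
  finally show ?thesis .
qed

text \<open>Both traces become derivatives of Z = exp (log Z): the product of the w's is the
  disconnected part, and the derivative of w_r in a_s is the connected part, smaller by 1/N^2. For
  \<open>s = 0\<close> the trace is the constant N and the connected part has coefficient
  zero.\<close>

lemma GI_tr_tr:
  "GI (\<lambda>x. tr r x * tr s x * pot m x) / GI (\<lambda>x. 1) =
     mcoeff (mconst (of_nat N ^ 2) * ((w_ser r * w_ser s + mconst (of_nat s * (1 / of_nat N ^ 2)) * mpd (s - 1) (w_ser r))
       * partition_function N)) m"
proof (cases "s = 0")
  case True
  have "GI (\<lambda>x. tr r x * tr s x * pot m x) / GI (\<lambda>x. 1) = of_nat N * mcoeff (T_ser r) m"
    using GI_scale[of "of_nat N" "\<lambda>x. tr r x * pot m x"] by (simp add: True tr_0 T_ser_def mult_ac)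
  then show ?thesis
    by (simp add: True T_ser_eq w_ser_0 mconst_0 power2_eq_square mult.assoc)
next
  case False
  then have s: "s \<ge> 1" by simp
  have "GI (\<lambda>x. tr r x * tr s x * pot m x) / GI (\<lambda>x. 1) =
      mcoeff (mconst (of_nat s / of_nat N) * mpd (s - 1) (T_ser r)) m"
    unfolding GI_pot_add[OF s] by (simp add: mcoeff_mpd T_ser_def)
  also have "mconst (of_nat s / of_nat N) * mpd (s - 1) (T_ser r) =
      mconst (of_nat s) * mpd (s - 1) (w_ser r * partition_function N)"
    unfolding T_ser_eq mult.assoc mpd_mconst_mult using N_pos
    by (simp add: mult.assoc[symmetric] flip: mconst_mult)
  also have "\<dots> = mconst (of_nat s) * mpd (s - 1) (w_ser r) * partition_function N +
      w_ser r * (mconst (of_nat s) * mpd (s - 1) (partition_function N))"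
    by (simp add: mpd_mult algebra_simps)
  also have "\<dots> = mconst (of_nat N ^ 2) * ((w_ser r * w_ser s + mconst (of_nat s * (1 / of_nat N ^ 2)) * mpd (s - 1) (w_ser r))
       * partition_function N)"
  proof -
    have "mconst (of_nat N ^ 2) * mconst (of_nat s * (1 / of_nat N ^ 2)) = (mconst (of_nat s) :: complex mpser)"
      using N_pos by (simp flip: mconst_mult)
    note e = this
    show ?thesis
      unfolding mpd_partition_function[OF s] unfolding e[symmetric] by (simp only: distrib_left distrib_right mult_ac add_ac)
  qed
  finally show ?thesis .
qed

text \<open>Expressed through Z and the w's, the loop equation has a common factor N^2 Z, which is
  cancelled using that Z has constant term 1.\<close>

theorem topological_w_ser: "topological_solution (1 / of_nat N ^ 2) w_ser"
  unfolding topological_solution_def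
proof (intro conjI allI)
  fix k
  let ?Z = "partition_function N" and ?h = "1 / of_nat N ^ 2 :: complex"
  let ?P = "\<Sum>r<k. w_ser r * w_ser (k - 1 - r) + mconst (of_nat (k - 1 - r) * ?h) * mpd (k - 2 - r) (w_ser r)"
  have "mconst (of_nat N) * T_ser (Suc k) =
      mconst (of_nat N ^ 2) * (?P * ?Z) + mconst (of_nat N) * formal_sum {1..} (\<lambda>n. avar n * T_ser (n - 1 + k))"
  proof (rule mpser_eqI)
    fix m
    have "mcoeff (mconst (of_nat N) * T_ser (Suc k)) m =
        (of_nat N * GI (\<lambda>x. tr (Suc k) x * pot m x)) / GI (\<lambda>x. 1)"
      by (simp add: T_ser_def)
    also have "\<dots> =
      (\<Sum>r<k. GI (\<lambda>x. tr r x * tr (k - 1 - r) x * pot m x) / GI (\<lambda>x. 1)) +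
      of_nat N * (\<Sum>l\<in>set_mset m. GI (\<lambda>x. tr (l + k) x * pot (m - {#l#}) x) / GI (\<lambda>x. 1))"
      unfolding loop_equation
      by (simp only: add_divide_distrib times_divide_eq_right[symmetric] sum_divide_distrib)
    also have "(\<Sum>r<k. GI (\<lambda>x. tr r x * tr (k - 1 - r) x * pot m x) / GI (\<lambda>x. 1)) =
        mcoeff (mconst (of_nat N ^ 2) * (?P * ?Z)) m"
      unfolding GI_tr_tr by (simp add: sum_distrib_right sum_distrib_left mcoeff_sum numeral_2_eq_2)
    also have "(\<Sum>l\<in>set_mset m. GI (\<lambda>x. tr (l + k) x * pot (m - {#l#}) x) / GI (\<lambda>x. 1)) =
        mcoeff (formal_sum {1..} (\<lambda>n. avar n * T_ser (n - 1 + k))) m"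
      unfolding mcoeff_formal_sum_avar by (simp add: T_ser_def)
    finally show "mcoeff (mconst (of_nat N) * T_ser (Suc k)) m = mcoeff (mconst (of_nat N ^ 2) * (?P * ?Z) +
        mconst (of_nat N) * formal_sum {1..} (\<lambda>n. avar n * T_ser (n - 1 + k))) m"
      by simp
  qed
  moreover have "formal_sum {1..} (\<lambda>n. avar n * T_ser (n - 1 + k)) =
      mconst (of_nat N) * formal_sum {1..} (\<lambda>n. avar n * w_ser (n - 1 + k)) * ?Z"
  proof -
    have "avar n * T_ser (n - 1 + k) = avar n * (w_ser (n - 1 + k) * (mconst (of_nat N) * ?Z))" for n
      by (simp only: T_ser_eq mult_ac)
    then show ?thesis
      by (simp only: formal_sum_avar_mult[symmetric]) (simp only: mult_ac)
  qed
  ultimately have "mconst (of_nat N ^ 2) * w_ser (Suc k) * ?Z =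
      mconst (of_nat N ^ 2) * (formal_sum {1..} (\<lambda>n. avar n * w_ser (n - 1 + k)) + ?P) * ?Z"
    by (simp only: T_ser_eq) (simp add: power2_eq_square mconst_mult algebra_simps)
  then have "mconst (of_nat N ^ 2) * w_ser (Suc k) =
      mconst (of_nat N ^ 2) * (formal_sum {1..} (\<lambda>n. avar n * w_ser (n - 1 + k)) + ?P)"
    by (rule mpser_unit_cancel_eq[OF _ const_term_partition_function])
  then have "mconst ?h * mconst (of_nat N ^ 2) * w_ser (Suc k) =
      mconst ?h * mconst (of_nat N ^ 2) * (formal_sum {1..} (\<lambda>n. avar n * w_ser (n - 1 + k)) + ?P)"
    by (simp only: mult.assoc)
  then show "w_ser (Suc k) = formal_sum {1..} (\<lambda>n. avar n * w_ser (n - 1 + k)) + ?P"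
    using N_pos by (simp add: mconst_1 flip: mconst_mult)
qed (rule w_ser_0)

lemma mlog_partition_function_coeff:
  assumes "i \<in># m"
  shows "of_nat (Suc i) * of_nat (count m i) * mcoeff (mlog (partition_function N)) m =
    of_nat N ^ 2 * mcoeff (w_ser (Suc i)) (m - {#i#})"
proof -
  obtain m' where "m = add_mset i m'" using assms by (blast dest: multi_member_split)
  then show ?thesis using N_pos by (simp add: w_ser_def mcoeff_mpd)
qed

end


section \<open>The genus expansion\<close>

lemma mpd_weight: "mweight (add_mset i m) = Suc i + mweight m"
  by (simp add: mweight_def)

definition ratpoly :: "rat poly \<Rightarrow> complex \<Rightarrow> complex" where
  "ratpoly p e = poly (map_poly of_rat p) e"

lemma ratpoly_add: "ratpoly (p + q) e = ratpoly p e + ratpoly q e"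
proof -
  have "map_poly of_rat (p + q) = (map_poly of_rat p + map_poly of_rat q :: complex poly)"
    by (rule poly_eqI) (simp add: coeff_map_poly of_rat_add)
  then show ?thesis by (simp add: ratpoly_def)
qed

lemma ratpoly_mult: "ratpoly (p * q) e = ratpoly p e * ratpoly q e"
proof -
  have "map_poly of_rat (p * q) = (map_poly of_rat p * map_poly of_rat q :: complex poly)"
    by (rule poly_eqI) (simp add: coeff_map_poly coeff_mult of_rat_sum of_rat_mult)
  then show ?thesis by (simp add: ratpoly_def)
qed

lemma ratpoly_linear: "ratpoly [:a:] e = of_rat a" "ratpoly [:0, a:] e = of_rat a * e"
  by (simp_all add: ratpoly_def map_poly_pCons)

lemma ratpoly_sum: "ratpoly (\<Sum>i\<in>A. p i) e = (\<Sum>i\<in>A. ratpoly (p i) e)"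
  by (induction A rule: infinite_finite_induct) (simp_all add: ratpoly_add, simp_all add: ratpoly_def)

lemma ratpoly_altdef: "ratpoly p e = (\<Sum>g\<le>degree p. of_rat (coeff p g) * e ^ g)"
  by (simp add: ratpoly_def poly_altdef coeff_map_poly degree_map_poly)

text \<open>One polynomial in \<open>1 / N^2\<close> per coefficient, the same for all matrix sizes: the recursion
  for the coefficients lowers \<open>k\<close> plus the weight of the monomial.\<close>

lemma topological_coeff_poly:
  "\<exists>p :: rat poly. \<forall>e w. topological_solution e w \<longrightarrow> mcoeff (w k) m = ratpoly p e"
proof (induction "k + mweight m" arbitrary: k m rule: less_induct)
  case less
  show ?case
  proof (cases k)
    case 0
    have "mcoeff (w 0) m = ratpoly [:if m = {#} then 1 else 0:] e"
      if "topological_solution e w" for e w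
      using that by (simp add: topological_solution_def mcoeff_one ratpoly_linear)
    then show ?thesis using 0 by blast
  next
    case (Suc l)
    \<comment> \<open>Expressions that, on all solutions with parameter e, are given by one fixed
      rational polynomial in e. They are closed under sums and products, so the right side of the
      recursion can be treated term by term.\<close>
    define isP where "isP F \<longleftrightarrow> (\<exists>p :: rat poly. \<forall>e w. topological_solution e w \<longrightarrow>
      F e w = ratpoly p e)" for F :: "complex \<Rightarrow> (nat \<Rightarrow> complex mpser) \<Rightarrow> complex"
    have w: "isP (\<lambda>e w. mcoeff (w k') m')" if "k' + mweight m' < k + mweight m" for k' m'
      unfolding isP_def using less[OF that] .
    have add: "isP (\<lambda>e w. F e w + G e w)" if "isP F" "isP G" for F G
    proof -
      from that obtain p p' where "\<And>e w. topological_solution e w \<Longrightarrow> F e w = ratpoly p e"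
        "\<And>e w. topological_solution e w \<Longrightarrow> G e w = ratpoly p' e"
        unfolding isP_def by blast
      then show ?thesis unfolding isP_def
        by (intro exI[of _ "p + p'"]) (simp add: ratpoly_add)
    qed
    have mult: "isP (\<lambda>e w. F e w * G e w)" if "isP F" "isP G" for F G
    proof -
      from that obtain p p' where "\<And>e w. topological_solution e w \<Longrightarrow> F e w = ratpoly p e"
        "\<And>e w. topological_solution e w \<Longrightarrow> G e w = ratpoly p' e"
        unfolding isP_def by blast
      then show ?thesis unfolding isP_def
        by (intro exI[of _ "p * p'"]) (simp add: ratpoly_mult)
    qed
    have const: "isP (\<lambda>e w. of_nat c * e)" "isP (\<lambda>e w. of_nat c)" for c
    proof -
      show "isP (\<lambda>e w. of_nat c * e)"
        unfolding isP_def by (intro exI[of _ "[:0, of_nat c:]"]) (simp add: ratpoly_linear)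
      show "isP (\<lambda>e w. of_nat c)"
        unfolding isP_def by (intro exI[of _ "[:of_nat c:]"]) (simp add: ratpoly_linear)
    qed
    have sum: "isP (\<lambda>e w. \<Sum>i\<in>A. F i e w)" if "finite A" "\<And>i. i \<in> A \<Longrightarrow> isP (F i)"
      for A :: "'b set" and F
      using that
    proof (induction A rule: finite_induct)
      case empty
      then show ?case using const(2)[of 0] by simp
    qed (auto intro: add)
    have "isP (\<lambda>e w. (\<Sum>i\<in>set_mset m. mcoeff (w (i + l)) (m - {#i#})) +
      (\<Sum>r<l. (\<Sum>u\<in>{u. u \<subseteq># m}. mcoeff (w r) u * mcoeff (w (l - 1 - r)) (m - u)) +
         of_nat (l - 1 - r) * e * (of_nat (count m (l - 2 - r) + 1) * mcoeff (w r) (add_mset (l - 2 - r) m))))"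
    proof (intro add sum)
      show "isP (\<lambda>e w. mcoeff (w (i + l)) (m - {#i#}))" if "i \<in> set_mset m" for i
        using that mweight_remove[of i m] by (intro w) (simp add: Suc)
      fix r assume r: "r \<in> {..<l}"
      show "isP (\<lambda>e w. mcoeff (w r) u * mcoeff (w (l - 1 - r)) (m - u))" if "u \<in> {u. u \<subseteq># m}" for u
        using that r mweight_diff[of u m] by (intro mult w) (auto simp: Suc)
      show "isP (\<lambda>e w. of_nat (l - 1 - r) * e *
        (of_nat (count m (l - 2 - r) + 1) * mcoeff (w r) (add_mset (l - 2 - r) m)))"
      \<comment> \<open>If \<open>l - 1 - r\<close> vanishes, so does the term with the truncated
        index. Otherwise the added variable has weight \<open>l - 1 - r\<close>, and the measure
        becomes l - 1 plus the weight of \<open>m\<close>.\<close>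
      proof (cases "l - 1 - r = 0")
        case True
        then show ?thesis using const(2)[of 0] by simp
      next
        case False
        then show ?thesis
          using r by (intro mult const w) (auto simp: mpd_weight Suc)
      qed
    qed (auto intro: finite_submultisets)
    then obtain p where p: "\<And>e w. topological_solution e w \<Longrightarrow>
      (\<Sum>i\<in>set_mset m. mcoeff (w (i + l)) (m - {#i#})) +
      (\<Sum>r<l. (\<Sum>u\<in>{u. u \<subseteq># m}. mcoeff (w r) u * mcoeff (w (l - 1 - r)) (m - u)) +
         of_nat (l - 1 - r) * e * (of_nat (count m (l - 2 - r) + 1) * mcoeff (w r) (add_mset (l - 2 - r) m)))
      = ratpoly p e"
      unfolding isP_def by blast
    have "mcoeff (w k) m = ratpoly p e" if "topological_solution e w" for e w
    proof -
      have "w k = formal_sum {1..} (\<lambda>n. avar n * w (n - 1 + l)) +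
         (\<Sum>r<l. w r * w (l - 1 - r) + mconst (of_nat (l - 1 - r) * e) * mpd (l - 2 - r) (w r))"
        using that unfolding topological_solution_def Suc by blast
      then show ?thesis
        unfolding p[OF that, symmetric]
        by (simp only: mcoeff_simps mcoeff_formal_sum_avar mcoeff_sum mcoeff_mconst_mult mcoeff_mpd diff_Suc_1)
          (simp only: mcoeff_mult)
    qed
    then show ?thesis by blast
  qed
qed

definition wpoly :: "nat \<Rightarrow> nat multiset \<Rightarrow> rat poly" where
  "wpoly k m = (SOME p. \<forall>e w. topological_solution e w \<longrightarrow> mcoeff (w k) m = ratpoly p e)"

lemma wpoly: "topological_solution e w \<Longrightarrow> mcoeff (w k) m = ratpoly (wpoly k m) e"
  using someI_ex[OF topological_coeff_poly[of k m]] unfolding wpoly_def by blast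

abbreviation inv_sq :: "nat \<Rightarrow> complex" where
  "inv_sq N \<equiv> 1 / of_nat N ^ 2"

lemma infinite_inv_sq: "infinite (inv_sq ` {1..})"
proof -
  have "inj_on inv_sq {1..}"
    by (rule inj_onI) (auto simp: field_simps simp flip: of_nat_power)
  then show ?thesis by (simp add: finite_image_iff infinite_Ici)
qed

text \<open>The values 1/N^2 form an infinite set, so identities checked at matrix sizes lift to
  identities of polynomials.\<close>

lemma rat_poly_eqI:
  assumes "\<And>N. N \<ge> 1 \<Longrightarrow> ratpoly p (inv_sq N) = ratpoly q (inv_sq N)"
  shows "p = q"
proof -
  let ?d = "map_poly of_rat p - map_poly of_rat q :: complex poly"
  have "inv_sq ` {1..} \<subseteq> {x. poly ?d x = 0}" using assms by (auto simp: ratpoly_def)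
  then have "infinite {x. poly ?d x = 0}" using infinite_inv_sq finite_subset by blast
  then have "?d = 0" using poly_roots_finite by blast
  then have "coeff (map_poly of_rat p :: complex poly) n = coeff (map_poly of_rat q) n" for n by simp
  then show ?thesis by (simp add: poly_eq_iff coeff_map_poly)
qed

lemma topological_w_ser': "N \<ge> 1 \<Longrightarrow> topological_solution (inv_sq N) (gue.w_ser N)"
  using gue.topological_w_ser[OF gue.intro] by simp

definition wplanar :: "nat \<Rightarrow> rat mpser" where
  "wplanar k = Abs_mpser (\<lambda>m. coeff (wpoly k m) 0)"

text \<open>The recursion is first established between the polynomials \<open>wpoly\<close>, from
  its validity at every matrix size; passing to constant coefficients then removes the term with the
  factor 1/N^2.\<close>

lemma planar_wplanar: "planar_solution wplanar"
  unfolding planar_solution_def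
proof (intro conjI allI)
  have "wpoly 0 m = [:if m = {#} then 1 else 0:]" for m
    by (rule rat_poly_eqI) (auto simp: wpoly[OF topological_w_ser', symmetric] gue.w_ser_0[OF gue.intro]
        mcoeff_one ratpoly_linear)
  then show "wplanar 0 = 1" by (intro mpser_eqI) (simp add: wplanar_def mcoeff_one)
next
  fix k
  show "wplanar (Suc k) = formal_sum {1..} (\<lambda>n. avar n * wplanar (n - 1 + k)) + (\<Sum>r<k. wplanar r * wplanar (k - 1 - r))"
  proof (rule mpser_eqI)
    fix m
    let ?q = "(\<Sum>i\<in>set_mset m. wpoly (i + k) (m - {#i#})) +
      (\<Sum>r<k. (\<Sum>u\<in>{u. u \<subseteq># m}. wpoly r u * wpoly (k - 1 - r) (m - u)) +
         [:0, of_nat (k - 1 - r):] * ([:of_nat (count m (k - 2 - r) + 1):] * wpoly r (add_mset (k - 2 - r) m)))"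
    have "wpoly (Suc k) m = ?q"
    proof (rule rat_poly_eqI)
      fix N :: nat assume N: "N \<ge> 1"
      let ?w = "gue.w_ser N"
      note W = wpoly[OF topological_w_ser'[OF N], symmetric]
      have "?w (Suc k) = formal_sum {1..} (\<lambda>n. avar n * ?w (n - 1 + k)) +
         (\<Sum>r<k. ?w r * ?w (k - 1 - r) + mconst (of_nat (k - 1 - r) * inv_sq N) * mpd (k - 2 - r) (?w r))"
        using topological_w_ser'[OF N] unfolding topological_solution_def by blast
      then have "mcoeff (?w (Suc k)) m = (\<Sum>i\<in>set_mset m. mcoeff (?w (i + k)) (m - {#i#})) +
        (\<Sum>r<k. (\<Sum>u\<in>{u. u \<subseteq># m}. mcoeff (?w r) u * mcoeff (?w (k - 1 - r)) (m - u)) +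
          of_nat (k - 1 - r) * inv_sq N * (of_nat (count m (k - 2 - r) + 1) * mcoeff (?w r) (add_mset (k - 2 - r) m)))"
        by (simp only: mcoeff_simps mcoeff_formal_sum_avar mcoeff_sum mcoeff_mconst_mult mcoeff_mpd diff_Suc_1)
          (simp only: mcoeff_mult)
      also have "\<dots> = ratpoly ?q (inv_sq N)"
        unfolding wpoly[OF topological_w_ser'[OF N]]
        by (simp only: ratpoly_add ratpoly_mult ratpoly_sum ratpoly_linear of_rat_of_nat_eq)
      finally show "ratpoly (wpoly (Suc k) m) (inv_sq N) = ratpoly ?q (inv_sq N)"
        unfolding W .
    qed
    then have "coeff (wpoly (Suc k) m) 0 = (\<Sum>i\<in>set_mset m. coeff (wpoly (i + k) (m - {#i#})) 0) +
        (\<Sum>r<k. \<Sum>u\<in>{u. u \<subseteq># m}. coeff (wpoly r u) 0 * coeff (wpoly (k - 1 - r) (m - u)) 0)"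
      by (simp add: coeff_sum coeff_mult_0)
    then show "mcoeff (wplanar (Suc k)) m = mcoeff (formal_sum {1..} (\<lambda>n. avar n * wplanar (n - 1 + k)) +
        (\<Sum>r<k. wplanar r * wplanar (k - 1 - r))) m"
      by (simp only: mcoeff_simps mcoeff_formal_sum_avar mcoeff_sum mcoeff_mult diff_Suc_1)
        (simp add: wplanar_def)
  qed
qed

text \<open>Integrates w_n = (n/N^2) d(log Z)/da_n along an arbitrary variable of the monomial. The
  empty monomial gets 0, as log Z has no constant term.\<close>

definition Fpoly :: "nat multiset \<Rightarrow> rat poly" where
  "Fpoly m = (if m = {#} then 0 else let i = (SOME i. i \<in># m) in
     [:1 / (of_nat (Suc i) * of_nat (count m i)):] * wpoly (Suc i) (m - {#i#}))"

lemma Fpoly_nonempty: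
  assumes "m \<noteq> {#}"
  obtains i where "i \<in># m" "Fpoly m = [:1 / (of_nat (Suc i) * of_nat (count m i)):] * wpoly (Suc i) (m - {#i#})"
proof
  have "\<exists>i. i \<in># m" using assms by (meson multiset_nonemptyE)
  then show "(SOME i. i \<in># m) \<in># m" by (rule someI_ex)
  show "Fpoly m = [:1 / (of_nat (Suc (SOME i. i \<in># m)) * of_nat (count m (SOME i. i \<in># m))):] *
      (wpoly (Suc (SOME i. i \<in># m)) (m - {#SOME i. i \<in># m#}))"
    using assms by (simp add: Fpoly_def Let_def)
qed

lemma Fpoly:
  assumes N: "N \<ge> 1"
  shows "mcoeff (mlog (partition_function N)) m = of_nat N ^ 2 * ratpoly (Fpoly m) (inv_sq N)"
proof (cases "m = {#}")
  case True
  then show ?thesis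
    using const_term_mlog[OF gue.const_term_partition_function[OF gue.intro[OF N]]]
    by (simp add: Fpoly_def const_term_def ratpoly_def)
next
  case False
  then obtain i where i: "i \<in># m"
    and F: "Fpoly m = [:1 / (of_nat (Suc i) * of_nat (count m i)):] * wpoly (Suc i) (m - {#i#})"
    by (rule Fpoly_nonempty)
  have nz: "of_nat (Suc i) * of_nat (count m i) \<noteq> (0 :: complex)" using i by (simp del: of_nat_Suc)
  have "of_nat (Suc i) * of_nat (count m i) * mcoeff (mlog (partition_function N)) m =
      of_nat N ^ 2 * ratpoly (wpoly (Suc i) (m - {#i#})) (inv_sq N)"
    using gue.mlog_partition_function_coeff[OF gue.intro[OF N] i]
    by (simp only: wpoly[OF topological_w_ser'[OF N]])
  then have "mcoeff (mlog (partition_function N)) m =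
      of_nat N ^ 2 * (ratpoly (wpoly (Suc i) (m - {#i#})) (inv_sq N) / (of_nat (Suc i) * of_nat (count m i)))"
    using nz by (simp add: eq_divide_eq mult_ac del: of_nat_Suc)
  then show ?thesis
    by (simp add: F ratpoly_mult ratpoly_linear of_rat_divide of_rat_mult del: mult_pCons_left of_nat_Suc)
qed

text \<open>Independence of the variable chosen in \<open>Fpoly\<close>: for each N all choices
  recover the same coefficient of log Z, and infinitely many N decide.\<close>

lemma Fpoly_wpoly:
  assumes "i \<in># m"
  shows "[:of_nat (Suc i) * of_nat (count m i):] * Fpoly m = wpoly (Suc i) (m - {#i#})"
proof (rule rat_poly_eqI)
  fix N :: nat assume N: "N \<ge> 1"
  have "of_nat N ^ 2 * (of_nat (Suc i) * of_nat (count m i) * ratpoly (Fpoly m) (inv_sq N)) =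
      of_nat N ^ 2 * ratpoly (wpoly (Suc i) (m - {#i#})) (inv_sq N)"
    using gue.mlog_partition_function_coeff[OF gue.intro[OF N] assms]
    by (simp only: wpoly[OF topological_w_ser'[OF N]] Fpoly[OF N] mult_ac)
  then show "ratpoly ([:of_nat (Suc i) * of_nat (count m i):] * Fpoly m) (inv_sq N) =
      ratpoly (wpoly (Suc i) (m - {#i#})) (inv_sq N)"
    using N by (simp add: ratpoly_mult ratpoly_linear of_rat_mult del: mult_pCons_left of_nat_Suc)
qed

lemma genus_sum:
  assumes N: "N \<ge> 1" and fin: "finite {g. coeff p g \<noteq> 0}"
  shows "(\<Sum>g | coeff p g \<noteq> 0. of_nat N powi (2 - 2 * int g) * of_rat (coeff p g)) =
    of_nat N ^ 2 * ratpoly p (inv_sq N)"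
proof -
  have pw: "(of_nat N :: complex) powi (2 - 2 * int g) = of_nat N ^ 2 * inv_sq N ^ g" for g
  proof -
    have "(of_nat N :: complex) powi (2 - 2 * int g) = of_nat N powi 2 / of_nat N powi (2 * int g)"
      using N by (simp add: power_int_diff)
    also have "(of_nat N :: complex) powi (2 * int g) = (of_nat N ^ 2) ^ g"
      by (simp add: power_int_mult power_int_of_nat flip: power_mult)
    finally show ?thesis by (simp add: power_divide)
  qed
  have "ratpoly p (inv_sq N) = (\<Sum>g\<le>degree p. of_rat (coeff p g) * inv_sq N ^ g)"
    by (rule ratpoly_altdef)
  also have "\<dots> = (\<Sum>g | coeff p g \<noteq> 0. of_rat (coeff p g) * inv_sq N ^ g)"
    by (rule sum.mono_neutral_right) (auto simp: le_degree)
  finally show ?thesis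
    by (simp only: pw sum_distrib_left) (simp only: mult_ac)
qed

text \<open>For a fixed monomial, finiteness in g makes the candidate coefficients into a polynomial
  in 1/N^2, and its values at all matrix sizes are prescribed.\<close>

theorem genus_expansion_iff: "genus_expansion F \<longleftrightarrow> (\<forall>g m. mcoeff (F g) m = coeff (Fpoly m) g)"
proof
  assume F: "genus_expansion F"
  show "\<forall>g m. mcoeff (F g) m = coeff (Fpoly m) g"
  proof (intro allI)
    fix g m
    have fin: "finite {g. mcoeff (F g) m \<noteq> 0}" using F by (simp add: genus_expansion_def)
    define p where "p = Abs_poly (\<lambda>g. mcoeff (F g) m)"
    have p: "coeff p g = mcoeff (F g) m" for g
      unfolding p_def using fin by (subst Abs_poly_inverse) (simp_all add: MOST_iff_cofinite)
    have "p = Fpoly m"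
    proof (rule rat_poly_eqI)
      fix N :: nat assume N: "N \<ge> 1"
      have "of_nat N ^ 2 * ratpoly p (inv_sq N) = mcoeff (mlog (partition_function N)) m"
        using F N genus_sum[OF N, of p] fin unfolding genus_expansion_def p by simp
      then show "ratpoly p (inv_sq N) = ratpoly (Fpoly m) (inv_sq N)"
        unfolding Fpoly[OF N] using N by (metis mult_left_cancel not_one_le_zero of_nat_eq_0_iff power_not_zero)
    qed
    then show "mcoeff (F g) m = coeff (Fpoly m) g" using p by simp
  qed
next
  assume F: "\<forall>g m. mcoeff (F g) m = coeff (Fpoly m) g"
  have "finite {g. coeff (Fpoly m) g \<noteq> 0}" for m
    using MOST_coeff_eq_0[of "Fpoly m"] by (simp add: MOST_iff_cofinite)
  then show "genus_expansion F"
    unfolding genus_expansion_def using F Fpoly genus_sum by simp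
qed

lemma free_energy_coeff: "mcoeff (free_energy g) m = coeff (Fpoly m) g"
proof -
  define F0 :: "nat \<Rightarrow> rat mpser" where "F0 = (\<lambda>g. Abs_mpser (\<lambda>m. coeff (Fpoly m) g))"
  have "genus_expansion (THE F. genus_expansion F)"
  proof (rule theI[of _ F0])
    show "genus_expansion F0" by (simp add: genus_expansion_iff F0_def)
  next
    fix F assume "genus_expansion F"
    then show "F = F0" by (intro ext mpser_eqI) (simp add: genus_expansion_iff F0_def)
  qed
  then have "genus_expansion free_energy" by (simp only: free_energy_def)
  then show ?thesis by (simp add: genus_expansion_iff)
qed

lemma free_energy_0_wplanar:
  assumes "n \<ge> 1"
  shows "of_nat n * mdiag (\<lambda>m. of_nat (count m (n - 1))) (free_energy 0) = avar n * wplanar n"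
proof (rule mpser_eqI)
  fix m
  have n: "Suc (n - 1) = n" using assms by simp
  show "mcoeff (of_nat n * mdiag (\<lambda>m. of_nat (count m (n - 1))) (free_energy 0)) m = mcoeff (avar n * wplanar n) m"
  proof (cases "n - 1 \<in># m")
    case True
    then show ?thesis
      using arg_cong[OF Fpoly_wpoly[OF True], of "\<lambda>p. coeff p 0"]
      by (simp only: n mcoeff_of_nat_mult mcoeff_mdiag free_energy_coeff mcoeff_avar_mult if_True wplanar_def
          mcoeff_Abs coeff_smult mult.assoc mult_pCons_left mult_zero_left pCons_0_0 add_0_right)
  next
    case False
    then have "count m (n - 1) = 0" by (simp only: not_in_iff)
    with False show ?thesis by (simp only: mcoeff_of_nat_mult mcoeff_mdiag mcoeff_avar_mult if_False of_nat_0 mult_zero_left mult_zero_right)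
  qed
qed

theorem free_energy_0_mlog_R:
  "(euler_weight m + 2) * (euler_weight m + 4) * mcoeff (free_energy 0) m = 4 * mcoeff (mlog R_ser) m"
  by (rule planar_free_energy_eq[OF planar_wplanar _ free_energy_0_wplanar])
    (simp_all add: const_term_def free_energy_coeff Fpoly_def)


section \<open>The scaled series\<close>

definition admissible :: "nat multiset \<Rightarrow> bool" where
  "admissible m \<longleftrightarrow> (\<forall>i\<in>#m. i \<ge> 2)"

definition scale_degree :: "nat multiset \<Rightarrow> nat" where
  "scale_degree m = (\<Sum>i\<in>#m. i - 1)"

text \<open>The coefficient of t^k is the part of degree 2 k in t^(1/2); odd degrees are dropped, so
  this agrees with \<open>scale_t\<close> only for even series.\<close>

definition scaled :: "'a::comm_ring_1 mpser \<Rightarrow> 'a mpser fps" where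
  "scaled f = Abs_fps (\<lambda>k. Abs_mpser (\<lambda>m.
     if admissible m \<and> scale_degree m = 2 * k then mcoeff f m else 0))"

lemma scaled_nth:
  "mcoeff (fps_nth (scaled f) k) m = (if admissible m \<and> scale_degree m = 2 * k then mcoeff f m else 0)"
  by (simp add: scaled_def)

lemma scale_sqrt_nth:
  "mcoeff (fps_nth (scale_sqrt f) k) m = (if admissible m \<and> scale_degree m = k then mcoeff f m else 0)"
proof -
  have "(\<Sum>n\<in>#image_mset Suc m. n - 2) = scale_degree m"
    by (simp add: scale_degree_def image_mset.compositionality comp_def numeral_2_eq_2)
  moreover have "(\<forall>n\<in>#image_mset Suc m. n \<ge> 3) \<longleftrightarrow> admissible m"
    by (auto simp: admissible_def)
  ultimately show ?thesis by (simp add: scale_sqrt_def Let_def)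
qed

text \<open>Weight and degree differ by an even number, which identifies parity of the total index
  with parity of the power of t^(1/2). Each a_n with n >= 3 adds at least 1 to the degree, whence
  the size bound.\<close>

lemma admissible_weight:
  "admissible m \<Longrightarrow> mweight m = scale_degree m + 2 * size m \<and> size m \<le> scale_degree m"
  by (induction m) (auto simp: admissible_def mweight_def scale_degree_def)

lemma euler_weight_eq: "euler_weight m = of_nat (mweight m) - 2 * of_nat (size m)"
  by (induction m) (auto simp: euler_weight_def mweight_def algebra_simps)

lemma scale_t_eq_scaled:
  assumes "mparity 0 f"
  shows "scale_t f = scaled f"
  unfolding scale_t_def
proof (rule the_equality)
  show "scaled f oo fps_X ^ 2 = scale_sqrt f"
  proof (rule fps_ext, rule mpser_eqI)
    fix k m
    have "even (scale_degree m)" if "admissible m" "mcoeff f m \<noteq> 0"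
    proof -
      have "even (mweight m)" using assms that(2) unfolding mparity_def by (metis add_0_right)
      then show ?thesis using admissible_weight[OF that(1)] by simp
    qed
    then show "mcoeff (fps_nth (scaled f oo fps_X ^ 2) k) m = mcoeff (fps_nth (scale_sqrt f) k) m"
      by (auto simp: fps_nth_compose_X_power scaled_nth scale_sqrt_nth)
  qed
next
  fix P assume P: "P oo fps_X ^ 2 = scale_sqrt f"
  show "P = scaled f"
  proof (rule fps_ext, rule mpser_eqI)
    fix k m
    have "fps_nth P k = fps_nth (P oo fps_X ^ 2) (2 * k)" by (simp add: fps_nth_compose_X_power)
    then show "mcoeff (fps_nth P k) m = mcoeff (fps_nth (scaled f) k) m"
      unfolding P by (simp add: scale_sqrt_nth scaled_nth)
  qed
qed

text \<open>Evenness of one factor suffices: in a monomial of even degree, a part of even degree has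
  a complement of even degree.\<close>

lemma scaled_mult:
  assumes "mparity 0 f"
  shows "scaled (f * g) = scaled f * scaled g"
proof (rule fps_ext, rule mpser_eqI)
  fix k m
  have split: "admissible m \<longleftrightarrow> admissible u \<and> admissible (m - u)"
    "scale_degree m = scale_degree u + scale_degree (m - u)" if "u \<subseteq># m" for u
  proof -
    have m: "m = u + (m - u)" using that by simp
    show "admissible m \<longleftrightarrow> admissible u \<and> admissible (m - u)"
      unfolding admissible_def by (subst (1) m) (auto simp only: set_mset_union)
    show "scale_degree m = scale_degree u + scale_degree (m - u)"
      unfolding scale_degree_def by (subst (1) m) (simp only: image_mset_union sum_mset.union)
  qed
  have "mcoeff (fps_nth (scaled f * scaled g) k) m =
      (\<Sum>u | u \<subseteq># m. \<Sum>j\<le>k. mcoeff (fps_nth (scaled f) j) u * mcoeff (fps_nth (scaled g) (k - j)) (m - u))"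
    unfolding fps_mult_nth mcoeff_sum mcoeff_mult atLeast0AtMost by (rule sum.swap)
  also have "\<dots> = (\<Sum>u | u \<subseteq># m. if admissible m \<and> scale_degree m = 2 * k then mcoeff f u * mcoeff g (m - u) else 0)"
  proof (rule sum.cong)
    fix u assume "u \<in> {u. u \<subseteq># m}"
    then have u: "u \<subseteq># m" by simp
    show "(\<Sum>j\<le>k. mcoeff (fps_nth (scaled f) j) u * mcoeff (fps_nth (scaled g) (k - j)) (m - u)) =
        (if admissible m \<and> scale_degree m = 2 * k then mcoeff f u * mcoeff g (m - u) else 0)"
    proof (cases "admissible m \<and> scale_degree m = 2 * k \<and> even (scale_degree u)")
      case True
      then obtain j0 where j0: "scale_degree u = 2 * j0" by (elim conjE evenE)
      have "(\<Sum>j\<le>k. mcoeff (fps_nth (scaled f) j) u * mcoeff (fps_nth (scaled g) (k - j)) (m - u)) =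
          (\<Sum>j\<le>k. if j = j0 then mcoeff f u * mcoeff g (m - u) else 0)"
        using True split[OF u] j0 by (intro sum.cong) (auto simp: scaled_nth)
      moreover have "j0 \<le> k" using True split[OF u] j0 by simp
      ultimately show ?thesis using True by simp
    next
      case False
      have "mcoeff f u = 0" if "admissible m" "odd (scale_degree u)"
        using that split[OF u] admissible_weight[of u] assms by (auto simp: mparity_def)
      moreover have "mcoeff (fps_nth (scaled f) j) u * mcoeff (fps_nth (scaled g) (k - j)) (m - u) = 0" if "j \<le> k" for j
        using False split[OF u] that by (auto simp: scaled_nth)
      ultimately show ?thesis using False by auto
    qed
  qed simp
  also have "\<dots> = mcoeff (fps_nth (scaled (f * g)) k) m"
    by (cases "admissible m \<and> scale_degree m = 2 * k") (auto simp: scaled_nth mcoeff_mult)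
  finally show "mcoeff (fps_nth (scaled (f * g)) k) m = mcoeff (fps_nth (scaled f * scaled g) k) m" ..
qed

lemma scaled_one: "scaled 1 = 1"
  by (rule fps_ext, rule mpser_eqI)
    (auto simp: scaled_nth mcoeff_one fps_one_nth admissible_def scale_degree_def)

lemma scaled_diff: "scaled (f - g) = scaled f - scaled g"
  by (rule fps_ext, rule mpser_eqI) (simp add: scaled_nth)

lemma scaled_power: "mparity 0 f \<Longrightarrow> scaled (f ^ n) = scaled f ^ n"
  by (induction n) (simp_all add: scaled_one scaled_mult)

lemma mparity_diff: "mparity e f \<Longrightarrow> mparity e g \<Longrightarrow> mparity e (f - g)"
  by (simp add: mparity_def)

lemma mparity_one: "mparity 0 1"
  using mparity_mconst[of 1] by (simp add: mconst_1)

lemma mparity_mlog: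
  assumes f: "mparity 0 f" "const_term f = 1"
  shows "mparity 0 (mlog f)"
  unfolding mparity_def
proof (intro allI impI)
  fix m assume m: "odd (mweight m + 0)"
  have c: "const_term (f - 1) = 0" using f(2) by (simp add: const_term_def mcoeff_one)
  have "mparity 0 ((f - 1) ^ k)" for k
    using mparity_power[OF mparity_diff[OF f(1) mparity_one], of k] by simp
  then have "mcoeff ((f - 1) ^ k) m = 0" for k using m by (simp add: mparity_def)
  then show "mcoeff (mlog f) m = 0"
    using mcoeff_mcompose[OF c order_refl, where P = "fps_ln 1"] by (simp add: mlog_def)
qed

text \<open>The two logarithms cut their series differently, by the degree k in t and by the size of
  the monomial, which can reach 2 k. Powers beyond k do not contribute, because
  \<open>scaled f - 1\<close> has no term of degree 0 in t.\<close>

lemma fps_log_scaled: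
  fixes f :: "'a::field_char_0 mpser"
  assumes f: "mparity 0 f" "const_term f = 1"
  shows "fps_log (scaled f) = scaled (mlog f)"
proof (rule fps_ext, rule mpser_eqI)
  fix k m
  let ?l = "fps_nth (fps_ln (1 :: 'a))"
  have c: "const_term (f - 1) = 0" using f(2) by (simp add: const_term_def mcoeff_one)
  have p: "mparity 0 (f - 1)" by (rule mparity_diff[OF f(1) mparity_one])
  have pow: "(scaled f - 1) ^ i = scaled ((f - 1) ^ i)" for i
    by (simp add: scaled_power[OF p] scaled_diff scaled_one)
  have lhs: "mcoeff (fps_nth (fps_log (scaled f)) k) m = (\<Sum>i\<le>k. ?l i * mcoeff (fps_nth (scaled ((f - 1) ^ i)) k) m)"
    by (simp add: fps_log_def fps_compose_nth pow mcoeff_sum atLeast0AtMost)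
  show "mcoeff (fps_nth (fps_log (scaled f)) k) m = mcoeff (fps_nth (scaled (mlog f)) k) m"
  proof (cases "admissible m \<and> scale_degree m = 2 * k")
    case True
    have s0: "fps_nth (scaled f - 1) 0 = 0"
    proof (rule mpser_eqI)
      fix m
      have "m = {#}" if "admissible m" "scale_degree m = 0" using admissible_weight[of m] that by simp
      then show "mcoeff (fps_nth (scaled f - 1) 0) m = mcoeff 0 m"
        using f(2) by (auto simp: scaled_nth mcoeff_one const_term_def admissible_def scale_degree_def)
    qed
    have z: "mcoeff ((f - 1) ^ i) m = 0" if "i > k" for i
    proof -
      have "fps_nth ((scaled f - 1) ^ i) k = 0"
        using startsby_zero_power_prefix[OF s0] that by blast
      then show ?thesis
        using arg_cong[OF pow[of i], of "\<lambda>F. mcoeff (fps_nth F k) m"] True by (simp add: scaled_nth)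
    qed
    have "mcoeff (mlog f) m = (\<Sum>i\<le>2 * k. ?l i * mcoeff ((f - 1) ^ i) m)"
      unfolding mlog_def using True admissible_weight[of m] by (intro mcoeff_mcompose c) simp
    also have "\<dots> = (\<Sum>i\<le>k. ?l i * mcoeff ((f - 1) ^ i) m)"
      by (rule sum.mono_neutral_right) (use z in auto)
    finally show ?thesis unfolding lhs using True by (simp add: scaled_nth)
  next
    case False
    then show ?thesis unfolding lhs by (auto simp: scaled_nth intro!: sum.neutral)
  qed
qed

text \<open>For odd total index the Euler weight is an odd integer, so neither factor in
  \<open>free_energy_0_mlog_R\<close> vanishes and evenness passes from log R to F_0.\<close>

lemma mparity_free_energy_0: "mparity 0 (free_energy 0)"
  unfolding mparity_def
proof (intro allI impI)
  fix m assume m: "odd (mweight m + 0)"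
  have "const_term R_ser = 1" using RS_system_ser by (simp add: RS_system_def)
  then have "mcoeff (mlog R_ser) m = 0"
    using mparity_mlog[OF mparity_R_ser] m by (simp add: mparity_def)
  moreover have "euler_weight m + 2 \<noteq> 0" "euler_weight m + 4 \<noteq> 0"
  proof -
    have e: "euler_weight m = of_int (int (mweight m) - 2 * int (size m))"
      by (simp add: euler_weight_eq)
    have "int (mweight m) - 2 * int (size m) + 2 \<noteq> 0" "int (mweight m) - 2 * int (size m) + 4 \<noteq> 0"
      using m by presburger+
    then have "(of_int (int (mweight m) - 2 * int (size m) + 2) :: rat) \<noteq> 0"
      "(of_int (int (mweight m) - 2 * int (size m) + 4) :: rat) \<noteq> 0"
      by (simp_all only: of_int_eq_0_iff not_False_eq_True)
    then show "euler_weight m + 2 \<noteq> 0" "euler_weight m + 4 \<noteq> 0"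
      unfolding e by (simp_all only: of_int_add of_int_numeral not_False_eq_True)
  qed
  ultimately show "mcoeff (free_energy 0) m = 0"
    using free_energy_0_mlog_R[of m] by simp
qed

text \<open>The monomials in the coefficient of t^k have Euler weight 2 k, so the factor 4
  cancels.\<close>

lemma F0_f_log_R_f: "of_nat ((k + 1) * (k + 2)) * fps_nth F0_f k = fps_nth (fps_log R_f) k"
proof (rule mpser_eqI)
  fix m
  have R: "const_term R_ser = 1" using RS_system_ser by (simp add: RS_system_def)
  have F: "F0_f = scaled (free_energy 0)" "fps_log R_f = scaled (mlog R_ser)"
    unfolding F0_f_def R_f_def
    by (simp_all add: scale_t_eq_scaled mparity_free_energy_0 mparity_R_ser fps_log_scaled R)
  show "mcoeff (of_nat ((k + 1) * (k + 2)) * fps_nth F0_f k) m = mcoeff (fps_nth (fps_log R_f) k) m"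
  proof (cases "admissible m \<and> scale_degree m = 2 * k")
    case True
    then have "euler_weight m = 2 * of_nat k"
      using admissible_weight[of m] by (simp add: euler_weight_eq)
    then have "(of_nat k + 1) * (of_nat k + 2) * mcoeff (free_energy 0) m = mcoeff (mlog R_ser) m"
      using free_energy_0_mlog_R[of m] by (simp add: algebra_simps)
    then show ?thesis using True by (simp only: F mcoeff_of_nat_mult scaled_nth if_True) (simp add: algebra_simps)
  next
    case False
    then show ?thesis by (auto simp only: F mcoeff_of_nat_mult scaled_nth if_False mult_zero_right)
  qed
qed

text \<open>The kernel turns t^k into (1/(k+1) - 1/(k+2)) t^(k+2), and this factor is the inverse of
  (k+1)(k+2).\<close>

lemma fps_int_kernel_log_R_f: "fps_int_kernel (fps_log R_f) = fps_X ^ 2 * F0_f"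
proof (rule fps_ext)
  fix n
  show "fps_nth (fps_int_kernel (fps_log R_f)) n = fps_nth (fps_X ^ 2 * F0_f) n"
  proof (cases "n < 2")
    case True
    then have "n = 0 \<or> n = 1" by auto
    then show ?thesis by (auto simp: fps_int_kernel_def fps_int0_def fps_X_power_mult_nth)
  next
    case False
    then obtain k where n: "n = Suc (Suc k)" by (metis add_2_eq_Suc le_Suc_ex not_less)
    have "fps_nth (fps_int_kernel (fps_log R_f)) n =
        mconst (1 / of_nat (Suc k)) * fps_nth (fps_log R_f) k - mconst (1 / of_nat (Suc (Suc k))) * fps_nth (fps_log R_f) k"
      by (simp add: fps_int_kernel_def fps_int0_def n del: of_nat_Suc)
    also have "\<dots> = fps_nth F0_f k"
    proof (rule mpser_eqI)
      fix m
      have "(1 / of_nat (Suc k) - 1 / of_nat (Suc (Suc k))) * of_nat ((k + 1) * (k + 2)) = (1 :: rat)"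
      proof -
        define a b where "a = (of_nat (Suc k) :: rat)" and "b = (of_nat (Suc (Suc k)) :: rat)"
        have ab: "a \<noteq> 0" "b \<noteq> 0" "b - a = 1" by (simp_all add: a_def b_def)
        have "of_nat ((k + 1) * (k + 2)) = a * b" by (simp add: a_def b_def algebra_simps)
        moreover have "(1 / a - 1 / b) * (a * b) = b - a" using ab(1,2) by (simp add: field_simps)
        ultimately show ?thesis using ab(3) by (simp only: a_def b_def)
      qed
      then show "mcoeff (mconst (1 / of_nat (Suc k)) * fps_nth (fps_log R_f) k -
          mconst (1 / of_nat (Suc (Suc k))) * fps_nth (fps_log R_f) k) m = mcoeff (fps_nth F0_f k) m"
        unfolding F0_f_log_R_f[symmetric]
        by (simp only: mcoeff_simps mcoeff_mconst_mult mcoeff_of_nat_mult)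
          (simp only: mult.assoc[symmetric] left_diff_distrib[symmetric] mult_1)
    qed
    finally show ?thesis by (simp add: n fps_X_power_mult_nth)
  qed
qed

theorem theorem1p4:
  shows "fps_to_fls F0_f = fls_X_intpow (-2) * fps_to_fls (fps_int_kernel (fps_log R_f))
       \<and> fps_deriv (fps_deriv (fps_X ^ 2 * F0_f)) = fps_log R_f"
proof
  show "fps_to_fls F0_f = fls_X_intpow (-2) * fps_to_fls (fps_int_kernel (fps_log R_f))"
    unfolding fps_int_kernel_log_R_f fls_X_intpow_times_conv_shift(1)
    by (rule fls_eqI) (auto simp: fps_X_power_mult_nth nat_add_distrib)
  show "fps_deriv (fps_deriv (fps_X ^ 2 * F0_f)) = fps_log R_f"
  proof (rule fps_ext)
    fix k
    have "fps_nth (fps_deriv (fps_deriv (fps_X ^ 2 * F0_f))) k = of_nat ((k + 1) * (k + 2)) * fps_nth F0_f k"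
      by (simp only: fps_deriv_nth fps_X_power_mult_nth) (simp add: algebra_simps)
    then show "fps_nth (fps_deriv (fps_deriv (fps_X ^ 2 * F0_f))) k = fps_nth (fps_log R_f) k"
      unfolding F0_f_log_R_f .
  qed
qed

end
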